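(* Let $\alpha,\beta,\gamma$ be three partitions. There exist integers $k'_1,k'_2,k'_3$ and integers $A_{\alpha,\beta,\gamma}$, $B_{\alpha,\beta,\gamma}$, $C_{\alpha,\beta,\gamma}$ such that, for all integers $a\ge\alpha_1$, $b\ge\beta_1$, $c\ge\gamma_1$ satisfying $$a-b\ge k'_1,\qquad a-c\ge k'_2,\qquad b+c-a\ge k'_3,$$ we have $$\overline{g}_{(a,\alpha),(b,\beta),(c,\gamma)}=\tfrac12A_{\alpha,\beta,\gamma}\cdot(b+c-a)+B_{\alpha,\beta,\gamma}-\begin{cases}0&\text{if } b+c-a\text{ is even},\\ \tfrac12 C_{\alpha,\beta,\gamma}&\text{if } b+c-a\text{ is odd}.\end{cases}$$
   Context: Partitions are weakly decreasing sequences of nonnegative integers, identified up to trailing zeros; $|\lambda|$ is the sum of the parts, and $\lambda_1$ is the first part ($0$ for the empty partition). For $a\ge\alpha_1$, $(a,\alpha)$ is the partition $(a,\alpha_1,\alpha_2,\ldots)$. Kronecker coefficients: for partitions $\lambda,\mu,\nu$ of the same integer $n$, $g_{\lambda,\mu,\nu}$ is the multiplicity of the irreducible representation of the symmetric group $S_n$ indexed by $\lambda$ in the tensor product of those indexed by $\mu$ and $\nu$. Reduced Kronecker coefficients: for a partition $\alpha$ and $n\ge|\alpha|+\alpha_1$, let $\alpha[n]=(n-|\alpha|,\alpha_1,\alpha_2,\ldots)$. The sequence $g_{\alpha[n],\beta[n],\gamma[n]}$ is eventually constant in $n$ (Murnaghan); its limit is the reduced Kronecker coefficient $\overline{g}_{\alpha,\beta,\gamma}$.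 *)

theory Defs
  imports Complex_Main "HOL-Library.FuncSet" "HOL-Library.Function_Algebras" "HOL-Algebra.Sym_Groups"
begin

section \<open>Partitions\<close>

text \<open>
  A partition is an infinite weakly decreasing sequence of natural numbers that is eventually zero,
  so partitions differing only by trailing zeros are equal. Parts are numbered from \<open>0\<close>:
  the first part of \<open>\<alpha>\<close> is \<open>\<alpha> 0\<close>.
\<close>

definition is_partition :: "(nat \<Rightarrow> nat) \<Rightarrow> bool" where
  "is_partition \<alpha> \<longleftrightarrow> antimono \<alpha> \<and> finite {i. \<alpha> i \<noteq> 0}"

definition psize :: "(nat \<Rightarrow> nat) \<Rightarrow> nat" where
  "psize \<alpha> = (\<Sum>i\<in>{i. \<alpha> i \<noteq> 0}. \<alpha> i)"

definition pcons :: "nat \<Rightarrow> (nat \<Rightarrow> nat) \<Rightarrow> nat \<Rightarrow> nat" where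
  "pcons a \<alpha> = case_nat a \<alpha>"

text \<open>\<open>\<alpha>[n]\<close>; meaningful only for \<open>n \<ge> psize \<alpha> + \<alpha> 0\<close>.\<close>

definition pad :: "(nat \<Rightarrow> nat) \<Rightarrow> nat \<Rightarrow> nat \<Rightarrow> nat" where
  "pad \<alpha> n = pcons (n - psize \<alpha>) \<alpha>"

definition diagram :: "(nat \<Rightarrow> nat) \<Rightarrow> (nat \<times> nat) set" where
  "diagram \<alpha> = {(i, j). j < \<alpha> i}"


section \<open>Complex representations on spaces of functions\<close>

definition cscale :: "complex \<Rightarrow> ('x \<Rightarrow> complex) \<Rightarrow> 'x \<Rightarrow> complex" where
  "cscale c f = (\<lambda>x. c * f x)"

global_interpretation cfun: vector_space "cscale :: complex \<Rightarrow> ('x \<Rightarrow> complex) \<Rightarrow> 'x \<Rightarrow> complex"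
  by unfold_locales (auto simp: cscale_def fun_eq_iff algebra_simps)

text \<open>
  A representation of a group \<open>G\<close> is a subspace \<open>V\<close> of \<open>'x \<Rightarrow> complex\<close> together with an action \<open>\<rho>\<close>
  of \<open>G\<close> that is linear on \<open>V\<close> and preserves it. All actions used below are linear group actions
  on the whole function space, so only the invariance of subspaces has to be recorded.
\<close>

definition invariant_subspace ::
  "('g, 'm) monoid_scheme \<Rightarrow> ('g \<Rightarrow> ('x \<Rightarrow> complex) \<Rightarrow> 'x \<Rightarrow> complex) \<Rightarrow> ('x \<Rightarrow> complex) set \<Rightarrow> bool"
  where
  "invariant_subspace G \<rho> W \<longleftrightarrow> cfun.subspace W \<and> (\<forall>g\<in>carrier G. \<forall>v\<in>W. \<rho> g v \<in> W)"

definition irreducible_rep ::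
  "('g, 'm) monoid_scheme \<Rightarrow> ('g \<Rightarrow> ('x \<Rightarrow> complex) \<Rightarrow> 'x \<Rightarrow> complex) \<Rightarrow> ('x \<Rightarrow> complex) set \<Rightarrow> bool"
  where
  "irreducible_rep G \<rho> W \<longleftrightarrow>
     invariant_subspace G \<rho> W \<and> W \<noteq> {0} \<and>
     (\<forall>W'. invariant_subspace G \<rho> W' \<and> W' \<subseteq> W \<longrightarrow> W' = {0} \<or> W' = W)"

definition rep_iso ::
  "('g, 'm) monoid_scheme \<Rightarrow>
   ('g \<Rightarrow> ('x \<Rightarrow> complex) \<Rightarrow> 'x \<Rightarrow> complex) \<Rightarrow> ('x \<Rightarrow> complex) set \<Rightarrow>
   ('g \<Rightarrow> ('y \<Rightarrow> complex) \<Rightarrow> 'y \<Rightarrow> complex) \<Rightarrow> ('y \<Rightarrow> complex) set \<Rightarrow> bool"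
  where
  "rep_iso G \<rho> U \<sigma> W \<longleftrightarrow>
     (\<exists>\<phi>. bij_betw \<phi> U W \<and>
        (\<forall>u\<in>U. \<forall>v\<in>U. \<phi> (u + v) = \<phi> u + \<phi> v) \<and>
        (\<forall>c. \<forall>u\<in>U. \<phi> (cscale c u) = cscale c (\<phi> u)) \<and>
        (\<forall>g\<in>carrier G. \<forall>u\<in>U. \<phi> (\<rho> g u) = \<sigma> g (\<phi> u)))"

text \<open>\<open>V\<close> is the internal direct sum of the irreducible representations \<open>W 0, \<dots>, W (k - 1)\<close>.\<close>

definition irreducible_decomposition ::
  "('g, 'm) monoid_scheme \<Rightarrow> ('g \<Rightarrow> ('x \<Rightarrow> complex) \<Rightarrow> 'x \<Rightarrow> complex) \<Rightarrow> ('x \<Rightarrow> complex) set \<Rightarrow>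
   nat \<Rightarrow> (nat \<Rightarrow> ('x \<Rightarrow> complex) set) \<Rightarrow> bool"
  where
  "irreducible_decomposition G \<rho> V k W \<longleftrightarrow>
     (\<forall>i<k. irreducible_rep G \<rho> (W i) \<and> W i \<subseteq> V) \<and>
     (\<forall>v\<in>V. \<exists>!w. w \<in> (\<Pi>\<^sub>E i\<in>{..<k}. W i) \<and> v = (\<Sum>i<k. w i))"

text \<open>
  The multiplicity of the irreducible representation \<open>(U, \<rho>)\<close> in \<open>(V, \<sigma>)\<close>: the number of summands
  isomorphic to \<open>U\<close> in a decomposition of \<open>V\<close> into irreducibles. For a finite group and a
  finite-dimensional \<open>V\<close> a decomposition exists (Maschke) and this number does not depend on it.
\<close>

definition multiplicity_in ::
  "('g, 'm) monoid_scheme \<Rightarrow>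
   ('g \<Rightarrow> ('x \<Rightarrow> complex) \<Rightarrow> 'x \<Rightarrow> complex) \<Rightarrow> ('x \<Rightarrow> complex) set \<Rightarrow>
   ('g \<Rightarrow> ('y \<Rightarrow> complex) \<Rightarrow> 'y \<Rightarrow> complex) \<Rightarrow> ('y \<Rightarrow> complex) set \<Rightarrow> nat"
  where
  "multiplicity_in G \<rho> U \<sigma> V =
     (THE m. \<exists>k W. irreducible_decomposition G \<sigma> V k W \<and>
                   m = card {i. i < k \<and> rep_iso G \<rho> U \<sigma> (W i)})"


section \<open>Specht modules\<close>

text \<open>
  A tableau of shape \<open>\<alpha>\<close> sends each entry in \<open>{1..n}\<close> to its cell. Its row equivalence class,
  the tabloid, is encoded as the function sending each entry to its row. A permutation \<open>p\<close>
  relabels entries, i.e. sends the tabloid \<open>w\<close> to \<open>w \<circ> inv p\<close>. On a function \<open>f\<close> on tabloids,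
  regarded as the formal linear combination of the tabloids \<open>w\<close> with coefficients \<open>f w\<close>, this is
  \<open>f \<mapsto> (\<lambda>w. f (w \<circ> p))\<close>.
\<close>

definition is_tableau :: "(nat \<Rightarrow> nat) \<Rightarrow> (nat \<Rightarrow> nat \<times> nat) \<Rightarrow> bool" where
  "is_tableau \<alpha> T \<longleftrightarrow> bij_betw T {1..psize \<alpha>} (diagram \<alpha>)"

definition tabloid :: "nat \<Rightarrow> (nat \<Rightarrow> nat \<times> nat) \<Rightarrow> nat \<Rightarrow> nat" where
  "tabloid n T = restrict (fst \<circ> T) {1..n}"

definition perm_action ::
  "(nat \<Rightarrow> nat) \<Rightarrow> ((nat \<Rightarrow> nat) \<Rightarrow> complex) \<Rightarrow> (nat \<Rightarrow> nat) \<Rightarrow> complex" where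
  "perm_action p f = (\<lambda>w. f (w \<circ> p))"

definition column_stabilizer :: "nat \<Rightarrow> (nat \<Rightarrow> nat \<times> nat) \<Rightarrow> (nat \<Rightarrow> nat) set" where
  "column_stabilizer n T =
     {q \<in> carrier (sym_group n). \<forall>x\<in>{1..n}. snd (T (q x)) = snd (T x)}"

definition polytabloid :: "nat \<Rightarrow> (nat \<Rightarrow> nat \<times> nat) \<Rightarrow> (nat \<Rightarrow> nat) \<Rightarrow> complex" where
  "polytabloid n T =
     (\<Sum>q\<in>column_stabilizer n T.
        cscale (of_int (sign q)) (perm_action q (\<lambda>w. if w = tabloid n T then 1 else 0)))"

text \<open>The irreducible representation of \<open>S\<^sub>n\<close> indexed by the partition \<open>\<alpha>\<close> of \<open>n\<close>,
  with action \<^const>\<open>perm_action\<close>.\<close>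

definition specht :: "(nat \<Rightarrow> nat) \<Rightarrow> ((nat \<Rightarrow> nat) \<Rightarrow> complex) set" where
  "specht \<alpha> = cfun.span {polytabloid (psize \<alpha>) T |T. is_tableau \<alpha> T}"


section \<open>Tensor products\<close>

text \<open>
  The tensor product of two function spaces is realised inside the functions of two variables,
  via the canonical embedding that sends \<open>f \<otimes> g\<close> to \<open>(x, y) \<mapsto> f x * g y\<close>.
\<close>

definition pure_tensor :: "('x \<Rightarrow> complex) \<Rightarrow> ('y \<Rightarrow> complex) \<Rightarrow> 'x \<times> 'y \<Rightarrow> complex" where
  "pure_tensor f g = (\<lambda>(x, y). f x * g y)"

definition tensor_space ::
  "('x \<Rightarrow> complex) set \<Rightarrow> ('y \<Rightarrow> complex) set \<Rightarrow> ('x \<times> 'y \<Rightarrow> complex) set" where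
  "tensor_space U V = cfun.span {pure_tensor f g |f g. f \<in> U \<and> g \<in> V}"

definition tensor_action ::
  "(nat \<Rightarrow> nat) \<Rightarrow> ((nat \<Rightarrow> nat) \<times> (nat \<Rightarrow> nat) \<Rightarrow> complex) \<Rightarrow>
   (nat \<Rightarrow> nat) \<times> (nat \<Rightarrow> nat) \<Rightarrow> complex" where
  "tensor_action p F = (\<lambda>(v, w). F (v \<circ> p, w \<circ> p))"

lemma tensor_action_pure_tensor:
  "tensor_action p (pure_tensor f g) = pure_tensor (perm_action p f) (perm_action p g)"
  by (simp add: tensor_action_def pure_tensor_def perm_action_def fun_eq_iff)


section \<open>Kronecker coefficients\<close>

text \<open>Meaningful only for three partitions of the same size.\<close>

definition kronecker :: "(nat \<Rightarrow> nat) \<Rightarrow> (nat \<Rightarrow> nat) \<Rightarrow> (nat \<Rightarrow> nat) \<Rightarrow> nat" where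
  "kronecker \<alpha> \<beta> \<gamma> =
     multiplicity_in (sym_group (psize \<alpha>)) perm_action (specht \<alpha>)
       tensor_action (tensor_space (specht \<beta>) (specht \<gamma>))"

text \<open>The limit is taken in the discrete space of natural numbers, so it is the eventual value.\<close>

definition reduced_kronecker :: "(nat \<Rightarrow> nat) \<Rightarrow> (nat \<Rightarrow> nat) \<Rightarrow> (nat \<Rightarrow> nat) \<Rightarrow> nat" where
  "reduced_kronecker \<alpha> \<beta> \<gamma> = lim (\<lambda>n. kronecker (pad \<alpha> n) (pad \<beta> n) (pad \<gamma> n))"

end

(*
  The character of a Specht module is the alternating sum, over the permutations s of the rows, of the
  permutation characters on tabloids of shape lambda + s - id. This follows from Cauchy's identity (the
  alternating sum has norm 1) and from James's theory of polytabloids (its inner product with the Specht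
  character is 1). By Burnside's lemma a Kronecker coefficient is then an alternating sum of numbers of
  three-dimensional contingency tables with prescribed margins.

  If the first margins are long, the corner entry absorbs them, which gives stability. Tables are split
  into the seven cells of {0,1}^3 other than the corner, which see the second rows a, b, c, and the
  remaining cells, which allow finitely many fillings independent of a, b, c. Antisymmetry in the first
  two rows turns the count for seven cells into the count for (1,1,0), (1,0,1), (0,1,1), (1,1,1), which is
  floor((b + c - a) / 2) + 1 in the relevant cone. So the reduced coefficient is an integer combination of
  shifts of this function.
*)

theory Submission
  imports Defs "HOL-Computational_Algebra.Formal_Power_Series" "Jordan_Normal_Form.Determinant" "HOL-Library.Poly_Mapping"
begin

text \<open>Representations are subspaces of function spaces without a chosen basis, and a
  multiplicity is defined through arbitrary decompositions into irreducibles. Each subspace is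
  therefore represented by the matrix of its orthogonal projection: uniqueness makes it inherit
  every symmetry, and its trace against a group element is a finite sum over points. Permutation
  actions preserve the Hermitian form, which gives complements; orthogonality of characters then
  shows that all decompositions count the same multiplicity. Schur's lemma needs no eigenvalues,
  because on a Specht module the column antisymmetriser forces operators that commute with the group
  to be scalars. As to growth, a count for seven cells under three margin conditions has degree
  four, while the answer must be linear. The swap of the first two rows pairs terms into
  differences. One difference in each of the three directions cancels the cells with a single
  coordinate 1, and four cells under three conditions leave one free parameter.\<close>

section \<open>Projection kernels of subspaces\<close>

definition supported_subspace :: "'x set \<Rightarrow> ('x \<Rightarrow> complex) set \<Rightarrow> bool" where
  "supported_subspace X V \<longleftrightarrow> cfun.subspace V \<and> (\<forall>v\<in>V. \<forall>x. x \<notin> X \<longrightarrow> v x = 0)"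

text \<open>\<open>p\<close> is the matrix of the orthogonal projection onto \<open>V\<close>.\<close>

definition is_kernel :: "'x set \<Rightarrow> ('x \<Rightarrow> complex) set \<Rightarrow> ('x \<Rightarrow> 'x \<Rightarrow> complex) \<Rightarrow> bool" where
  "is_kernel X V p \<longleftrightarrow> (\<forall>x. (\<lambda>y. p y x) \<in> V) \<and>
     (\<forall>v\<in>V. \<forall>y. (\<Sum>x\<in>X. p y x * v x) = v y) \<and> (\<forall>x y. p x y = cnj (p y x))"

definition fip :: "'x set \<Rightarrow> ('x \<Rightarrow> complex) \<Rightarrow> ('x \<Rightarrow> complex) \<Rightarrow> complex" where
  "fip X u v = (\<Sum>x\<in>X. u x * cnj (v x))"

definition orthonormal :: "'x set \<Rightarrow> ('x \<Rightarrow> complex) set \<Rightarrow> bool" where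
  "orthonormal X E \<longleftrightarrow> finite E \<and> (\<forall>e\<in>E. \<forall>f\<in>E. fip X e f = (if e = f then 1 else 0))"

lemma sum_fun_apply: "(\<Sum>i\<in>I. f i) x = (\<Sum>i\<in>I. f i x)" for f :: "'i \<Rightarrow> 'x \<Rightarrow> complex"
  by (induction I rule: infinite_finite_induct) auto

lemma subspace_lincomb:
  assumes "cfun.subspace V" "\<And>i. i \<in> I \<Longrightarrow> f i \<in> V"
  shows "(\<lambda>y. \<Sum>i\<in>I. c i * f i y) \<in> V"
proof -
  have "(\<Sum>i\<in>I. cscale (c i) (f i)) \<in> V"
    using assms by (intro cfun.subspace_sum cfun.subspace_scale)
  also have "(\<Sum>i\<in>I. cscale (c i) (f i)) = (\<lambda>y. \<Sum>i\<in>I. c i * f i y)"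
    by (auto simp: sum_fun_apply cscale_def)
  finally show ?thesis .
qed

lemma fip_self: "fip X u u = of_real (\<Sum>x\<in>X. (cmod (u x))\<^sup>2)"
  unfolding fip_def by (simp add: complex_norm_square del: of_real_power)

lemma fip_self_eq_0:
  assumes "finite X" "fip X u u = 0" "x \<in> X"
  shows "u x = 0"
proof -
  have "(\<Sum>x\<in>X. (cmod (u x))\<^sup>2) = 0"
    using assms(2) unfolding fip_self by (simp only: of_real_eq_0_iff)
  with assms show ?thesis by (simp add: sum_nonneg_eq_0_iff)
qed

text \<open>Bessel's inequality for the point mass at x bounds the sum of |e x|^2 over E by 1;
  summing over x counts each unit vector once. This stands in for a dimension bound and makes an
  orthonormal family of maximal size available.\<close>

lemma orthonormal_card_le:
  assumes X: "finite X" and E: "orthonormal X E"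
  shows "card E \<le> card X"
proof -
  have bessel: "(\<Sum>e\<in>E. (cmod (e x))\<^sup>2) \<le> 1" if x: "x \<in> X" for x
  proof -
    define s where "s = (\<Sum>e\<in>E. (cmod (e x))\<^sup>2)"
    \<comment> \<open>\<open>b\<close> is the projection of the point mass at \<open>x\<close> to
      the span of \<open>E\<close>, so \<open>b x\<close> and the squared norm of \<open>b\<close>
      are both \<open>s\<close>. One coordinate is at most the norm, which gives s^2 <= s.\<close>
    define b where "b = (\<lambda>y. \<Sum>e\<in>E. cnj (e x) * e y)"
    have bx: "b x = of_real s"
      unfolding b_def s_def by (simp add: complex_norm_square mult.commute del: of_real_power)
    have "fip X b b = (\<Sum>y\<in>X. \<Sum>e\<in>E. \<Sum>f\<in>E. cnj (e x) * e y * (f x * cnj (f y)))"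
      unfolding fip_def b_def by (simp add: sum_product)
    also have "\<dots> = (\<Sum>e\<in>E. \<Sum>f\<in>E. \<Sum>y\<in>X. cnj (e x) * e y * (f x * cnj (f y)))"
      by (subst sum.swap, rule sum.cong[OF refl], rule sum.swap)
    also have "\<dots> = (\<Sum>e\<in>E. \<Sum>f\<in>E. cnj (e x) * f x * fip X e f)"
      unfolding fip_def by (simp add: sum_distrib_left mult_ac)
    also have "\<dots> = (\<Sum>e\<in>E. \<Sum>f\<in>E. if e = f then cnj (e x) * f x else 0)"
      using E unfolding orthonormal_def by (intro sum.cong) auto
    also have "\<dots> = (\<Sum>e\<in>E. cnj (e x) * e x)"
      using E unfolding orthonormal_def by (intro sum.cong) auto
    also have "\<dots> = of_real s"
      unfolding s_def by (simp add: complex_norm_square mult.commute del: of_real_power)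
    finally have "(\<Sum>y\<in>X. (cmod (b y))\<^sup>2) = s"
      unfolding fip_self by (simp only: of_real_eq_iff)
    moreover have "(cmod (b x))\<^sup>2 \<le> (\<Sum>y\<in>X. (cmod (b y))\<^sup>2)"
      using X x by (intro member_le_sum) auto
    ultimately have "s * s \<le> s" unfolding bx by (simp add: power2_eq_square)
    moreover have "s \<ge> 0" unfolding s_def by (simp add: sum_nonneg)
    ultimately have "s \<le> 1"
      using mult_strict_left_mono[of 1 s s] by (cases "s \<le> 1") auto
    then show ?thesis unfolding s_def .
  qed
  have "(of_nat (card E) :: complex) = (\<Sum>e\<in>E. fip X e e)"
    using E unfolding orthonormal_def by simp
  also have "\<dots> = of_real (\<Sum>e\<in>E. \<Sum>x\<in>X. (cmod (e x))\<^sup>2)"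
    unfolding fip_self by (simp only: of_real_sum)
  finally have "(of_real (real (card E)) :: complex) = of_real (\<Sum>e\<in>E. \<Sum>x\<in>X. (cmod (e x))\<^sup>2)"
    by (simp only: of_real_of_nat_eq)
  then have "real (card E) = (\<Sum>e\<in>E. \<Sum>x\<in>X. (cmod (e x))\<^sup>2)"
    by (simp only: of_real_eq_iff)
  also have "\<dots> = (\<Sum>x\<in>X. \<Sum>e\<in>E. (cmod (e x))\<^sup>2)" by (rule sum.swap)
  also have "\<dots> \<le> (\<Sum>x\<in>X. 1)" by (intro sum_mono bessel)
  finally show ?thesis by simp
qed

lemma fip_diff_left: "fip X (u - v) w = fip X u w - fip X v w"
  unfolding fip_def by (simp add: sum_subtractf algebra_simps)

lemma fip_sum_left: "fip X (\<lambda>y. \<Sum>i\<in>I. c i * f i y) w = (\<Sum>i\<in>I. c i * fip X (f i) w)"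
  unfolding fip_def by (simp add: sum_distrib_right sum_distrib_left mult_ac, rule sum.swap)

lemma fip_cnj: "fip X u v = cnj (fip X v u)"
  unfolding fip_def by (simp add: mult.commute)

lemma fip_scale: "fip X (cscale c u) v = c * fip X u v" "fip X u (cscale c v) = cnj c * fip X u v"
  unfolding fip_def cscale_def by (simp_all add: sum_distrib_left algebra_simps)

text \<open>An orthonormal family in V of maximal size spans V, since a nonzero residual could be
  normalised and added. The projection is the sum of each e times its adjoint, and its trace is the
  size of the family.\<close>

lemma kernel_exists:
  assumes X: "finite X" and V: "supported_subspace X V"
  shows "\<exists>p k. is_kernel X V p \<and> (\<Sum>x\<in>X. p x x) = of_nat k"
proof -
  let ?P = "\<lambda>E. orthonormal X E \<and> E \<subseteq> V"
  have sub: "cfun.subspace V" and supp: "\<And>v x. v \<in> V \<Longrightarrow> x \<notin> X \<Longrightarrow> v x = 0"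
    using V unfolding supported_subspace_def by auto
  have "?P {}" unfolding orthonormal_def by simp
  moreover have "\<forall>E. ?P E \<longrightarrow> card E < Suc (card X)"
    using orthonormal_card_le[OF X] by (auto simp: less_Suc_eq_le)
  ultimately obtain E where E: "?P E" and max: "\<And>E'. ?P E' \<Longrightarrow> card E' \<le> card E"
    using ex_has_greatest_nat[of ?P "{}" card "Suc (card X)"] by blast
  have finE: "finite E" and on: "\<And>e f. e \<in> E \<Longrightarrow> f \<in> E \<Longrightarrow> fip X e f = (if e = f then 1 else 0)"
    using E unfolding orthonormal_def by auto
  define p where "p = (\<lambda>y x. \<Sum>e\<in>E. e y * cnj (e x))"
  have "v y = (\<Sum>e\<in>E. fip X v e * e y)" if v: "v \<in> V" for v y
  proof -
    define w where "w = v - (\<lambda>y. \<Sum>e\<in>E. fip X v e * e y)"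
    have wV: "w \<in> V" unfolding w_def using v E sub
      by (intro cfun.subspace_diff subspace_lincomb) auto
    have orth: "fip X w f = 0" if "f \<in> E" for f
    proof -
      have "fip X w f = fip X v f - (\<Sum>e\<in>E. fip X v e * fip X e f)"
        unfolding w_def fip_diff_left fip_sum_left ..
      also have "(\<Sum>e\<in>E. fip X v e * fip X e f) = (\<Sum>e\<in>E. if e = f then fip X v e else 0)"
        using on that by (intro sum.cong) auto
      also have "\<dots> = fip X v f" using finE that by simp
      finally show ?thesis by simp
    qed
    have "fip X w w = 0"
    proof (rule ccontr)
      assume nz: "fip X w w \<noteq> 0"
      define s where "s = (\<Sum>x\<in>X. (cmod (w x))\<^sup>2)"
      have ws: "fip X w w = of_real s" unfolding s_def fip_self ..
      have "s \<noteq> 0" using nz unfolding ws by simp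
      moreover have "s \<ge> 0" unfolding s_def by (simp add: sum_nonneg)
      ultimately have s0: "s > 0" by simp
      define f where "f = cscale (of_real (1 / sqrt s)) w"
      have ff: "fip X f f = 1"
      proof -
        have "fip X f f = of_real (1 / sqrt s * (1 / sqrt s) * s)"
          unfolding f_def fip_scale ws by (simp only: complex_cnj_complex_of_real of_real_mult mult.assoc)
        also have "1 / sqrt s * (1 / sqrt s) * s = 1" using s0 by simp
        finally show ?thesis by simp
      qed
      have fo: "fip X f e = 0" "fip X e f = 0" if "e \<in> E" for e
        using orth[OF that] fip_cnj[of X e f] by (simp_all add: f_def fip_scale)
      have fE: "f \<notin> E" using ff fo by force
      have "?P (insert f E)"
        using on finE fo ff E wV sub fE unfolding orthonormal_def f_def
        by (auto intro: cfun.subspace_scale)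
      from max[OF this] show False using finE fE by simp
    qed
    then have "w y = 0" using fip_self_eq_0[OF X] supp[OF wV] by blast
    then show ?thesis unfolding w_def by simp
  qed
  note exp = this
  have "is_kernel X V p"
    unfolding is_kernel_def
  proof (intro conjI allI ballI)
    fix x show "(\<lambda>y. p y x) \<in> V"
      using subspace_lincomb[OF sub, of E "\<lambda>e. e" "\<lambda>e. cnj (e x)"] E
      unfolding p_def by (auto simp: mult.commute)
  next
    fix v y assume v: "v \<in> V"
    have "(\<Sum>x\<in>X. p y x * v x) = (\<Sum>e\<in>E. fip X v e * e y)"
      unfolding p_def fip_def
      by (simp add: sum_distrib_right sum_distrib_left mult_ac, rule sum.swap)
    then show "(\<Sum>x\<in>X. p y x * v x) = v y" using exp[OF v] by simp
  next
    fix x y show "p x y = cnj (p y x)" unfolding p_def by (simp add: mult.commute)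
  qed
  moreover have "(\<Sum>x\<in>X. p x x) = (\<Sum>e\<in>E. fip X e e)"
    unfolding p_def fip_def by (rule sum.swap)
  then have "(\<Sum>x\<in>X. p x x) = of_nat (card E)" using on by simp
  ultimately show ?thesis by blast
qed

lemma kernel_column: "is_kernel X V p \<Longrightarrow> (\<lambda>y. p y x) \<in> V"
  and kernel_reproduces: "is_kernel X V p \<Longrightarrow> v \<in> V \<Longrightarrow> (\<Sum>x\<in>X. p y x * v x) = v y"
  and kernel_hermitian: "is_kernel X V p \<Longrightarrow> p x y = cnj (p y x)"
  unfolding is_kernel_def by blast+

text \<open>Each matrix fixes the columns of the other, so q p = p and p q = q; the adjoint of the
  first equation is p q = p.\<close>

lemma kernel_unique:
  assumes "is_kernel X V p" "is_kernel X V q"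
  shows "p = q"
proof (intro ext)
  fix y x
  have "p y x = (\<Sum>z\<in>X. q y z * p z x)"
    using kernel_reproduces[OF assms(2) kernel_column[OF assms(1)]] by simp
  also have "\<dots> = cnj (\<Sum>z\<in>X. p x z * q z y)"
    unfolding cnj_sum complex_cnj_mult
    by (intro sum.cong) (simp_all add: mult.commute flip: kernel_hermitian[OF assms(1)] kernel_hermitian[OF assms(2)])
  also have "\<dots> = cnj (q x y)"
    using kernel_reproduces[OF assms(1) kernel_column[OF assms(2)]] by simp
  also have "\<dots> = q y x" using kernel_hermitian[OF assms(2)] by metis
  finally show "p y x = q y x" .
qed

lemma kernel_range:
  assumes "supported_subspace X V" "is_kernel X V p"
  shows "(\<lambda>y. \<Sum>x\<in>Z. p y x * c x) \<in> V"
  using subspace_lincomb[of V Z "\<lambda>x y. p y x" c] assms(1) kernel_column[OF assms(2)]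
  unfolding supported_subspace_def by (simp add: mult.commute)

lemma kernel_idem:
  "is_kernel X V p \<Longrightarrow> (\<Sum>z\<in>X. p y z * p z x) = p y x"
  using kernel_reproduces[OF _ kernel_column] .

lemma kernel_reproduces_row:
  assumes "is_kernel X V p" "v \<in> V"
  shows "(\<Sum>z\<in>X. cnj (v z) * p z x) = cnj (v x)"
proof -
  have "(\<Sum>z\<in>X. cnj (v z) * p z x) = cnj (\<Sum>z\<in>X. p x z * v z)"
    unfolding cnj_sum complex_cnj_mult
    by (intro sum.cong) (simp_all add: mult.commute flip: kernel_hermitian[OF assms(1)])
  then show ?thesis using kernel_reproduces[OF assms] by simp
qed

lemma kernel_support:
  assumes "supported_subspace X V" "is_kernel X V p" "y \<notin> X \<or> x \<notin> X"
  shows "p y x = 0"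
proof -
  have *: "p y x = 0" if "y \<notin> X" for y x
  proof -
    have "\<forall>v\<in>V. \<forall>x. x \<notin> X \<longrightarrow> v x = 0"
      using assms(1) unfolding supported_subspace_def by simp
    from bspec[OF this kernel_column[OF assms(2), of x]] that show ?thesis by simp
  qed
  show ?thesis using assms(3) *[of y x] *[of x y] kernel_hermitian[OF assms(2), of y x] by auto
qed

section \<open>Permutation representations and characters\<close>

definition pull :: "('g \<Rightarrow> 'x \<Rightarrow> 'x) \<Rightarrow> 'g \<Rightarrow> ('x \<Rightarrow> complex) \<Rightarrow> 'x \<Rightarrow> complex" where
  "pull r g f = (\<lambda>x. f (r g x))"

text \<open>The trace of \<open>g\<close> composed with the projection whose matrix is \<open>p\<close>.\<close>

definition rep_char :: "'x set \<Rightarrow> ('g \<Rightarrow> 'x \<Rightarrow> 'x) \<Rightarrow> ('x \<Rightarrow> 'x \<Rightarrow> complex) \<Rightarrow> 'g \<Rightarrow> complex" where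
  "rep_char X r p g = (\<Sum>x\<in>X. p (r g x) x)"

text \<open>The matrix form of an intertwiner: moving both indices at once is what makes
  \<open>kapply X F\<close> commute with the actions on functions.\<close>

definition equivariant ::
  "('g, 'm) monoid_scheme \<Rightarrow> ('g \<Rightarrow> 'x \<Rightarrow> 'x) \<Rightarrow> ('g \<Rightarrow> 'y \<Rightarrow> 'y) \<Rightarrow> ('y \<Rightarrow> 'x \<Rightarrow> complex) \<Rightarrow> bool"
  where
  "equivariant G r s F \<longleftrightarrow> (\<forall>g\<in>carrier G. \<forall>y x. F (s g y) (r g x) = F y x)"

definition kapply :: "'x set \<Rightarrow> ('y \<Rightarrow> 'x \<Rightarrow> complex) \<Rightarrow> ('x \<Rightarrow> complex) \<Rightarrow> 'y \<Rightarrow> complex" where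
  "kapply X F v = (\<lambda>y. \<Sum>x\<in>X. F y x * v x)"

lemma pull_linear: "pull r g (u + v) = pull r g u + pull r g v"
  "pull r g (cscale c u) = cscale c (pull r g u)" "pull r g 0 = 0"
  unfolding pull_def cscale_def by (auto simp: zero_fun_def plus_fun_def)

lemma kapply_linear: "kapply X F (u + v) = kapply X F u + kapply X F v"
  "kapply X F (cscale c u) = cscale c (kapply X F u)" "kapply X F 0 = 0"
  unfolding kapply_def cscale_def
  by (auto simp: algebra_simps sum.distrib sum_distrib_left)

lemma kapply_diff: "kapply X F (u - v) = kapply X F u - kapply X F v"
  unfolding kapply_def by (auto simp: algebra_simps sum_subtractf)

text \<open>The action \<open>r\<close> on points is a right action, so that \<open>pull r\<close> is a left action on functions.\<close>

locale perm_rep =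
  fixes G :: "('g, 'm) monoid_scheme" and X :: "'x set" and r :: "'g \<Rightarrow> 'x \<Rightarrow> 'x"
  assumes group_G: "group G" and finite_G: "finite (carrier G)" and finite_X: "finite X"
    and act_one: "r \<one>\<^bsub>G\<^esub> x = x"
    and act_mult: "g \<in> carrier G \<Longrightarrow> h \<in> carrier G \<Longrightarrow> r (g \<otimes>\<^bsub>G\<^esub> h) x = r h (r g x)"
    and act_closed: "g \<in> carrier G \<Longrightarrow> x \<in> X \<Longrightarrow> r g x \<in> X"
begin

lemma act_inv:
  assumes "g \<in> carrier G"
  shows "r g (r (inv\<^bsub>G\<^esub> g) x) = x" "r (inv\<^bsub>G\<^esub> g) (r g x) = x"
  using act_mult[of "inv\<^bsub>G\<^esub> g" g x] act_mult[of g "inv\<^bsub>G\<^esub> g" x] assms group_G act_one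
  by (simp_all add: group.l_inv group.r_inv)

lemma act_bij: "g \<in> carrier G \<Longrightarrow> bij_betw (r g) X X"
  by (rule bij_betwI[where g = "r (inv\<^bsub>G\<^esub> g)"])
     (auto simp: act_closed act_inv group.inv_closed[OF group_G])

lemma sum_act: "g \<in> carrier G \<Longrightarrow> (\<Sum>x\<in>X. f (r g x)) = (\<Sum>x\<in>X. f x)"
  using sum.reindex_bij_betw[OF act_bij] .

lemma sum_translate:
  assumes "h \<in> carrier G"
  shows "(\<Sum>g\<in>carrier G. f (h \<otimes>\<^bsub>G\<^esub> g)) = (\<Sum>g\<in>carrier G. f g)"
proof -
  interpret group G by (rule group_G)
  have "bij_betw ((\<otimes>\<^bsub>G\<^esub>) h) (carrier G) (carrier G)"
    by (rule bij_betwI[where g = "(\<otimes>\<^bsub>G\<^esub>) (inv\<^bsub>G\<^esub> h)"])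
       (use assms in \<open>auto simp flip: m_assoc\<close>)
  from sum.reindex_bij_betw[OF this] show ?thesis .
qed

abbreviation submodule :: "('x \<Rightarrow> complex) set \<Rightarrow> bool" where
  "submodule V \<equiv> supported_subspace X V \<and> invariant_subspace G (pull r) V"

lemma submoduleI:
  assumes "cfun.subspace V" "\<And>v x. v \<in> V \<Longrightarrow> x \<notin> X \<Longrightarrow> v x = 0"
    "\<And>g v. g \<in> carrier G \<Longrightarrow> v \<in> V \<Longrightarrow> pull r g v \<in> V"
  shows "submodule V"
  using assms unfolding supported_subspace_def invariant_subspace_def by blast

lemma submoduleD:
  assumes "submodule V"
  shows "cfun.subspace V" "v \<in> V \<Longrightarrow> x \<notin> X \<Longrightarrow> v x = 0"
    "g \<in> carrier G \<Longrightarrow> v \<in> V \<Longrightarrow> pull r g v \<in> V"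
  using assms unfolding supported_subspace_def invariant_subspace_def by blast+

lemma submodule_subset:
  assumes "submodule V" "invariant_subspace G (pull r) W" "W \<subseteq> V"
  shows "submodule W"
  using assms unfolding supported_subspace_def invariant_subspace_def by blast

text \<open>Conjugating p by g gives another projection matrix of the same subspace, so uniqueness
  applies.\<close>

lemma kernel_equivariant:
  assumes V: "submodule V" and p: "is_kernel X V p"
  shows "equivariant G r r p"
  unfolding equivariant_def
proof (intro ballI allI)
  fix g y x assume g: "g \<in> carrier G"
  have g': "inv\<^bsub>G\<^esub> g \<in> carrier G" using g group_G by (simp add: group.inv_closed)
  have "is_kernel X V (\<lambda>y x. p (r g y) (r g x))"
    unfolding is_kernel_def
  proof (intro conjI allI ballI)
    fix x
    show "(\<lambda>y. p (r g y) (r g x)) \<in> V"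
      using submoduleD(3)[OF V g kernel_column[OF p, of "r g x"]] unfolding pull_def .
  next
    fix v y assume v: "v \<in> V"
    have "(\<Sum>x\<in>X. p (r g y) (r g x) * v x)
        = (\<Sum>x\<in>X. p (r g y) (r g x) * pull r (inv\<^bsub>G\<^esub> g) v (r g x))"
      unfolding pull_def using act_inv[OF g] by simp
    also have "\<dots> = (\<Sum>x\<in>X. p (r g y) x * pull r (inv\<^bsub>G\<^esub> g) v x)"
      using sum_act[OF g, of "\<lambda>x. p (r g y) x * pull r (inv\<^bsub>G\<^esub> g) v x"] .
    also have "\<dots> = v y"
      using kernel_reproduces[OF p submoduleD(3)[OF V g' v]] act_inv[OF g] unfolding pull_def by simp
    finally show "(\<Sum>x\<in>X. p (r g y) (r g x) * v x) = v y" .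
  next
    fix x y show "p (r g x) (r g y) = cnj (p (r g y) (r g x))"
      by (rule kernel_hermitian[OF p])
  qed
  from kernel_unique[OF this p] show "p (r g y) (r g x) = p y x" by metis
qed

end

lemma equivariantD: "equivariant G r s F \<Longrightarrow> g \<in> carrier G \<Longrightarrow> F (s g y) (r g x) = F y x"
  unfolding equivariant_def by blast

section \<open>Intertwiners between two permutation representations and orthogonality of
  characters\<close>

locale perm_rep_pair = X: perm_rep G X r + Y: perm_rep G Y s
  for G :: "('g, 'm) monoid_scheme" and X :: "'x set" and r :: "'g \<Rightarrow> 'x \<Rightarrow> 'x"
    and Y :: "'y set" and s :: "'g \<Rightarrow> 'y \<Rightarrow> 'y"
begin

lemma kapply_pull:
  assumes F: "equivariant G r s F" and g: "g \<in> carrier G"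
  shows "kapply X F (pull r g v) = pull s g (kapply X F v)"
proof
  fix y
  have "(\<Sum>x\<in>X. F y x * v (r g x)) = (\<Sum>x\<in>X. F (s g y) (r g x) * v (r g x))"
    using equivariantD[OF F g] by simp
  also have "\<dots> = (\<Sum>x\<in>X. F (s g y) x * v x)"
    using X.sum_act[OF g, of "\<lambda>x. F (s g y) x * v x"] .
  finally show "kapply X F (pull r g v) y = pull s g (kapply X F v) y"
    unfolding kapply_def pull_def .
qed

text \<open>Averaging the rank-one operators \<open>q \<circ> E \<circ> p\<close> over the group.\<close>

definition average :: "('x \<Rightarrow> 'x \<Rightarrow> complex) \<Rightarrow> ('y \<Rightarrow> 'y \<Rightarrow> complex) \<Rightarrow> 'y \<Rightarrow> 'x \<Rightarrow> 'y \<Rightarrow> 'x \<Rightarrow> complex" where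
  "average p q y0 x0 y x = (\<Sum>g\<in>carrier G. q (s g y) y0 * p x0 (r g x))"

lemma average_equivariant: "equivariant G r s (average p q y0 x0)"
  unfolding equivariant_def
proof (intro ballI allI)
  fix h y x assume h: "h \<in> carrier G"
  have "average p q y0 x0 (s h y) (r h x)
      = (\<Sum>g\<in>carrier G. q (s (h \<otimes>\<^bsub>G\<^esub> g) y) y0 * p x0 (r (h \<otimes>\<^bsub>G\<^esub> g) x))"
    unfolding average_def using h by (simp add: X.act_mult Y.act_mult)
  also have "\<dots> = average p q y0 x0 y x"
    unfolding average_def using X.sum_translate[OF h, of "\<lambda>g. q (s g y) y0 * p x0 (r g x)"] .
  finally show "average p q y0 x0 (s h y) (r h x) = average p q y0 x0 y x" .
qed

lemma average_left:
  assumes W: "Y.submodule W" and q: "is_kernel Y W q"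
  shows "(\<Sum>z\<in>Y. q y z * average p q y0 x0 z x) = average p q y0 x0 y x"
proof -
  have "(\<Sum>z\<in>Y. q y z * average p q y0 x0 z x)
      = (\<Sum>g\<in>carrier G. (\<Sum>z\<in>Y. q y z * q (s g z) y0) * p x0 (r g x))"
    unfolding average_def by (simp add: sum_distrib_left sum_distrib_right mult_ac, rule sum.swap)
  also have "\<dots> = average p q y0 x0 y x"
    unfolding average_def
  proof (intro sum.cong refl)
    fix g assume "g \<in> carrier G"
    from kernel_reproduces[OF q Y.submoduleD(3)[OF W this kernel_column[OF q, of y0]], of y]
    show "(\<Sum>z\<in>Y. q y z * q (s g z) y0) * p x0 (r g x) = q (s g y) y0 * p x0 (r g x)"
      unfolding pull_def by simp
  qed
  finally show ?thesis .
qed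

lemma average_right:
  assumes U: "X.submodule U" and p: "is_kernel X U p"
  shows "(\<Sum>z\<in>X. average p q y0 x0 y z * p z x) = average p q y0 x0 y x"
proof -
  have "(\<Sum>z\<in>X. average p q y0 x0 y z * p z x)
      = (\<Sum>g\<in>carrier G. q (s g y) y0 * (\<Sum>z\<in>X. cnj (p (r g z) x0) * p z x))"
    unfolding average_def kernel_hermitian[OF p, of x0, symmetric]
    by (simp add: sum_distrib_left sum_distrib_right mult_ac, rule sum.swap)
  also have "\<dots> = average p q y0 x0 y x"
    unfolding average_def
  proof (intro sum.cong refl)
    fix g assume "g \<in> carrier G"
    from kernel_reproduces_row[OF p X.submoduleD(3)[OF U this kernel_column[OF p, of x0]], of x]
    show "q (s g y) y0 * (\<Sum>z\<in>X. cnj (p (r g z) x0) * p z x) = q (s g y) y0 * p x0 (r g x)"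
      unfolding pull_def by (simp flip: kernel_hermitian[OF p])
  qed
  finally show ?thesis .
qed

text \<open>Hermitian symmetry turns the conjugate of p (r g x) x into p x (r g x), so the product
  of the two traces becomes a sum of entries of averaged rank-one operators.\<close>

lemma char_product_average:
  assumes p: "is_kernel X U p"
  shows "(\<Sum>g\<in>carrier G. rep_char Y s q g * cnj (rep_char X r p g))
    = (\<Sum>y\<in>Y. \<Sum>x\<in>X. average p q y x y x)"
proof -
  have "(\<Sum>g\<in>carrier G. rep_char Y s q g * cnj (rep_char X r p g))
      = (\<Sum>g\<in>carrier G. \<Sum>y\<in>Y. \<Sum>x\<in>X. q (s g y) y * p x (r g x))"
    unfolding rep_char_def by (simp add: sum_product flip: kernel_hermitian[OF p])
  also have "\<dots> = (\<Sum>y\<in>Y. \<Sum>x\<in>X. average p q y x y x)"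
    unfolding average_def by (subst sum.swap, rule sum.cong[OF refl], rule sum.swap)
  finally show ?thesis .
qed

text \<open>The hypothesis \<open>zero\<close> says that no nonzero intertwiner maps U to W: the
  equations q F = F and F p = F single out the matrices that factor through both projections.
  Keeping it abstract lets one argument serve for nonisomorphic irreducibles, for permutation
  modules of lower weight and for an orthogonal complement.\<close>

lemma char_orthogonal:
  assumes U: "X.submodule U" and p: "is_kernel X U p"
    and W: "Y.submodule W" and q: "is_kernel Y W q"
    and zero: "\<And>F. equivariant G r s F \<Longrightarrow>
       \<forall>y x. (\<Sum>z\<in>Y. q y z * F z x) = F y x \<Longrightarrow>
       \<forall>y x. (\<Sum>z\<in>X. F y z * p z x) = F y x \<Longrightarrow> \<forall>y x. F y x = 0"
  shows "(\<Sum>g\<in>carrier G. rep_char Y s q g * cnj (rep_char X r p g)) = 0"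
proof -
  have "\<forall>y x. average p q y0 x0 y x = 0" for y0 x0
    by (rule zero[OF average_equivariant]) (intro allI average_left[OF W q] average_right[OF U p])+
  then show ?thesis unfolding char_product_average[OF p] by simp
qed

text \<open>Schur's lemma: the kernel in U and the image in W are invariant, so a map that is not
  zero would be bijective and hence an isomorphism.\<close>

lemma kapply_zero_if_not_iso:
  assumes U: "X.submodule U" "irreducible_rep G (pull r) U"
    and W: "Y.submodule W" "irreducible_rep G (pull s) W"
    and niso: "\<not> rep_iso G (pull r) U (pull s) W"
    and F: "equivariant G r s F" and FW: "\<And>u. u \<in> U \<Longrightarrow> kapply X F u \<in> W"
    and u: "u \<in> U"
  shows "kapply X F u = 0"
proof -
  have subU: "cfun.subspace U" by (rule X.submoduleD(1)[OF U(1)])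
  define K where "K = {u\<in>U. kapply X F u = 0}"
  have "cfun.subspace K"
    unfolding cfun.subspace_def K_def
    using subU by (auto simp: kapply_linear cfun.subspace_0 cfun.subspace_add cfun.subspace_scale
        intro: cfun.scale_zero_right)
  then have "invariant_subspace G (pull r) K"
    unfolding invariant_subspace_def K_def
    using X.submoduleD(3)[OF U(1)] by (auto simp: kapply_pull[OF F] pull_linear)
  then have K: "K = {0} \<or> K = U"
    using U(2) unfolding irreducible_rep_def K_def by blast
  define I where "I = kapply X F ` U"
  have "cfun.subspace I"
    unfolding cfun.subspace_def I_def
    using subU
    by (auto simp flip: kapply_linear(1,2) intro: cfun.subspace_add cfun.subspace_scale)
       (metis cfun.subspace_0 image_eqI kapply_linear(3))
  then have "invariant_subspace G (pull s) I"
    unfolding invariant_subspace_def I_def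
    using X.submoduleD(3)[OF U(1)] by (auto simp flip: kapply_pull[OF F])
  moreover have "I \<subseteq> W" unfolding I_def using FW by auto
  ultimately have I: "I = {0} \<or> I = W"
    using W(2) unfolding irreducible_rep_def by blast
  show ?thesis
  proof (cases "K = U \<or> I = {0}")
    case True
    then show ?thesis using u unfolding K_def I_def by blast
  next
    case False
    then have K0: "K = {0}" and IW: "I = W" using K I by auto
    have "inj_on (kapply X F) U"
    proof (rule inj_onI)
      fix v w assume vw: "v \<in> U" "w \<in> U" "kapply X F v = kapply X F w"
      then have "v - w \<in> K"
        unfolding K_def using cfun.subspace_diff[OF subU] by (simp add: kapply_diff)
      then show "v = w" using K0 by simp
    qed
    then have "bij_betw (kapply X F) U W"
      using IW unfolding bij_betw_def I_def by simp
    then have "rep_iso G (pull r) U (pull s) W"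
      unfolding rep_iso_def
      by (intro exI[of _ "kapply X F"]) (simp add: kapply_linear kapply_pull[OF F])
    then show ?thesis using niso by simp
  qed
qed

lemma char_orthogonal_irreducible:
  assumes U: "X.submodule U" "irreducible_rep G (pull r) U" and p: "is_kernel X U p"
    and W: "Y.submodule W" "irreducible_rep G (pull s) W" and q: "is_kernel Y W q"
    and niso: "\<not> rep_iso G (pull r) U (pull s) W"
  shows "(\<Sum>g\<in>carrier G. rep_char Y s q g * cnj (rep_char X r p g)) = 0"
proof (rule char_orthogonal[OF U(1) p W(1) q])
  fix F
  assume F: "equivariant G r s F" and qF': "\<forall>y x. (\<Sum>z\<in>Y. q y z * F z x) = F y x"
    and Fp': "\<forall>y x. (\<Sum>z\<in>X. F y z * p z x) = F y x"
  note qF = qF'[rule_format] and Fp = Fp'[rule_format]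
  have "kapply X F u \<in> W" if "u \<in> U" for u
  proof -
    have "kapply X F u = (\<lambda>y. \<Sum>z\<in>Y. q y z * (\<Sum>x\<in>X. F z x * u x))"
    proof
      fix y
      have "kapply X F u y = (\<Sum>x\<in>X. (\<Sum>z\<in>Y. q y z * F z x) * u x)"
        unfolding kapply_def qF ..
      also have "\<dots> = (\<Sum>z\<in>Y. q y z * (\<Sum>x\<in>X. F z x * u x))"
        by (simp add: sum_distrib_left sum_distrib_right mult_ac, rule sum.swap)
      finally show "kapply X F u y = (\<Sum>z\<in>Y. q y z * (\<Sum>x\<in>X. F z x * u x))" .
    qed
    also have "\<dots> \<in> W" by (rule kernel_range[OF conjunct1[OF W(1)] q])
    finally show ?thesis .
  qed
  note FW = this
  show "\<forall>y x. F y x = 0"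
  proof (intro allI)
    fix y x
    from kapply_zero_if_not_iso[OF U W niso F FW kernel_column[OF p, of x]]
    have "kapply X F (\<lambda>y. p y x) y = 0" by simp
    then show "F y x = 0" unfolding kapply_def Fp .
  qed
qed

text \<open>An isomorphism is given only as a function that is linear on U, so it has to be turned
  into matrices. With A for \<phi> after p and B for its inverse after q, one gets q = A B and p = B
  A, and the characters agree because a trace is invariant under cyclic shifts.\<close>

lemma char_iso:
  assumes U: "X.submodule U" and p: "is_kernel X U p"
    and W: "Y.submodule W" and q: "is_kernel Y W q"
    and iso: "rep_iso G (pull r) U (pull s) W" and g: "g \<in> carrier G"
  shows "rep_char Y s q g = rep_char X r p g"
proof -
  from iso obtain \<phi> where bij: "bij_betw \<phi> U W"
    and add: "\<And>u v. u \<in> U \<Longrightarrow> v \<in> U \<Longrightarrow> \<phi> (u + v) = \<phi> u + \<phi> v"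
    and scale: "\<And>c u. u \<in> U \<Longrightarrow> \<phi> (cscale c u) = cscale c (\<phi> u)"
    and eq: "\<And>g u. g \<in> carrier G \<Longrightarrow> u \<in> U \<Longrightarrow> \<phi> (pull r g u) = pull s g (\<phi> u)"
    unfolding rep_iso_def by blast
  have subU: "cfun.subspace U" using X.submoduleD(1)[OF U] .
  have \<phi>0: "\<phi> 0 = 0" using scale[of 0 0] cfun.subspace_0[OF subU]
    by (simp only: cfun.scale_zero_left)
  have sum: "\<phi> (\<Sum>x\<in>A. cscale (c x) (f x)) = (\<Sum>x\<in>A. cscale (c x) (\<phi> (f x)))"
    if "\<And>x. x \<in> A \<Longrightarrow> f x \<in> U" for A c and f :: "'x \<Rightarrow> 'x \<Rightarrow> complex"
    using that
  proof (induction A rule: infinite_finite_induct)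
    case (insert a A)
    have "\<phi> (cscale (c a) (f a) + (\<Sum>x\<in>A. cscale (c x) (f x)))
        = \<phi> (cscale (c a) (f a)) + \<phi> (\<Sum>x\<in>A. cscale (c x) (f x))"
      using insert.prems subU by (intro add cfun.subspace_sum cfun.subspace_scale) auto
    moreover have "\<phi> (cscale (c a) (f a)) = cscale (c a) (\<phi> (f a))"
      using insert.prems by (intro scale) simp
    moreover have "\<phi> (\<Sum>x\<in>A. cscale (c x) (f x)) = (\<Sum>x\<in>A. cscale (c x) (\<phi> (f x)))"
      using insert.prems by (intro insert.IH) simp
    ultimately show ?case by (simp only: sum.insert[OF insert.hyps])
  qed (simp_all add: \<phi>0)
  have expand: "\<phi> u = (\<lambda>y. \<Sum>x\<in>X. u x * \<phi> (\<lambda>z. p z x) y)" if "u \<in> U" for u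
  proof -
    have "u = (\<Sum>x\<in>X. cscale (u x) (\<lambda>z. p z x))"
      using kernel_reproduces[OF p that] by (auto simp: sum_fun_apply cscale_def mult.commute)
    then have "\<phi> u = (\<Sum>x\<in>X. cscale (u x) (\<phi> (\<lambda>z. p z x)))"
      using sum[of X "\<lambda>x z. p z x" u] kernel_column[OF p] by metis
    then show ?thesis by (auto simp: sum_fun_apply cscale_def)
  qed
  define \<psi> where "\<psi> = inv_into U \<phi>"
  have \<psi>U: "\<psi> w \<in> U" and \<phi>\<psi>: "\<phi> (\<psi> w) = w" if "w \<in> W" for w
    using bij that unfolding \<psi>_def bij_betw_def by (auto simp: inv_into_into f_inv_into_f)
  have \<psi>\<phi>: "\<psi> (\<phi> u) = u" if "u \<in> U" for u
    using bij that unfolding \<psi>_def by (simp add: bij_betw_inv_into_left)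
  have \<phi>W: "\<phi> u \<in> W" if "u \<in> U" for u using bij that unfolding bij_betw_def by blast
  define A where "A = (\<lambda>y x. \<phi> (\<lambda>z. p z x) y)"
  define B where "B = (\<lambda>x y. \<psi> (\<lambda>z. q z y) x)"
  have qAB: "q y' y = (\<Sum>x\<in>X. B x y * A y' x)" for y' y
    using fun_cong[OF expand[OF \<psi>U[OF kernel_column[OF q, of y]]], of y']
    unfolding A_def B_def by (simp add: \<phi>\<psi>[OF kernel_column[OF q]])
  have BA: "(\<Sum>y\<in>Y. B x' y * A y x) = p x' x" for x' x
  proof -
    have inj: "u = v" if "u \<in> U" "v \<in> U" "\<phi> u = \<phi> v" for u v
      using that \<psi>\<phi> by metis
    define v where "v = (\<Sum>y\<in>Y. cscale (A y x) (\<psi> (\<lambda>z. q z y)))"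
    have vU: "v \<in> U" unfolding v_def using subU \<psi>U[OF kernel_column[OF q]]
      by (intro cfun.subspace_sum cfun.subspace_scale)
    have "\<phi> v = \<phi> (\<lambda>z. p z x)"
    proof
      fix y'
      have "\<phi> v y' = (\<Sum>x\<in>X. v x * A y' x)"
        using fun_cong[OF expand[OF vU]] unfolding A_def .
      also have "\<dots> = (\<Sum>x1\<in>X. (\<Sum>y\<in>Y. A y x * B x1 y) * A y' x1)"
        unfolding v_def B_def by (simp add: sum_fun_apply cscale_def)
      also have "\<dots> = (\<Sum>y\<in>Y. A y x * (\<Sum>x1\<in>X. B x1 y * A y' x1))"
        by (simp add: sum_distrib_left sum_distrib_right mult_ac, rule sum.swap)
      also have "\<dots> = (\<Sum>y\<in>Y. q y' y * A y x)" unfolding qAB[symmetric] by (simp only: mult.commute)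
      also have "\<dots> = A y' x"
        unfolding A_def using kernel_reproduces[OF q \<phi>W[OF kernel_column[OF p]]] .
      finally show "\<phi> v y' = \<phi> (\<lambda>z. p z x) y'" unfolding A_def .
    qed
    from fun_cong[OF inj[OF vU kernel_column[OF p] this], of x']
    show ?thesis unfolding v_def B_def by (simp add: sum_fun_apply cscale_def mult.commute)
  qed
  have shift: "A (s g y) x = (\<Sum>z\<in>X. p (r g z) x * A y z)" for y x
  proof -
    have "A (s g y) x = \<phi> (pull r g (\<lambda>z. p z x)) y"
      unfolding A_def eq[OF g kernel_column[OF p]] by (simp add: pull_def)
    also have "\<dots> = (\<Sum>z\<in>X. pull r g (\<lambda>z. p z x) z * A y z)"
      using fun_cong[OF expand[OF X.submoduleD(3)[OF U g kernel_column[OF p]]]] unfolding A_def .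
    finally show ?thesis unfolding pull_def .
  qed
  have "rep_char Y s q g = (\<Sum>y\<in>Y. \<Sum>x\<in>X. B x y * (\<Sum>z\<in>X. p (r g z) x * A y z))"
    unfolding rep_char_def qAB shift ..
  also have "\<dots> = (\<Sum>x\<in>X. \<Sum>z\<in>X. p (r g z) x * (\<Sum>y\<in>Y. B x y * A y z))"
    by (simp add: sum_distrib_left mult_ac, subst sum.swap, rule sum.cong[OF refl], rule sum.swap)
  also have "\<dots> = (\<Sum>z\<in>X. \<Sum>x\<in>X. p (r g z) x * p x z)"
    unfolding BA by (rule sum.swap)
  also have "\<dots> = rep_char X r p g"
    unfolding rep_char_def kernel_idem[OF p] ..
  finally show ?thesis .
qed

end

section \<open>Complete reducibility and multiplicities\<close>

definition kernel_of :: "'x set \<Rightarrow> ('x \<Rightarrow> complex) set \<Rightarrow> 'x \<Rightarrow> 'x \<Rightarrow> complex" where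
  "kernel_of X V = (SOME p. is_kernel X V p)"

text \<open>The dimension of V, obtained as the trace of its projection; it serves as the measure in
  inductions on submodules.\<close>

definition rank_of :: "'x set \<Rightarrow> ('x \<Rightarrow> complex) set \<Rightarrow> nat" where
  "rank_of X V = (SOME k. (\<Sum>x\<in>X. kernel_of X V x x) = of_nat k)"

lemma kernel_of:
  assumes "finite X" "supported_subspace X V"
  shows "is_kernel X V (kernel_of X V)"
  using kernel_exists[OF assms] unfolding kernel_of_def by (metis (lifting) someI)

lemma rank_of:
  assumes "finite X" "supported_subspace X V"
  shows "(\<Sum>x\<in>X. kernel_of X V x x) = of_nat (rank_of X V)"
proof -
  from kernel_exists[OF assms] obtain p k where pk: "is_kernel X V p" "(\<Sum>x\<in>X. p x x) = of_nat k"
    by blast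
  from kernel_unique[OF pk(1) kernel_of[OF assms]]
  have "(\<Sum>x\<in>X. kernel_of X V x x) = of_nat k" using pk(2) by simp
  then show ?thesis unfolding rank_of_def by (rule someI)
qed

text \<open>The difference d = q - p is again an orthogonal projection, so its trace is the sum of
  all |d z x|^2. This vanishes only if p = q, and then the two subspaces coincide.\<close>

lemma rank_strict_mono:
  assumes X: "finite X" and U: "supported_subspace X U" and V: "supported_subspace X V"
    and UV: "U \<subset> V"
  shows "rank_of X U < rank_of X V"
proof -
  define p q where "p = kernel_of X U" and "q = kernel_of X V"
  have p: "is_kernel X U p" and q: "is_kernel X V q"
    unfolding p_def q_def using kernel_of X U V by auto
  define d where "d = (\<lambda>z x. q z x - p z x)"
  have diag: "d x x = of_real (\<Sum>z\<in>X. (cmod (d z x))\<^sup>2)" for x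
  proof -
    have "(\<Sum>z\<in>X. q x z * p z x) = p x x"
      using kernel_reproduces[OF q] kernel_column[OF p] UV by blast
    moreover have "(\<Sum>z\<in>X. p x z * q z x) = p x x"
      using kernel_reproduces_row[OF q, of "\<lambda>y. p y x" x] kernel_column[OF p] UV
      by (auto simp flip: kernel_hermitian[OF p])
    ultimately have "(\<Sum>z\<in>X. d x z * d z x) = d x x"
      unfolding d_def using kernel_idem[OF p] kernel_idem[OF q]
      by (simp add: left_diff_distrib right_diff_distrib sum_subtractf)
    moreover have "(\<Sum>z\<in>X. d x z * d z x) = (\<Sum>z\<in>X. cnj (d z x) * d z x)"
    proof (intro sum.cong refl)
      fix z
      have "d x z = cnj (d z x)"
        unfolding d_def using kernel_hermitian[OF p, of x z] kernel_hermitian[OF q, of x z] by simp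
      then show "d x z * d z x = cnj (d z x) * d z x" by simp
    qed
    ultimately show ?thesis
      by (simp add: complex_norm_square mult.commute del: of_real_power)
  qed
  define t where "t = (\<Sum>x\<in>X. \<Sum>z\<in>X. (cmod (d z x))\<^sup>2)"
  have "(of_real (real (rank_of X V) - real (rank_of X U)) :: complex) = (\<Sum>x\<in>X. d x x)"
    unfolding d_def p_def q_def using rank_of[OF X U] rank_of[OF X V] by (simp add: sum_subtractf)
  also have "\<dots> = of_real t" unfolding t_def diag by (simp only: of_real_sum)
  finally have t: "real (rank_of X V) - real (rank_of X U) = t" by (simp only: of_real_eq_iff)
  have "t \<noteq> 0"
  proof
    assume "t = 0"
    then have "d z x = 0" if "x \<in> X" "z \<in> X" for z x
      unfolding t_def using X that by (simp add: sum_nonneg_eq_0_iff sum_nonneg)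
    moreover have "d z x = 0" if "x \<notin> X \<or> z \<notin> X" for z x
      unfolding d_def using kernel_support[OF U p] kernel_support[OF V q] that by auto
    ultimately have pq: "p z x = q z x" for z x unfolding d_def by (metis eq_iff_diff_eq_0)
    have "v \<in> U" if v: "v \<in> V" for v
    proof -
      have "(\<lambda>y. \<Sum>x\<in>X. p y x * v x) \<in> U" by (rule kernel_range[OF U p])
      also have "(\<lambda>y. \<Sum>x\<in>X. p y x * v x) = v" using kernel_reproduces[OF q v] pq by auto
      finally show ?thesis .
    qed
    then show False using UV by blast
  qed
  moreover have "t \<ge> 0" unfolding t_def by (simp add: sum_nonneg)
  ultimately show ?thesis using t by linarith
qed

section \<open>Irreducibility from scalar intertwiners, and Maschke's theorem\<close>

context perm_rep
begin

text \<open>F is not assumed to preserve U. For a submodule U the condition therefore says that all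
  its endomorphisms are scalars and also that it occurs only once in the function space on X, which
  is what James's argument yields for Specht modules.\<close>

definition schur_scalar :: "('x \<Rightarrow> complex) set \<Rightarrow> bool" where
  "schur_scalar U \<longleftrightarrow> (\<forall>F. equivariant G r r F \<longrightarrow> (\<forall>y x. y \<notin> X \<longrightarrow> F y x = 0) \<longrightarrow>
     (\<exists>c. \<forall>u\<in>U. kapply X F u = cscale c u))"

lemma kapply_kernel: "is_kernel X V p \<Longrightarrow> v \<in> V \<Longrightarrow> kapply X p v = v"
  unfolding kapply_def using kernel_reproduces by fastforce

text \<open>The projection onto a submodule W of U is equivariant, hence a scalar on U. If W has a
  nonzero vector this scalar is 1, so U is contained in W.\<close>

lemma schur_scalar_irreducible:
  assumes U: "submodule U" "U \<noteq> {0}" "schur_scalar U"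
  shows "irreducible_rep G (pull r) U"
  unfolding irreducible_rep_def
proof (intro conjI allI impI U(2) conjunct2[OF U(1)])
  fix W assume "invariant_subspace G (pull r) W \<and> W \<subseteq> U"
  then have W: "submodule W" and WU: "W \<subseteq> U" using submodule_subset[OF U(1)] by auto
  let ?p = "kernel_of X W"
  have p: "is_kernel X W ?p" using kernel_of[OF finite_X] W by blast
  obtain c where c: "\<And>u. u \<in> U \<Longrightarrow> kapply X ?p u = cscale c u"
    using U(3) kernel_equivariant[OF W p] kernel_support[OF conjunct1[OF W] p]
    unfolding schur_scalar_def by blast
  show "W = {0} \<or> W = U"
  proof (cases "W \<subseteq> {0}")
    case True
    then show ?thesis using cfun.subspace_0[OF submoduleD(1)[OF W]] by blast
  next
    case False
    then obtain w where w: "w \<in> W" "w \<noteq> 0" by blast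
    have "cscale c w = w" using c[of w] kapply_kernel[OF p w(1)] w WU by auto
    then have "cscale (c - 1) w = 0" by (auto simp: cscale_def fun_eq_iff algebra_simps)
    then have "c = 1" using w(2) by (simp only: cfun.scale_eq_0_iff) simp
    then have "u \<in> W" if "u \<in> U" for u
    proof -
      have "kapply X ?p u \<in> W"
        unfolding kapply_def by (rule kernel_range[OF conjunct1[OF W] p])
      then show ?thesis using c[OF that] \<open>c = 1\<close> by (simp only: cfun.scale_one)
    qed
    then show ?thesis using WU by blast
  qed
qed

text \<open>Every averaged rank-one operator is a multiple c p, and comparing traces gives c d = |G|
  p x0 y0 with d the trace of p. Summing the relevant entries and using p p = p leaves |G| after
  division by d.\<close>

lemma schur_scalar_norm:
  assumes U: "submodule U" "U \<noteq> {0}" "schur_scalar U" and p: "is_kernel X U p"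
  shows "(\<Sum>g\<in>carrier G. rep_char X r p g * cnj (rep_char X r p g)) = of_nat (card (carrier G))"
proof -
  interpret perm_rep_pair G X r X r ..
  define d where "d = (\<Sum>x\<in>X. p x x)"
  have "d \<noteq> 0"
  proof -
    have "{0} \<subset> U" using U(2) cfun.subspace_0[OF submoduleD(1)[OF U(1)]] by blast
    moreover have "supported_subspace X {0}"
      unfolding supported_subspace_def by (auto simp: cfun.subspace_single_0)
    ultimately have "rank_of X U > 0" using rank_strict_mono[OF finite_X _ conjunct1[OF U(1)]]
      by (metis gr_zeroI less_nat_zero_code)
    moreover have "p = kernel_of X U"
      using kernel_unique[OF p kernel_of[OF finite_X conjunct1[OF U(1)]]] .
    ultimately show ?thesis unfolding d_def using rank_of[OF finite_X conjunct1[OF U(1)]] by simp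
  qed
  have avg: "average p p y0 x0 y x * d = of_nat (card (carrier G)) * p x0 y0 * p y x" for y0 x0 y x
  proof -
    have "average p p y0 x0 y x = 0" if "y \<notin> X" for y x
      using average_left[OF U(1) p, where y = y] kernel_support[OF conjunct1[OF U(1)] p, of y] that
      by (metis (no_types, lifting) mult_zero_left sum.neutral)
    then obtain c where c: "\<And>u. u \<in> U \<Longrightarrow> kapply X (average p p y0 x0) u = cscale c u"
      using U(3) average_equivariant unfolding schur_scalar_def by blast
    have F: "average p p y0 x0 y x = c * p y x" for y x
      using fun_cong[OF c[OF kernel_column[OF p, of x]], of y] average_right[OF U(1) p]
      unfolding kapply_def cscale_def by simp
    have "c * d = (\<Sum>x\<in>X. average p p y0 x0 x x)" unfolding F d_def by (simp add: sum_distrib_left)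
    also have "\<dots> = (\<Sum>g\<in>carrier G. \<Sum>x\<in>X. p (r g x) y0 * p x0 (r g x))"
      unfolding average_def by (rule sum.swap)
    also have "\<dots> = (\<Sum>g\<in>carrier G. p x0 y0)"
    proof (intro sum.cong refl)
      fix g assume "g \<in> carrier G"
      from sum_act[OF this, of "\<lambda>x. p x y0 * p x0 x"]
      show "(\<Sum>x\<in>X. p (r g x) y0 * p x0 (r g x)) = p x0 y0"
        using kernel_idem[OF p, of x0 y0] by (simp add: mult.commute)
    qed
    finally have "c * d = of_nat (card (carrier G)) * p x0 y0" by simp
    then show ?thesis unfolding F by (simp add: algebra_simps)
  qed
  have "(\<Sum>g\<in>carrier G. rep_char X r p g * cnj (rep_char X r p g)) * d
      = (\<Sum>y\<in>X. \<Sum>x\<in>X. average p p y x y x * d)"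
    unfolding char_product_average[OF p] by (simp add: sum_distrib_right)
  also have "\<dots> = of_nat (card (carrier G)) * (\<Sum>x\<in>X. \<Sum>y\<in>X. p x y * p y x)"
    unfolding avg by (subst sum.swap) (simp add: sum_distrib_left mult_ac)
  also have "(\<Sum>x\<in>X. \<Sum>y\<in>X. p x y * p y x) = d"
    unfolding d_def kernel_idem[OF p] ..
  finally show ?thesis using \<open>d \<noteq> 0\<close> by simp
qed

lemma exists_irreducible:
  assumes V: "submodule V" "V \<noteq> {0}"
  shows "\<exists>W\<subseteq>V. submodule W \<and> irreducible_rep G (pull r) W"
proof -
  let ?P = "\<lambda>W. W \<subseteq> V \<and> W \<noteq> {0} \<and> submodule W"
  have "?P V" using V by auto
  from ex_has_least_nat[of ?P, OF this, of "rank_of X"]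
  obtain W where W: "?P W" and min: "\<And>W'. ?P W' \<Longrightarrow> rank_of X W \<le> rank_of X W'" by blast
  have "irreducible_rep G (pull r) W"
    unfolding irreducible_rep_def
  proof (intro conjI allI impI)
    fix W' assume W': "invariant_subspace G (pull r) W' \<and> W' \<subseteq> W"
    then have sub: "submodule W'" using submodule_subset W by blast
    show "W' = {0} \<or> W' = W"
    proof (rule ccontr)
      assume "\<not> ?thesis"
      then have "W' \<noteq> {0}" "W' \<subset> W" using W' by auto
      with min[of W'] rank_strict_mono[OF finite_X, of W' W] sub W show False by auto
    qed
  qed (use W in auto)
  then show ?thesis using W by blast
qed

lemma fip_pull: "g \<in> carrier G \<Longrightarrow> fip X (pull r g u) (pull r g v) = fip X u v"
  unfolding fip_def pull_def using sum_act[of g "\<lambda>x. u x * cnj (v x)"] .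

lemma orth_complement_submodule:
  assumes V: "submodule V" and W: "submodule W"
  shows "submodule {v\<in>V. \<forall>w\<in>W. fip X v w = 0}" (is "submodule ?C")
proof (rule submoduleI)
  have "fip X 0 w = 0" for w unfolding fip_def by simp
  moreover have "fip X (u + v) w = fip X u w + fip X v w" for u v w
    unfolding fip_def by (simp add: sum.distrib algebra_simps)
  ultimately show "cfun.subspace ?C"
    using submoduleD(1)[OF V] unfolding cfun.subspace_def by (simp add: fip_scale)
next
  fix g v assume g: "g \<in> carrier G" and v: "v \<in> ?C"
  have "fip X (pull r g v) w = 0" if w: "w \<in> W" for w
  proof -
    have "w = pull r g (pull r (inv\<^bsub>G\<^esub> g) w)" unfolding pull_def using act_inv[OF g] by simp
    then have "fip X (pull r g v) w = fip X v (pull r (inv\<^bsub>G\<^esub> g) w)" using fip_pull[OF g] by metis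
    then show ?thesis using v submoduleD(3)[OF W] w g group.inv_closed[OF group_G] by simp
  qed
  then show "pull r g v \<in> ?C" using v submoduleD(3)[OF V g] by simp
qed (use submoduleD(2)[OF V] in auto)

text \<open>Maschke's theorem through orthogonal complements, by induction on the rank. The summands
  are kept pairwise orthogonal because uniqueness of components is later read off from inner
  products.\<close>

lemma orthogonal_decomposition:
  assumes "submodule V"
  shows "\<exists>k W. (\<forall>i<k. irreducible_rep G (pull r) (W i) \<and> W i \<subseteq> V) \<and>
     (\<forall>i<k. \<forall>j<k. i \<noteq> j \<longrightarrow> (\<forall>u\<in>W i. \<forall>v\<in>W j. fip X u v = 0)) \<and>
     (\<forall>v\<in>V. \<exists>w. (\<forall>i<(k::nat). w i \<in> W i) \<and> v = (\<Sum>i<k. w i))"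
  using assms
proof (induction "rank_of X V" arbitrary: V rule: less_induct)
  case less
  show ?case
  proof (cases "V = {0}")
    case True
    then show ?thesis by (intro exI[of _ 0]) auto
  next
    case False
    from exists_irreducible[OF less.prems False] obtain W0
      where W0: "W0 \<subseteq> V" "submodule W0" "irreducible_rep G (pull r) W0" by blast
    define V' where "V' = {v\<in>V. \<forall>w\<in>W0. fip X v w = 0}"
    have V': "submodule V'" unfolding V'_def by (rule orth_complement_submodule[OF less.prems W0(2)])
    have "V' \<noteq> V"
    proof
      assume "V' = V"
      then have "fip X w w = 0" if "w \<in> W0" for w using that W0(1) unfolding V'_def by blast
      then have "w = 0" if "w \<in> W0" for w
        using that fip_self_eq_0[OF finite_X, of w] submoduleD(2)[OF W0(2) that] by fastforce
      then have "W0 \<subseteq> {0}" by blast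
      moreover have "0 \<in> W0" using cfun.subspace_0[OF submoduleD(1)[OF W0(2)]] .
      ultimately show False using W0(3) unfolding irreducible_rep_def by blast
    qed
    then have "V' \<subset> V" unfolding V'_def by blast
    then have "rank_of X V' < rank_of X V"
      using rank_strict_mono[OF finite_X] V' less.prems by blast
    from less.hyps[OF this V'] obtain k :: nat and W
      where W: "\<forall>i<k. irreducible_rep G (pull r) (W i) \<and> W i \<subseteq> V'"
        and orth: "\<forall>i<k. \<forall>j<k. i \<noteq> j \<longrightarrow> (\<forall>u\<in>W i. \<forall>v\<in>W j. fip X u v = 0)"
        and span: "\<forall>v\<in>V'. \<exists>w. (\<forall>i<k. w i \<in> W i) \<and> v = (\<Sum>i<k. w i)"
      by (elim exE conjE) (rule that)
    define W1 where "W1 = W(k := W0)"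
    have W0V': "fip X u v = 0" "fip X v u = 0" if "u \<in> V'" "v \<in> W0" for u v
      using that fip_cnj[of X v u] unfolding V'_def by auto
    have "\<exists>w. (\<forall>i<Suc k. w i \<in> W1 i) \<and> v = (\<Sum>i<Suc k. w i)" if v: "v \<in> V" for v
    proof -
      let ?p = "kernel_of X W0"
      have p: "is_kernel X W0 ?p" using kernel_of[OF finite_X] W0(2) by blast
      define a where "a = kapply X ?p v"
      have a: "a \<in> W0"
        unfolding a_def kapply_def by (rule kernel_range[OF conjunct1[OF W0(2)] p])
      have "fip X (v - a) w = 0" if w: "w \<in> W0" for w
      proof -
        have "fip X a w = (\<Sum>x\<in>X. v x * (\<Sum>y\<in>X. cnj (w y) * ?p y x))"
          unfolding a_def kapply_def fip_def
          by (simp add: sum_distrib_left sum_distrib_right mult_ac, rule sum.swap)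
        also have "\<dots> = fip X v w" unfolding kernel_reproduces_row[OF p w] fip_def ..
        finally show ?thesis by (simp add: fip_diff_left)
      qed
      moreover have "v - a \<in> V"
        using cfun.subspace_diff[OF submoduleD(1)[OF less.prems] v] a W0(1) by blast
      ultimately have "v - a \<in> V'" unfolding V'_def by blast
      from bspec[OF span this] obtain w where w: "\<And>i. i < k \<Longrightarrow> w i \<in> W i" "v - a = (\<Sum>i<k. w i)" by blast
      have "v = (\<Sum>i<k. w i) + a" unfolding w(2)[symmetric] by simp
      also have "\<dots> = (\<Sum>i<Suc k. (w(k := a)) i)" by (simp only: sum.lessThan_Suc) simp
      finally show ?thesis
        using w(1) a unfolding W1_def by (intro exI[of _ "w(k := a)"]) (auto simp: less_Suc_eq)
    qed
    moreover have "irreducible_rep G (pull r) (W1 i) \<and> W1 i \<subseteq> V" if "i < Suc k" for i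
      using W W0 that unfolding W1_def V'_def by (cases "i = k") (auto simp: less_Suc_eq)
    moreover have "fip X u v = 0"
      if ij: "i < Suc k" "j < Suc k" "i \<noteq> j" "u \<in> W1 i" "v \<in> W1 j" for i j u v
    proof (cases "i = k")
      case True
      then show ?thesis using ij W0V'(2)[of v u] W unfolding W1_def by (auto simp: less_Suc_eq)
    next
      case False
      then show ?thesis using ij W0V'(1)[of u v] W orth unfolding W1_def
        by (cases "j = k") (auto simp: less_Suc_eq)
    qed
    ultimately show ?thesis by (intro exI[of _ "Suc k"] exI[of _ W1]) blast
  qed
qed

lemma decomposition_exists:
  assumes V: "submodule V"
  shows "\<exists>k W. irreducible_decomposition G (pull r) V k W"
proof -
  from orthogonal_decomposition[OF V] obtain k :: nat and W
    where W': "\<forall>i<k. irreducible_rep G (pull r) (W i) \<and> W i \<subseteq> V"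
      and orth': "\<forall>i<k. \<forall>j<k. i \<noteq> j \<longrightarrow> (\<forall>u\<in>W i. \<forall>v\<in>W j. fip X u v = 0)"
      and span': "\<forall>v\<in>V. \<exists>w. (\<forall>i<k. w i \<in> W i) \<and> v = (\<Sum>i<k. w i)"
    by (elim exE conjE) (rule that)
  have W: "irreducible_rep G (pull r) (W i) \<and> W i \<subseteq> V" if "i < k" for i using W' that by simp
  have orth: "fip X u v = 0" if "i < k" "j < k" "i \<noteq> j" "u \<in> W i" "v \<in> W j" for i j u v
    using orth' that by simp
  note span = bspec[OF span']
  have "\<exists>!w. w \<in> (\<Pi>\<^sub>E i\<in>{..<k}. W i) \<and> v = (\<Sum>i<k. w i)" if v: "v \<in> V" for v
  proof -
    from span[OF v] obtain w where w: "\<And>i. i < k \<Longrightarrow> w i \<in> W i" "v = (\<Sum>i<k. w i)" by blast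
    show ?thesis
    \<comment> \<open>Components have to be extensional, so the family found is cut off to
      \<open>undefined\<close> outside its index range.\<close>
    proof (rule ex1I[of _ "restrict w {..<k}"])
      show "restrict w {..<k} \<in> (\<Pi>\<^sub>E i\<in>{..<k}. W i) \<and> v = (\<Sum>i<k. restrict w {..<k} i)"
        using w by auto
    next
      fix u assume u: "u \<in> (\<Pi>\<^sub>E i\<in>{..<k}. W i) \<and> v = (\<Sum>i<k. u i)"
      have "u j = w j" if j: "j < k" for j
      proof -
        have sW: "cfun.subspace (W i)" if "i < k" for i
          using W[OF that] unfolding irreducible_rep_def invariant_subspace_def by blast
        define d where "d = (\<lambda>i. u i - w i)"
        have dW: "d i \<in> W i" if "i < k" for i
          unfolding d_def using cfun.subspace_diff[OF sW[OF that]] u w(1) that by auto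
        have "(\<Sum>i<k. d i) = 0" unfolding d_def sum_subtractf using u w(2) by simp
        then have "0 = fip X (\<Sum>i<k. d i) (d j)" unfolding fip_def by simp
        also have "\<dots> = (\<Sum>i<k. fip X (d i) (d j))"
          unfolding fip_def by (simp add: sum_fun_apply sum_distrib_right, rule sum.swap)
        also have "\<dots> = (\<Sum>i<k. if i = j then fip X (d j) (d j) else 0)"
          using orth dW j by (intro sum.cong) auto
        also have "\<dots> = fip X (d j) (d j)" using j by simp
        finally have "\<And>x. x \<in> X \<Longrightarrow> d j x = 0" using fip_self_eq_0[OF finite_X] by metis
        moreover have "\<And>x. x \<notin> X \<Longrightarrow> d j x = 0"
          using submoduleD(2)[OF V] dW[OF j] W[OF j] by blast
        ultimately show ?thesis unfolding d_def by (auto simp: fun_eq_iff)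
      qed
      then show "u = restrict w {..<k}" using u by (intro PiE_ext[of u "{..<k}" W]) (use w(1) in auto)
    qed
  qed
  then have "irreducible_decomposition G (pull r) V k W"
    using W' unfolding irreducible_decomposition_def by simp
  then show ?thesis by blast
qed

text \<open>The given decomposition need not be orthogonal, so its component maps \<open>e i\<close>
  are oblique projections. They have the same range \<open>W i\<close> as \<open>Q i\<close>, and
  tr(g e i) = tr(g Q i e i) = tr(e i g Q i) = tr(g Q i), the last step because g preserves
  \<open>W i\<close>.\<close>

lemma char_decomposition:
  assumes V: "submodule V" and q: "is_kernel X V q"
    and dec: "irreducible_decomposition G (pull r) V k W"
    and qi: "\<And>i. i < k \<Longrightarrow> is_kernel X (W i) (Q i)" and g: "g \<in> carrier G"
  shows "rep_char X r q g = (\<Sum>i<k. rep_char X r (Q i) g)"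
proof -
  define D where "D = (\<lambda>v. THE w. w \<in> (\<Pi>\<^sub>E i\<in>{..<k}. W i) \<and> v = (\<Sum>i<k. w i))"
  have ex1: "\<exists>!w. w \<in> (\<Pi>\<^sub>E i\<in>{..<k}. W i) \<and> v = (\<Sum>i<k. w i)" if "v \<in> V" for v
    using dec that unfolding irreducible_decomposition_def by blast
  have D: "D v \<in> (\<Pi>\<^sub>E i\<in>{..<k}. W i)" "v = (\<Sum>i<k. D v i)" if "v \<in> V" for v
    using theI'[OF ex1[OF that]] unfolding D_def by auto
  have D_unique: "D v i = w i" if "v \<in> V" "\<And>i. i < k \<Longrightarrow> w i \<in> W i" "v = (\<Sum>i<k. w i)" "i < k" for v w i
  proof -
    have "D v = restrict w {..<k}"
      unfolding D_def
      by (rule the1_equality[OF ex1[OF \<open>v \<in> V\<close>]]) (use that(2,3) in auto)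
    then show ?thesis using that(4) by simp
  qed
  have sW: "cfun.subspace (W i)" and WV: "W i \<subseteq> V" and invW: "invariant_subspace G (pull r) (W i)" if "i < k" for i
    using dec that unfolding irreducible_decomposition_def irreducible_rep_def invariant_subspace_def
    by blast+
  define e where "e = (\<lambda>i y x. D (\<lambda>z. q z x) i y)"
  have eW: "(\<lambda>y. e i y x) \<in> W i" if "i < k" for i x
    unfolding e_def using D(1)[OF kernel_column[OF q]] that by auto
  have e_sum: "(\<Sum>i<k. e i y x) = q y x" for y x
    using fun_cong[OF D(2)[OF kernel_column[OF q, of x]], of y] unfolding e_def
    by (simp add: sum_fun_apply)
  have e_id: "(\<Sum>x\<in>X. e i y x * w x) = w y" if i: "i < k" and w: "w \<in> W i" for i w y
  proof -
    have wV: "w \<in> V" using w WV[OF i] by blast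
    have "D w i = w"
      using D_unique[OF wV _ _ i, of "\<lambda>j. if j = i then w else 0"] i w cfun.subspace_0[OF sW]
      by simp
    \<comment> \<open>\<open>D\<close> is given only by a description, so its linearity has to come
      from the uniqueness of the decomposition.\<close>
    moreover have "D w i = (\<lambda>y. \<Sum>x\<in>X. w x * e i y x)"
    proof (rule D_unique[OF wV _ _ i])
      show "(\<lambda>y. \<Sum>x\<in>X. w x * e j y x) \<in> W j" if "j < k" for j
        using subspace_lincomb[OF sW[OF that], of X "\<lambda>x y. e j y x"] eW[OF that] by blast
      show "w = (\<Sum>j<k. (\<lambda>y. \<Sum>x\<in>X. w x * e j y x))"
      proof
        fix y
        have "(\<Sum>j<k. (\<lambda>y. \<Sum>x\<in>X. w x * e j y x)) y = (\<Sum>x\<in>X. w x * (\<Sum>j<k. e j y x))"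
          by (simp add: sum_fun_apply sum_distrib_left, rule sum.swap)
        also have "\<dots> = w y"
          unfolding e_sum using kernel_reproduces[OF q wV] by (simp add: mult.commute)
        finally show "w y = (\<Sum>j<k. (\<lambda>y. \<Sum>x\<in>X. w x * e j y x)) y" by simp
      qed
    qed
    ultimately show ?thesis by (simp add: mult.commute fun_eq_iff)
  qed
  have part: "(\<Sum>x\<in>X. e i (r g x) x) = rep_char X r (Q i) g" if i: "i < k" for i
  proof -
    have "(\<Sum>x\<in>X. e i (r g x) x) = (\<Sum>x\<in>X. \<Sum>z\<in>X. Q i (r g x) z * e i z x)"
      using kernel_reproduces[OF qi[OF i] eW[OF i]] by simp
    also have "\<dots> = (\<Sum>z\<in>X. \<Sum>x\<in>X. e i z x * Q i (r g x) z)"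
      by (subst sum.swap) (simp add: mult.commute)
    also have "\<dots> = (\<Sum>z\<in>X. Q i (r g z) z)"
    proof (intro sum.cong refl)
      fix z
      have "pull r g (\<lambda>y. Q i y z) \<in> W i"
        using invW[OF i] kernel_column[OF qi[OF i]] g unfolding invariant_subspace_def by blast
      from e_id[OF i this, of z] show "(\<Sum>x\<in>X. e i z x * Q i (r g x) z) = Q i (r g z) z"
        unfolding pull_def .
    qed
    finally show ?thesis unfolding rep_char_def .
  qed
  have "rep_char X r q g = (\<Sum>x\<in>X. \<Sum>i<k. e i (r g x) x)"
    unfolding rep_char_def e_sum ..
  also have "\<dots> = (\<Sum>i<k. rep_char X r (Q i) g)"
    by (subst sum.swap) (simp add: part)
  finally show ?thesis .
qed

end

section \<open>Multiplicities as inner products of characters\<close>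

context perm_rep_pair
begin

text \<open>Each summand contributes |G| or 0 to the pairing of characters. The number of summands
  isomorphic to U is thus the same for every decomposition, as the definite description in
  \<open>multiplicity_in\<close> demands.\<close>

lemma multiplicity_in_char:
  assumes U: "X.submodule U" "U \<noteq> {0}" "X.schur_scalar U" and p: "is_kernel X U p"
    and V: "Y.submodule V" and q: "is_kernel Y V q"
  shows "of_nat (multiplicity_in G (pull r) U (pull s) V) * of_nat (card (carrier G))
    = (\<Sum>g\<in>carrier G. rep_char Y s q g * cnj (rep_char X r p g))" (is "_ = ?S")
proof -
  have irrU: "irreducible_rep G (pull r) U" by (rule X.schur_scalar_irreducible[OF U])
  have card_pos: "card (carrier G) \<noteq> 0"
    using X.finite_G monoid.one_closed[OF group.is_monoid[OF X.group_G]] by auto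
  have count: "of_nat (card {i. i < k \<and> rep_iso G (pull r) U (pull s) (W i)}) * of_nat (card (carrier G)) = ?S"
    if dec: "irreducible_decomposition G (pull s) V k W" for k W
  proof -
    have W: "Y.submodule (W i)" "irreducible_rep G (pull s) (W i)" if "i < k" for i
    proof -
      show irr: "irreducible_rep G (pull s) (W i)"
        using dec that unfolding irreducible_decomposition_def by blast
      have "W i \<subseteq> V" using dec that unfolding irreducible_decomposition_def by blast
      with irr show "Y.submodule (W i)"
        unfolding irreducible_rep_def by (intro Y.submodule_subset[OF V]) simp_all
    qed
    define Q where "Q = (\<lambda>i. kernel_of Y (W i))"
    have Q: "is_kernel Y (W i) (Q i)" if "i < k" for i
      unfolding Q_def using kernel_of[OF Y.finite_X] W(1)[OF that] by blast
    have "?S = (\<Sum>g\<in>carrier G. \<Sum>i<k. rep_char Y s (Q i) g * cnj (rep_char X r p g))"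
      using Y.char_decomposition[OF V q dec Q] by (simp add: sum_distrib_right)
    also have "\<dots> = (\<Sum>i<k. \<Sum>g\<in>carrier G. rep_char Y s (Q i) g * cnj (rep_char X r p g))"
      by (rule sum.swap)
    also have "\<dots> = (\<Sum>i<k. if rep_iso G (pull r) U (pull s) (W i) then of_nat (card (carrier G)) else 0)"
    proof (intro sum.cong refl)
      fix i assume "i \<in> {..<k}"
      then have i: "i < k" by simp
      show "(\<Sum>g\<in>carrier G. rep_char Y s (Q i) g * cnj (rep_char X r p g))
        = (if rep_iso G (pull r) U (pull s) (W i) then of_nat (card (carrier G)) else 0)"
        using char_iso[OF U(1) p W(1)[OF i] Q[OF i]] X.schur_scalar_norm[OF U p]
          char_orthogonal_irreducible[OF U(1) irrU p W(1)[OF i] W(2)[OF i] Q[OF i]]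
        by auto
    qed
    also have "\<dots> = of_nat (card {i. i < k \<and> rep_iso G (pull r) U (pull s) (W i)}) * of_nat (card (carrier G))"
    proof -
      have "{..<k} \<inter> {i. rep_iso G (pull r) U (pull s) (W i)} = {i. i < k \<and> rep_iso G (pull r) U (pull s) (W i)}"
        by auto
      then show ?thesis by (simp add: sum.If_cases)
    qed
    finally show ?thesis by simp
  qed
  from Y.decomposition_exists[OF V] obtain k W
    where dec: "irreducible_decomposition G (pull s) V k W" by blast
  have "multiplicity_in G (pull r) U (pull s) V = card {i. i < k \<and> rep_iso G (pull r) U (pull s) (W i)}"
    unfolding multiplicity_in_def
  proof (rule the_equality)
    show "\<exists>k' W'. irreducible_decomposition G (pull s) V k' W' \<and>
        card {i. i < k \<and> rep_iso G (pull r) U (pull s) (W i)} =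
        card {i. i < k' \<and> rep_iso G (pull r) U (pull s) (W' i)}"
      using dec by blast
  next
    fix m assume "\<exists>k W. irreducible_decomposition G (pull s) V k W \<and>
        m = card {i. i < k \<and> rep_iso G (pull r) U (pull s) (W i)}"
    then have "(of_nat m :: complex) * of_nat (card (carrier G)) = ?S" using count by blast
    with count[OF dec] have "(of_nat m :: complex) * of_nat (card (carrier G))
        = of_nat (card {i. i < k \<and> rep_iso G (pull r) U (pull s) (W i)}) * of_nat (card (carrier G))"
      by (simp only:)
    then have "(of_nat m :: complex) = of_nat (card {i. i < k \<and> rep_iso G (pull r) U (pull s) (W i)})"
      using card_pos by (simp only: mult_cancel_right of_nat_eq_0_iff) simp
    then show "m = card {i. i < k \<and> rep_iso G (pull r) U (pull s) (W i)}" by (simp only: of_nat_eq_iff)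
  qed
  then show ?thesis using count[OF dec] by simp
qed

end

section \<open>Tabloids\<close>

text \<open>Row lengths are integers in any order, so that shifted partitions fit. A negative length
  gives the empty set and the zero character, in accordance with the convention that complete
  symmetric functions of negative degree vanish.\<close>

definition tabloids :: "nat \<Rightarrow> nat \<Rightarrow> (nat \<Rightarrow> int) \<Rightarrow> (nat \<Rightarrow> nat) set" where
  "tabloids n l a = {w \<in> {1..n} \<rightarrow>\<^sub>E {..<l}. \<forall>i<l. int (card {x\<in>{1..n}. w x = i}) = a i}"

abbreviation relabel :: "(nat \<Rightarrow> nat) \<Rightarrow> (nat \<Rightarrow> nat) \<Rightarrow> nat \<Rightarrow> nat" where
  "relabel p w \<equiv> w \<circ> p"

lemma perm_action_eq_pull: "perm_action = pull relabel"
  by (simp add: fun_eq_iff perm_action_def pull_def)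

lemma carrier_sym_group: "carrier (sym_group n) = {p. p permutes {1..n}}"
  by (simp add: sym_group_def)

lemma finite_carrier_sym_group: "finite (carrier (sym_group n))"
  by (simp add: carrier_sym_group finite_permutations)

lemma finite_tabloids: "finite (tabloids n l a)"
  unfolding tabloids_def by (rule finite_subset[of _ "{1..n} \<rightarrow>\<^sub>E {..<l}"]) (auto intro: finite_PiE)

lemma card_fibre_permute:
  assumes "p permutes {1..n}"
  shows "card {x\<in>{1..n}. w (p x) = i} = card {x\<in>{1..n}. w x = (i::'a)}"
proof -
  have "p ` {x\<in>{1..n}. w (p x) = i} = {x\<in>{1..n}. w x = i}" (is "p ` ?A = ?B")
  proof
    show "p ` ?A \<subseteq> ?B" using permutes_in_image[OF assms] by auto
    show "?B \<subseteq> p ` ?A"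
    proof
      fix y assume y: "y \<in> ?B"
      then have "inv' p y \<in> ?A"
        using permutes_in_image[OF permutes_inv[OF assms]] permutes_inverses(1)[OF assms] by auto
      then show "y \<in> p ` ?A"
        using permutes_inverses(1)[OF assms, of y] by (intro image_eqI[of y p "inv' p y"]) simp_all
    qed
  qed
  then show ?thesis using card_image[OF permutes_inj_on[OF assms, of ?A]] by simp
qed

lemma comp_permutes_eq_iff:
  assumes "q permutes S"
  shows "x \<circ> q = t \<longleftrightarrow> x = t \<circ> inv' q"
proof
  show "x = t \<circ> inv' q" if "x \<circ> q = t"
    unfolding that[symmetric] by (simp add: fun_eq_iff permutes_inverses[OF assms])
  show "x \<circ> q = t" if "x = t \<circ> inv' q"
    unfolding that by (simp add: fun_eq_iff permutes_inverses[OF assms])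
qed

lemma tabloids_relabel:
  assumes p: "p permutes {1..n}" and w: "w \<in> tabloids n l a"
  shows "relabel p w \<in> tabloids n l a"
proof -
  have "relabel p w \<in> {1..n} \<rightarrow>\<^sub>E {..<l}"
  proof (rule PiE_I)
    fix x assume "x \<in> {1..n}"
    then have "p x \<in> {1..n}" using permutes_in_image[OF p] by blast
    then show "(w \<circ> p) x \<in> {..<l}" using w unfolding tabloids_def by auto
  next
    fix x assume "x \<notin> {1..n}"
    then show "(w \<circ> p) x = undefined" using w permutes_not_in[OF p] unfolding tabloids_def
      by (auto simp: PiE_def extensional_def)
  qed
  then show ?thesis using w card_fibre_permute[OF p, of w] unfolding tabloids_def by simp
qed

lemma perm_rep_tabloids: "perm_rep (sym_group n) (tabloids n l a) relabel"
  by (rule perm_rep.intro)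
    (simp_all add: sym_group_is_group finite_carrier_sym_group finite_tabloids sym_group_carrier
      sym_group_mult sym_group_one tabloids_relabel comp_assoc)

lemma sum_initial_segment_le:
  fixes A :: "nat set"
  assumes "finite A"
  shows "\<Sum>{..<card A} \<le> \<Sum>A \<and> (\<Sum>A = \<Sum>{..<card A} \<longrightarrow> A = {..<card A})"
  using assms
proof (induction A rule: finite_linorder_max_induct)
  case empty
  then show ?case by simp
next
  case (insert b A)
  have bA: "b \<notin> A" using insert.hyps(2) by blast
  have le: "card A \<le> b" using card_mono[of "{..<b}" A] insert.hyps(2) by auto
  have card: "card (insert b A) = Suc (card A)" using insert.hyps(1) bA by simp
  have sum: "\<Sum>(insert b A) = b + \<Sum>A" using insert.hyps(1) bA by simp
  show ?case unfolding card sum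
  proof (intro conjI impI)
    show "\<Sum>{..<Suc (card A)} \<le> b + \<Sum>A" using le insert.IH by simp
    assume "b + \<Sum>A = \<Sum>{..<Suc (card A)}"
    then have "b = card A \<and> \<Sum>A = \<Sum>{..<card A}" using le insert.IH by simp
    then show "insert b A = {..<Suc (card A)}" using insert.IH by (auto simp: lessThan_Suc)
  qed
qed

section \<open>Specht modules\<close>

text \<open>\<open>l\<close> is an upper bound for the number of rows, not the exact number, so that
  three partitions can be treated with the same group of row permutations.\<close>

locale partition_shape =
  fixes \<mu> :: "nat \<Rightarrow> nat" and l n :: nat
  assumes anti: "antimono \<mu>" and zero_beyond: "\<And>i. l \<le> i \<Longrightarrow> \<mu> i = 0" and size: "n = (\<Sum>i<l. \<mu> i)"
begin

lemma psize: "psize \<mu> = n"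
  unfolding psize_def size
  by (rule sum.mono_neutral_left) (auto simp: not_le intro: leI dest: zero_beyond, metis leI less_irrefl_nat zero_beyond)

lemma diagram_eq: "diagram \<mu> = Sigma {..<l} (\<lambda>i. {..<\<mu> i})"
  unfolding diagram_def using zero_beyond by (auto, metis leI less_nat_zero_code zero_beyond)

lemma finite_diagram: "finite (diagram \<mu>)" and card_diagram: "card (diagram \<mu>) = n"
  unfolding diagram_eq size by simp_all

lemma tableau_exists: "\<exists>T. is_tableau \<mu> T"
  unfolding is_tableau_def psize using ex_bij_betw_nat_finite_1[OF finite_diagram] card_diagram by metis

abbreviation "M \<equiv> tabloids n l (\<lambda>i. int (\<mu> i))"

sublocale M: perm_rep "sym_group n" M relabel by (rule perm_rep_tabloids)

end

section \<open>The column antisymmetriser of a tableau\<close>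

locale tableau = partition_shape +
  fixes T :: "nat \<Rightarrow> nat \<times> nat"
  assumes tableau: "is_tableau \<mu> T"
begin

abbreviation "t \<equiv> tabloid n T"
abbreviation "C \<equiv> column_stabilizer n T"
abbreviation "tcol x \<equiv> snd (T x)"

lemma T_bij: "bij_betw T {1..n} (diagram \<mu>)"
  using tableau unfolding is_tableau_def psize .

lemma t_eq: "x \<in> {1..n} \<Longrightarrow> t x = fst (T x)"
  by (simp add: tabloid_def)

lemma T_in: "x \<in> {1..n} \<Longrightarrow> T x \<in> diagram \<mu>"
  using T_bij unfolding bij_betw_def by blast

lemma t_tabloid: "t \<in> M"
proof -
  have "t \<in> {1..n} \<rightarrow>\<^sub>E {..<l}"
    using T_in unfolding tabloid_def diagram_eq by (force simp: PiE_def extensional_def)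
  moreover have "card {x\<in>{1..n}. t x = i} = \<mu> i" if i: "i < l" for i
  proof -
    have "T ` {x\<in>{1..n}. t x = i} = Pair i ` {..<\<mu> i}"
    proof
      show "T ` {x\<in>{1..n}. t x = i} \<subseteq> Pair i ` {..<\<mu> i}"
      proof
        fix y assume "y \<in> T ` {x\<in>{1..n}. t x = i}"
        then obtain x where x: "x \<in> {1..n}" and i: "i = t x" and y: "y = T x" by blast
        then have "T x = (i, snd (T x))" using t_eq[OF x] by (simp add: prod_eq_iff)
        moreover have "snd (T x) < \<mu> i" using T_in[OF x] t_eq[OF x] i by (auto simp: diagram_def)
        ultimately show "y \<in> Pair i ` {..<\<mu> i}" using i y by auto
      qed
      show "Pair i ` {..<\<mu> i} \<subseteq> T ` {x\<in>{1..n}. t x = i}"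
      proof
        fix y assume "y \<in> Pair i ` {..<\<mu> i}"
        then obtain j where y: "y = (i, j)" and "j < \<mu> i" by blast
        then have "(i, j) \<in> diagram \<mu>" by (simp add: diagram_def)
        then obtain x where x: "x \<in> {1..n}" "T x = (i, j)" using T_bij unfolding bij_betw_def by force
        then show "y \<in> T ` {x\<in>{1..n}. t x = i}" using t_eq[OF x(1)] y by force
      qed
    qed
    moreover have "inj_on T {x\<in>{1..n}. t x = i}"
      using T_bij unfolding bij_betw_def by (auto intro: inj_on_subset)
    ultimately have "card {x\<in>{1..n}. t x = i} = card (Pair i ` {..<\<mu> i})"
      using card_image[of T "{x\<in>{1..n}. t x = i}"] by simp
    then show ?thesis by (simp add: card_image inj_on_def)
  qed
  ultimately show ?thesis unfolding tabloids_def by simp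
qed

lemma C_iff: "q \<in> C \<longleftrightarrow> q permutes {1..n} \<and> (\<forall>x\<in>{1..n}. tcol (q x) = tcol x)"
  unfolding column_stabilizer_def carrier_sym_group by simp

lemma finite_C: "finite C"
  unfolding column_stabilizer_def using finite_carrier_sym_group by simp

lemma C_comp: "p \<in> C \<Longrightarrow> q \<in> C \<Longrightarrow> p \<circ> q \<in> C"
  unfolding C_iff using permutes_in_image permutes_compose[of q "{1..n}" p] by (metis comp_apply)

lemma C_inv: "p \<in> C \<Longrightarrow> inv' p \<in> C"
  unfolding C_iff using permutes_inv permutes_in_image permutes_inverses(1) by metis

lemma C_permutation: "p \<in> C \<Longrightarrow> permutation p"
  unfolding C_iff using permutes_imp_permutation by blast

lemma C_bij: "p \<in> C \<Longrightarrow> bij_betw (\<lambda>q. p \<circ> q) C C"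
proof (rule bij_betwI[where g = "\<lambda>q. inv' p \<circ> q"])
  assume p: "p \<in> C"
  then have pp: "p permutes {1..n}" unfolding C_iff by blast
  show "(\<lambda>q. p \<circ> q) \<in> C \<rightarrow> C" "(\<lambda>q. inv' p \<circ> q) \<in> C \<rightarrow> C" using C_comp C_inv p by auto
  show "inv' p \<circ> (p \<circ> q) = q" "p \<circ> (inv' p \<circ> q) = q" for q
    using permutes_inv_o[OF pp] by (simp_all flip: comp_assoc)
qed

text \<open>The column antisymmetriser applied to f. It is evaluated at arbitrary functions w, so
  that it also acts on tabloids of shapes other than \<mu>, as \<open>csum_small\<close>
  needs.\<close>

definition csum :: "((nat \<Rightarrow> nat) \<Rightarrow> complex) \<Rightarrow> (nat \<Rightarrow> nat) \<Rightarrow> complex" where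
  "csum f w = (\<Sum>q\<in>C. of_int (sign q) * f (w \<circ> q))"

lemma csum_translate:
  assumes p: "p \<in> C"
  shows "csum f (w \<circ> p) = of_int (sign p) * csum f w"
proof -
  have "csum f w = (\<Sum>q\<in>C. of_int (sign (p \<circ> q)) * f (w \<circ> (p \<circ> q)))"
    unfolding csum_def
    using sum.reindex_bij_betw[OF C_bij[OF p], of "\<lambda>q. of_int (sign q) * f (w \<circ> q)"] by simp
  also have "\<dots> = (\<Sum>q\<in>C. of_int (sign p) * (of_int (sign q) * f (w \<circ> p \<circ> q)))"
    using C_permutation p by (intro sum.cong refl) (simp add: sign_compose comp_assoc mult_ac)
  also have "\<dots> = of_int (sign p) * csum f (w \<circ> p)" unfolding csum_def by (simp add: sum_distrib_left)
  finally have "csum f w = of_int (sign p) * csum f (w \<circ> p)" .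
  moreover have "(of_int (sign p) * of_int (sign p) :: complex) = 1" by (simp add: sign_def)
  ultimately show ?thesis by (simp flip: mult.assoc)
qed

text \<open>The transposition of x and y lies in the column group, fixes w and has sign -1, so the
  sum is its own negative.\<close>

lemma csum_clash:
  assumes xy: "x \<in> {1..n}" "y \<in> {1..n}" "x \<noteq> y" "tcol x = tcol y" "w x = w y"
  shows "csum f w = 0"
proof -
  let ?p = "Transposition.transpose x y"
  have "?p \<in> C" unfolding C_iff using xy by (auto simp: permutes_swap_id Transposition.transpose_def)
  moreover have "w \<circ> ?p = w" using xy(5) by (auto simp: Transposition.transpose_def)
  moreover have "sign ?p = -1" using xy(3) by (simp add: sign_swap_id)
  ultimately have "csum f w = - csum f w" using csum_translate[of ?p f w] by simp
  then show ?thesis by simp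
qed

text \<open>Weigh every entry by its row. If the entries of each column of \<open>T\<close> lie in distinct rows of \<open>w\<close>,
  then in every column the weight is least exactly when these rows form an initial segment, as they do
  for \<open>t\<close>. This replaces the usual argument with the dominance order.\<close>

lemma csum_not_clash:
  assumes w: "w \<in> {1..n} \<rightarrow>\<^sub>E {..<l}" and le: "(\<Sum>x=1..n. w x) \<le> (\<Sum>x=1..n. t x)"
    and inj: "inj_on (\<lambda>x. (w x, tcol x)) {1..n}"
  shows "(\<Sum>x=1..n. w x) = (\<Sum>x=1..n. t x) \<and> (\<exists>p\<in>C. w = t \<circ> p)"
proof -
  define c where "c = (\<lambda>j. {x\<in>{1..n}. tcol x = j})"
  have cfin: "finite (c j)" for j unfolding c_def by simp
  have winj: "inj_on w (c j)" for j
  proof (rule inj_onI)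
    fix x y assume "x \<in> c j" "y \<in> c j" "w x = w y"
    then show "x = y" using inj_onD[OF inj, of x y] unfolding c_def by simp
  qed
  have tinj: "inj_on t (c j)" for j
  proof (rule inj_onI)
    fix x y assume "x \<in> c j" "y \<in> c j" "t x = t y"
    then show "x = y"
      using inj_onD[OF bij_betw_imp_inj_on[OF T_bij], of x y] t_eq[of x] t_eq[of y]
      unfolding c_def by (simp add: prod_eq_iff)
  qed
  \<comment> \<open>Row lengths weakly decrease, so the rows met by column j of the diagram form an
    initial segment.\<close>
  have timg: "t ` c j = {..<card (c j)}" for j
  proof -
    have img: "t ` c j = {i. j < \<mu> i}"
    proof
      show "t ` c j \<subseteq> {i. j < \<mu> i}"
        using T_in t_eq unfolding c_def diagram_def by (force simp: case_prod_beta)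
      show "{i. j < \<mu> i} \<subseteq> t ` c j"
      proof
        fix i assume "i \<in> {i. j < \<mu> i}"
        then have "(i, j) \<in> diagram \<mu>" by (simp add: diagram_def)
        then obtain x where x: "x \<in> {1..n}" "T x = (i, j)" using T_bij unfolding bij_betw_def by force
        then show "i \<in> t ` c j" using t_eq[OF x(1)] unfolding c_def by force
      qed
    qed
    have fin: "finite (t ` c j)" using cfin by simp
    have down: "i' \<in> t ` c j" if "i \<in> t ` c j" "i' \<le> i" for i i'
      using that anti unfolding img by (auto dest: antimonoD intro: less_le_trans)
    have "t ` c j = {..<card (t ` c j)}"
    proof (cases "t ` c j = {}")
      case False
      then have "t ` c j = {..Max (t ` c j)}" using down Max_in[OF fin] Max_ge[OF fin] by blast
      then show ?thesis by (metis card_atMost lessThan_Suc_atMost)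
    qed simp
    then show ?thesis using card_image[OF tinj] by simp
  qed
  have le_col: "\<Sum>(t ` c j) \<le> \<Sum>(w ` c j)" and eq_col: "\<Sum>(w ` c j) = \<Sum>(t ` c j) \<Longrightarrow> w ` c j = t ` c j" for j
    using sum_initial_segment_le[of "w ` c j"] cfin card_image[OF winj[of j]] unfolding timg by auto
  define J where "J = tcol ` {1..n}"
  have split: "(\<Sum>x=1..n. f x) = (\<Sum>j\<in>J. \<Sum>x\<in>c j. f x)" for f :: "nat \<Rightarrow> nat"
    unfolding c_def J_def by (rule sum.group[symmetric]) auto
  have sw: "(\<Sum>x=1..n. w x) = (\<Sum>j\<in>J. \<Sum>(w ` c j))"
    unfolding split[of w] using sum.reindex[OF winj, of id] by simp
  have st: "(\<Sum>x=1..n. t x) = (\<Sum>j\<in>J. \<Sum>(t ` c j))"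
    unfolding split[of t] using sum.reindex[OF tinj, of id] by simp
  have ge: "(\<Sum>x=1..n. t x) \<le> (\<Sum>x=1..n. w x)" unfolding sw st by (intro sum_mono le_col)
  have eq: "(\<Sum>x=1..n. w x) = (\<Sum>x=1..n. t x)" using le ge by simp
  have "\<Sum>(w ` c j) = \<Sum>(t ` c j)" if "j \<in> J" for j
  proof (rule ccontr)
    assume "\<Sum>(w ` c j) \<noteq> \<Sum>(t ` c j)"
    then have "\<Sum>(t ` c j) < \<Sum>(w ` c j)" using le_col[of j] by simp
    then have "(\<Sum>j\<in>J. \<Sum>(t ` c j)) < (\<Sum>j\<in>J. \<Sum>(w ` c j))"
      using that le_col by (intro sum_strict_mono_ex1) (auto simp: J_def)
    then show False using eq sw st by simp
  qed
  then have img: "w ` c j = t ` c j" if "j \<in> J" for j using eq_col that by blast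
  have ex: "\<exists>y\<in>{1..n}. tcol y = tcol x \<and> t y = w x" if x: "x \<in> {1..n}" for x
  proof -
    have "x \<in> c (tcol x)" "tcol x \<in> J" using x unfolding c_def J_def by auto
    then have "w x \<in> t ` c (tcol x)" using img by blast
    then show ?thesis unfolding c_def by auto
  qed
  \<comment> \<open>\<open>\<pi> x\<close> is the entry of the same column that \<open>T\<close>
    places in row \<open>w x\<close>. Since \<open>w\<close> is injective on each column, this
    defines a permutation in the column group.\<close>
  then obtain \<pi> where \<pi>: "\<And>x. x \<in> {1..n} \<Longrightarrow> \<pi> x \<in> {1..n} \<and> tcol (\<pi> x) = tcol x \<and> t (\<pi> x) = w x" by metis
  define p where "p = (\<lambda>x. if x \<in> {1..n} then \<pi> x else x)"
  have "inj_on p {1..n}"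
  proof (rule inj_onI)
    fix x y assume xy: "x \<in> {1..n}" "y \<in> {1..n}" "p x = p y"
    then have "(w x, tcol x) = (w y, tcol y)" using \<pi>[of x] \<pi>[of y] unfolding p_def by (metis (full_types))
    then show "x = y" using inj xy unfolding inj_on_def by blast
  qed
  moreover have "p ` {1..n} \<subseteq> {1..n}" using \<pi> unfolding p_def by auto
  ultimately have "bij_betw p {1..n} {1..n}"
    unfolding bij_betw_def using endo_inj_surj[of "{1..n}" p] by blast
  then have perm: "p permutes {1..n}" by (rule bij_imp_permutes) (auto simp: p_def)
  then have "p \<in> C" unfolding C_iff using \<pi> unfolding p_def by auto
  moreover have "w = t \<circ> p"
  proof
    fix x show "w x = (t \<circ> p) x"
      using \<pi>[of x] w unfolding p_def by (auto simp: tabloid_def PiE_def extensional_def)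
  qed
  ultimately show ?thesis using eq by blast
qed

lemma polytabloid_eq: "polytabloid n T w = csum (\<lambda>v. if v = t then 1 else 0) w"
  unfolding polytabloid_def csum_def perm_action_def cscale_def sum_fun_apply by simp

text \<open>Only the identity preserves both the rows and the columns of T, so a single term
  survives. The coefficient 1 shows that polytabloids are nonzero and normalises the scalar in
  \<open>csum_scalar\<close>.\<close>

lemma polytabloid_t: "polytabloid n T t = 1"
proof -
  have "of_int (sign q) * (if t \<circ> q = t then 1 else 0) = (if q = id then 1 else (0::complex))"
    if q: "q \<in> C" for q
  proof -
    have qp: "q permutes {1..n}" and qc: "\<And>x. x \<in> {1..n} \<Longrightarrow> tcol (q x) = tcol x"
      using q unfolding C_iff by auto
    have "q = id" if "t \<circ> q = t"
    proof
      fix x show "q x = id x"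
      proof (cases "x \<in> {1..n}")
        case True
        then have qx: "q x \<in> {1..n}" using permutes_in_image[OF qp] by blast
        have "fst (T (q x)) = fst (T x)"
          using fun_cong[OF that, of x] t_eq[OF True] t_eq[OF qx] by simp
        moreover have "snd (T (q x)) = snd (T x)" using qc[OF True] .
        ultimately show ?thesis
          using inj_onD[OF bij_betw_imp_inj_on[OF T_bij] _ qx True] by (simp add: prod_eq_iff)
      next
        case False
        then show ?thesis using permutes_not_in[OF qp] by simp
      qed
    qed
    then show ?thesis by auto
  qed
  then have "polytabloid n T t = (\<Sum>q\<in>C. if q = id then 1 else 0)"
    unfolding polytabloid_eq csum_def by simp
  moreover have "id \<in> C" unfolding C_iff by (simp add: permutes_id)
  ultimately show ?thesis using finite_C by simp
qed

text \<open>A tabloid with a clash gives zero on both sides. One without a clash is t composed with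
  some p of the column group, and both sides then pick up the sign of p. This is James's lemma that
  on the permutation module of shape \<mu> the column antisymmetriser has one-dimensional
  range.\<close>

lemma csum_scalar:
  assumes w: "w \<in> M"
  shows "csum f w = csum f t * polytabloid n T w"
proof (cases "inj_on (\<lambda>x. (w x, tcol x)) {1..n}")
  case False
  then obtain x y where "x \<in> {1..n}" "y \<in> {1..n}" "x \<noteq> y" "tcol x = tcol y" "w x = w y"
    unfolding inj_on_def by auto
  then have "csum f w = 0" for f by (rule csum_clash)
  then show ?thesis unfolding polytabloid_eq by simp
next
  case True
  have rows: "(\<Sum>x=1..n. u x) = (\<Sum>i<l. i * \<mu> i)" if "u \<in> M" for u
  proof -
    have "(\<Sum>x=1..n. u x) = (\<Sum>i<l. \<Sum>x\<in>{x\<in>{1..n}. u x = i}. u x)"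
      using that unfolding tabloids_def by (intro sum.group[symmetric]) auto
    also have "\<dots> = (\<Sum>i<l. i * \<mu> i)"
      using that unfolding tabloids_def by (intro sum.cong) (auto simp: mult.commute)
    finally show ?thesis .
  qed
  from csum_not_clash[OF _ _ True] rows[OF w] rows[OF t_tabloid] w
  obtain p where p: "p \<in> C" "w = t \<circ> p" unfolding tabloids_def by auto
  show ?thesis
    unfolding p(2) csum_translate[OF p(1)] polytabloid_eq
    by (simp add: polytabloid_t flip: polytabloid_eq)
qed

text \<open>The total row weight of w depends only on a. Without a clash in some column it would be
  at least the weight of t, against the assumption.\<close>

lemma csum_small:
  assumes w: "w \<in> tabloids n l a" and a: "(\<Sum>i<l. int i * a i) < (\<Sum>i<l. int i * int (\<mu> i))"
  shows "csum f w = 0"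
proof (rule ccontr)
  assume nz: "csum f w \<noteq> 0"
  have inj: "inj_on (\<lambda>x. (w x, tcol x)) {1..n}"
  proof (rule inj_onI, rule ccontr)
    fix x y assume "x \<in> {1..n}" "y \<in> {1..n}" "(w x, tcol x) = (w y, tcol y)" "x \<noteq> y"
    then show False using csum_clash[of x y w f] nz by simp
  qed
  have rows: "(\<Sum>x=1..n. int (u x)) = (\<Sum>i<l. int i * b i)" if "u \<in> tabloids n l b" for u b
  proof -
    have "(\<Sum>x=1..n. int (u x)) = (\<Sum>i<l. \<Sum>x\<in>{x\<in>{1..n}. u x = i}. int (u x))"
      using that unfolding tabloids_def by (intro sum.group[symmetric]) auto
    also have "\<dots> = (\<Sum>i<l. int i * b i)"
    proof (intro sum.cong refl)
      fix i assume "i \<in> {..<l}"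
      then have "int (card {x\<in>{1..n}. u x = i}) = b i" using that unfolding tabloids_def by auto
      then show "(\<Sum>x\<in>{x\<in>{1..n}. u x = i}. int (u x)) = int i * b i"
        by (auto simp: mult.commute)
    qed
    finally show ?thesis .
  qed
  have "int (\<Sum>x=1..n. w x) < int (\<Sum>x=1..n. t x)"
    using a rows[OF w] rows[OF t_tabloid] by simp
  then have lt: "(\<Sum>x=1..n. w x) < (\<Sum>x=1..n. t x)" by (simp only: of_nat_less_iff)
  with csum_not_clash[OF _ _ inj] w show False unfolding tabloids_def by auto
qed

lemma polytabloid_support: "w \<notin> M \<Longrightarrow> polytabloid n T w = 0"
proof -
  assume w: "w \<notin> M"
  have "w \<circ> q \<noteq> t" if "q \<in> C" for q
  proof
    assume "w \<circ> q = t"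
    then have "w = t \<circ> inv' q" using that comp_permutes_eq_iff unfolding C_iff by blast
    then show False using w tabloids_relabel[OF _ t_tabloid, of "inv' q"] C_inv[OF that] unfolding C_iff by simp
  qed
  then show ?thesis unfolding polytabloid_eq csum_def by (auto intro: sum.neutral)
qed

text \<open>An intertwiner commutes with the column antisymmetriser, so the image of the polytabloid
  is determined by the single column of F at t.\<close>

lemma kapply_polytabloid:
  assumes F: "equivariant (sym_group n) relabel relabel F"
  shows "kapply M F (polytabloid n T) w = csum (\<lambda>v. F v t) w"
proof -
  have "kapply M F (polytabloid n T) w
      = (\<Sum>x\<in>M. \<Sum>q\<in>C. F w x * (of_int (sign q) * (if x \<circ> q = t then 1 else 0)))"
    unfolding kapply_def polytabloid_eq csum_def by (simp add: sum_distrib_left)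
  also have "\<dots> = (\<Sum>q\<in>C. \<Sum>x\<in>M. if x = t \<circ> inv' q then of_int (sign q) * F w x else 0)"
  proof (subst sum.swap, intro sum.cong refl)
    fix q x assume "q \<in> C" and "x \<in> M"
    then have q: "q permutes {1..n}" unfolding C_iff by blast
    have "x \<circ> q = t \<longleftrightarrow> x = t \<circ> inv' q"
      by (rule comp_permutes_eq_iff[OF q])
    then show "F w x * (of_int (sign q) * (if x \<circ> q = t then 1 else 0))
        = (if x = t \<circ> inv' q then of_int (sign q) * F w x else 0)" by simp
  qed
  also have "\<dots> = (\<Sum>q\<in>C. of_int (sign q) * F (w \<circ> q) t)"
  proof (intro sum.cong refl)
    fix q assume qC: "q \<in> C"
    then have q: "q permutes {1..n}" unfolding C_iff by blast
    have "t \<circ> inv' q \<in> M" using tabloids_relabel[OF permutes_inv[OF q] t_tabloid] .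
    moreover have "F (w \<circ> q) t = F w (t \<circ> inv' q)"
      using equivariantD[OF F, of q w "t \<circ> inv' q"] q permutes_inv_o[OF q]
      by (simp add: carrier_sym_group comp_assoc)
    ultimately show "(\<Sum>x\<in>M. if x = t \<circ> inv' q then of_int (sign q) * F w x else 0)
        = of_int (sign q) * F (w \<circ> q) t"
      by (simp add: finite_tabloids)
  qed
  finally show ?thesis unfolding csum_def .
qed

end

section \<open>The Specht module and the intertwiners that start from it\<close>

context partition_shape
begin

text \<open>Relabelling conjugates the column group by g and keeps all signs. Agreement of T' with T
  after g is required on the entries only, because a tableau is unconstrained elsewhere; so any
  tableau can be reached from a fixed one.\<close>

lemma polytabloid_conj:
  assumes T: "is_tableau \<mu> T" and g: "g permutes {1..n}" and T': "\<And>x. x \<in> {1..n} \<Longrightarrow> T' x = T (g x)"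
  shows "polytabloid n T' = pull relabel (inv' g) (polytabloid n T)" and "is_tableau \<mu> T'"
proof -
  have gi: "inv' g permutes {1..n}" using permutes_inv[OF g] .
  have in_g: "x \<in> {1..n} \<Longrightarrow> g x \<in> {1..n}" "x \<in> {1..n} \<Longrightarrow> inv' g x \<in> {1..n}" for x
    using permutes_in_image[OF g] permutes_in_image[OF gi] by auto
  have ggi: "g (inv' g x) = x" "inv' g (g x) = x" for x using permutes_inverses[OF g] by auto
  have "bij_betw (T \<circ> g) {1..n} (diagram \<mu>)"
    using T permutes_imp_bij[OF g] unfolding is_tableau_def psize by (rule bij_betw_trans[rotated])
  then have "bij_betw T' {1..n} (diagram \<mu>)"
    by (rule bij_betw_cong[THEN iffD1, rotated]) (simp add: T')
  then show T't: "is_tableau \<mu> T'" unfolding is_tableau_def psize .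
  interpret A: tableau \<mu> l n T by unfold_locales (rule T)
  interpret B: tableau \<mu> l n T' by unfold_locales (rule T't)
  have t': "B.t = A.t \<circ> g"
  proof
    fix x show "B.t x = (A.t \<circ> g) x"
      using T' in_g permutes_not_in[OF g, of x] by (cases "x \<in> {1..n}") (auto simp: tabloid_def)
  qed
  have bij: "bij_betw (\<lambda>q. inv' g \<circ> q \<circ> g) A.C B.C"
  proof (rule bij_betwI[where g = "\<lambda>q. g \<circ> q \<circ> inv' g"])
    show "(\<lambda>q. inv' g \<circ> q \<circ> g) \<in> A.C \<rightarrow> B.C"
    proof
      fix q assume q: "q \<in> A.C"
      then have qp: "q permutes {1..n}" unfolding A.C_iff by blast
      have "snd (T' (inv' g (q (g x)))) = snd (T' x)" if x: "x \<in> {1..n}" for x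
      proof -
        have "q (g x) \<in> {1..n}" using permutes_in_image[OF qp] in_g(1)[OF x] by blast
        then have "T' (inv' g (q (g x))) = T (q (g x))" using T'[OF in_g(2)] ggi by simp
        also have "snd \<dots> = snd (T (g x))" using q in_g(1)[OF x] unfolding A.C_iff by blast
        finally show ?thesis using T'[OF x] by simp
      qed
      then show "inv' g \<circ> q \<circ> g \<in> B.C"
        unfolding B.C_iff using permutes_compose[OF g permutes_compose[OF qp gi]] by (simp add: comp_assoc)
    qed
    show "(\<lambda>q. g \<circ> q \<circ> inv' g) \<in> B.C \<rightarrow> A.C"
    proof
      fix q assume q: "q \<in> B.C"
      then have qp: "q permutes {1..n}" unfolding B.C_iff by blast
      have "snd (T (g (q (inv' g x)))) = snd (T x)" if x: "x \<in> {1..n}" for x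
      proof -
        have "q (inv' g x) \<in> {1..n}" using permutes_in_image[OF qp] in_g(2)[OF x] by blast
        then have "T (g (q (inv' g x))) = T' (q (inv' g x))" using T' by simp
        also have "snd \<dots> = snd (T' (inv' g x))" using q in_g(2)[OF x] unfolding B.C_iff by blast
        finally show ?thesis using T'[OF in_g(2)[OF x]] ggi by simp
      qed
      then show "g \<circ> q \<circ> inv' g \<in> A.C"
        unfolding A.C_iff using permutes_compose[OF gi permutes_compose[OF qp g]] by (simp add: comp_assoc)
    qed
    show "g \<circ> (inv' g \<circ> q \<circ> g) \<circ> inv' g = q" "inv' g \<circ> (g \<circ> q \<circ> inv' g) \<circ> g = q" for q
      by (auto simp: ggi)
  qed
  show "polytabloid n T' = pull relabel (inv' g) (polytabloid n T)"
  proof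
    fix w
    have perm: "permutation g" "permutation (inv' g)"
      using permutes_imp_permutation[OF _ g] permutes_imp_permutation[OF _ gi] by auto
    have "polytabloid n T' w
        = (\<Sum>q\<in>A.C. of_int (sign (inv' g \<circ> q \<circ> g)) * (if w \<circ> (inv' g \<circ> q \<circ> g) = B.t then 1 else 0))"
      unfolding B.polytabloid_eq B.csum_def by (rule sum.reindex_bij_betw[OF bij, symmetric])
    also have "\<dots> = (\<Sum>q\<in>A.C. of_int (sign q) * (if w \<circ> inv' g \<circ> q = A.t then 1 else 0))"
    proof (intro sum.cong refl)
      fix q assume "q \<in> A.C"
      then have q: "permutation q" by (rule A.C_permutation)
      have "sign (inv' g \<circ> q \<circ> g) = sign q"
      proof -
        have "sign (inv' g \<circ> q \<circ> g) = sign g * sign q * sign g"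
          using q perm sign_inverse[OF perm(1)] by (simp add: sign_compose permutation_compose)
        then show ?thesis by (cases "evenperm g") (simp_all add: sign_def)
      qed
      moreover have "w \<circ> (inv' g \<circ> q \<circ> g) = B.t \<longleftrightarrow> w \<circ> inv' g \<circ> q = A.t"
      proof -
        have "(w \<circ> inv' g \<circ> q) \<circ> g = A.t \<circ> g \<longleftrightarrow> w \<circ> inv' g \<circ> q = A.t"
          unfolding comp_permutes_eq_iff[OF g]
          using comp_permutes_eq_iff[OF g, of A.t "A.t \<circ> g"] by simp
        then show ?thesis unfolding t' by (simp add: comp_assoc)
      qed
      ultimately show "of_int (sign (inv' g \<circ> q \<circ> g)) * (if w \<circ> (inv' g \<circ> q \<circ> g) = B.t then 1 else 0)
          = (of_int (sign q) * (if w \<circ> inv' g \<circ> q = A.t then 1 else 0) :: complex)" by simp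
    qed
    finally show "polytabloid n T' w = pull relabel (inv' g) (polytabloid n T) w"
      unfolding A.polytabloid_eq A.csum_def pull_def .
  qed
qed

lemma specht_eq: "specht \<mu> = cfun.span {polytabloid n T |T. is_tableau \<mu> T}"
  unfolding specht_def psize ..

lemma specht_submodule: "M.submodule (specht \<mu>)"
proof (rule M.submoduleI)
  show "cfun.subspace (specht \<mu>)" unfolding specht_eq by (rule cfun.subspace_span)
next
  fix v w assume "v \<in> specht \<mu>" and w: "w \<notin> M"
  then show "v w = 0" unfolding specht_eq
  proof (induction v rule: cfun.span_induct)
    case base
    show ?case unfolding cfun.subspace_def by (auto simp: cscale_def)
  next
    case (step v)
    then obtain T where T: "is_tableau \<mu> T" "v = polytabloid n T" by blast
    interpret tableau \<mu> l n T by unfold_locales (rule T)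
    show ?case using polytabloid_support[OF w] T by simp
  qed
next
  fix g v assume "v \<in> specht \<mu>" and g: "g \<in> carrier (sym_group n)"
  then show "pull relabel g v \<in> specht \<mu>" unfolding specht_eq
  proof (induction v rule: cfun.span_induct)
    case base
    show ?case unfolding cfun.subspace_def
      by (auto simp: pull_linear cfun.span_zero cfun.span_add cfun.span_scale)
  next
    case (step v)
    then obtain T where T: "is_tableau \<mu> T" "v = polytabloid n T" by blast
    have gp: "g permutes {1..n}" using g by (simp add: carrier_sym_group)
    have "inv' (inv' g) = g" using inv_inv_eq[OF permutes_bij[OF gp]] .
    then have "pull relabel g v = polytabloid n (T \<circ> inv' g)"
      using polytabloid_conj(1)[OF T(1) permutes_inv[OF gp], of "T \<circ> inv' g"] T(2) by simp
    moreover have "is_tableau \<mu> (T \<circ> inv' g)"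
      using polytabloid_conj(2)[OF T(1) permutes_inv[OF gp], of "T \<circ> inv' g"] by simp
    ultimately show ?case by (intro impI cfun.span_base) blast
  qed
qed

lemma specht_nonzero: "specht \<mu> \<noteq> {0}"
proof -
  obtain T where T: "is_tableau \<mu> T" using tableau_exists by blast
  interpret tableau \<mu> l n T by unfold_locales (rule T)
  have "polytabloid n T \<in> specht \<mu>" unfolding specht_eq using T by (auto intro: cfun.span_base)
  moreover have "polytabloid n T \<noteq> 0" using polytabloid_t by (metis zero_fun_apply zero_neq_one)
  ultimately show ?thesis by blast
qed

text \<open>For one tableau this is \<open>csum_scalar\<close>, since F maps a polytabloid to an
  antisymmetrised function. Every other tableau is a relabelling of the first, and F commutes with
  relabelling, so the scalar is the same.\<close>

lemma specht_schur_scalar: "M.schur_scalar (specht \<mu>)"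
  unfolding M.schur_scalar_def
proof (intro allI impI)
  fix F assume F: "equivariant (sym_group n) relabel relabel F" and supp: "\<forall>y x. y \<notin> M \<longrightarrow> F y x = 0"
  obtain T0 where T0: "is_tableau \<mu> T0" using tableau_exists by blast
  interpret T0: tableau \<mu> l n T0 by unfold_locales (rule T0)
  interpret perm_rep_pair "sym_group n" M relabel M relabel ..
  define c where "c = T0.csum (\<lambda>v. F v T0.t) T0.t"
  have base0: "kapply M F (polytabloid n T0) = cscale c (polytabloid n T0)"
  proof
    fix w show "kapply M F (polytabloid n T0) w = cscale c (polytabloid n T0) w"
    proof (cases "w \<in> M")
      case True
      then show ?thesis unfolding T0.kapply_polytabloid[OF F] c_def cscale_def by (rule T0.csum_scalar)
    next
      case False
      then show ?thesis using supp T0.polytabloid_support[OF False] unfolding kapply_def cscale_def by simp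
    qed
  qed
  have "kapply M F u = cscale c u" if "u \<in> specht \<mu>" for u
    using that unfolding specht_eq
  proof (induction u rule: cfun.span_induct)
    case base
    show ?case unfolding cfun.subspace_def
      by (auto simp: kapply_linear cfun.scale_right_distrib cfun.scale_left_commute cfun.scale_zero_right)
  next
    case (step u)
    then obtain T where T: "is_tableau \<mu> T" "u = polytabloid n T" by blast
    interpret tableau \<mu> l n T by unfold_locales (rule T)
    define g where "g = (\<lambda>x. if x \<in> {1..n} then inv_into {1..n} T0 (T x) else x)"
    have "bij_betw (inv_into {1..n} T0 \<circ> T) {1..n} {1..n}"
      by (rule bij_betw_trans[OF T_bij bij_betw_inv_into[OF T0.T_bij]])
    then have "bij_betw g {1..n} {1..n}"
      by (rule bij_betw_cong[THEN iffD1, rotated]) (simp add: g_def)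
    then have g: "g permutes {1..n}" by (rule bij_imp_permutes) (auto simp: g_def)
    have "T x = T0 (g x)" if "x \<in> {1..n}" for x
      using bij_betw_inv_into_right[OF T0.T_bij T_in[OF that]] that by (simp add: g_def)
    then have u: "u = pull relabel (inv' g) (polytabloid n T0)"
      using polytabloid_conj(1)[OF T0 g] T(2) by simp
    show ?case
      unfolding u using kapply_pull[OF F] permutes_inv[OF g] base0 by (simp add: carrier_sym_group pull_linear)
  qed
  then show "\<exists>c. \<forall>u\<in>specht \<mu>. kapply M F u = cscale c u" by blast
qed

lemma kapply_specht_small:
  assumes F: "equivariant (sym_group n) relabel relabel F" and y: "y \<in> tabloids n l a"
    and a: "(\<Sum>i<l. int i * a i) < (\<Sum>i<l. int i * int (\<mu> i))" and u: "u \<in> specht \<mu>"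
  shows "kapply M F u y = 0"
  using u unfolding specht_eq
proof (induction u rule: cfun.span_induct)
  case base
  show ?case unfolding cfun.subspace_def by (auto simp: kapply_linear) (simp add: cscale_def)
next
  case (step u)
  then obtain T where T: "is_tableau \<mu> T" "u = polytabloid n T" by blast
  interpret tableau \<mu> l n T by unfold_locales (rule T)
  show ?case using csum_small[OF y a] kapply_polytabloid[OF F] T by simp
qed

end

section \<open>The determinantal formula for Specht characters\<close>

definition full_space :: "'x set \<Rightarrow> ('x \<Rightarrow> complex) set" where
  "full_space X = {v. \<forall>x. x \<notin> X \<longrightarrow> v x = 0}"

definition delta_kernel :: "'x set \<Rightarrow> 'x \<Rightarrow> 'x \<Rightarrow> complex" where
  "delta_kernel X y x = (if y = x \<and> x \<in> X then 1 else 0)"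

lemma delta_kernel: "finite X \<Longrightarrow> is_kernel X (full_space X) (delta_kernel X)"
  unfolding is_kernel_def full_space_def delta_kernel_def
  by (auto simp: if_distrib[of "\<lambda>c. c * _"] cong: if_cong)

context perm_rep
begin

lemma full_space_submodule: "submodule (full_space X)"
proof (rule submoduleI)
  show "cfun.subspace (full_space X)"
    unfolding full_space_def cfun.subspace_def by (auto simp: cscale_def)
  show "v x = 0" if "v \<in> full_space X" "x \<notin> X" for v x
    using that unfolding full_space_def by simp
next
  fix g v assume g: "g \<in> carrier G" and v: "v \<in> full_space X"
  have "r g x \<notin> X" if "x \<notin> X" for x
    using act_closed[OF group.inv_closed[OF group_G g], of "r g x"] act_inv(2)[OF g, of x] that by auto
  then show "pull r g v \<in> full_space X" using v unfolding full_space_def pull_def by simp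
qed

lemma rep_char_delta: "rep_char X r (delta_kernel X) g = of_nat (card {x\<in>X. r g x = x})"
proof -
  have "rep_char X r (delta_kernel X) g = (\<Sum>x\<in>X. if r g x = x then 1 else 0)"
    unfolding rep_char_def delta_kernel_def by (intro sum.cong) auto
  also have "\<dots> = of_nat (card {x\<in>X. r g x = x})"
    using finite_X by (simp add: sum.If_cases Int_def)
  finally show ?thesis .
qed

text \<open>A subspace on which every equivariant operator acts as a scalar occurs only once in the
  whole function space, so the orthogonal complement does not contribute.\<close>

lemma schur_scalar_full_char:
  assumes U: "submodule U" "U \<noteq> {0}" "schur_scalar U" and p: "is_kernel X U p"
  shows "(\<Sum>g\<in>carrier G. rep_char X r (delta_kernel X) g * cnj (rep_char X r p g)) = of_nat (card (carrier G))"
proof -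
  interpret perm_rep_pair G X r X r ..
  define W where "W = {v\<in>full_space X. \<forall>u\<in>U. fip X v u = 0}"
  have W: "submodule W" unfolding W_def by (rule orth_complement_submodule[OF full_space_submodule U(1)])
  define q where "q = (\<lambda>y x. delta_kernel X y x - p y x)"
  have psupp: "p y x = 0" if "y \<notin> X \<or> x \<notin> X" for y x
    using kernel_support[OF conjunct1[OF U(1)] p that] .
  have \<delta>: "(\<Sum>x\<in>X. delta_kernel X y x * c x) = (if y \<in> X then c y else 0)" for y and c :: "'x \<Rightarrow> complex"
    unfolding delta_kernel_def using finite_X by (simp add: if_distrib[of "\<lambda>c. c * _"] cong: if_cong)
  have q: "is_kernel X W q"
    unfolding is_kernel_def
  proof (intro conjI allI ballI)
    fix x
    have "(\<lambda>y. q y x) \<in> full_space X"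
      unfolding q_def full_space_def delta_kernel_def using psupp by auto
    moreover have "fip X (\<lambda>y. q y x) u = 0" if u: "u \<in> U" for u
    proof -
      have "fip X (\<lambda>y. q y x) u = cnj (\<Sum>y\<in>X. delta_kernel X x y * u y) - (\<Sum>y\<in>X. cnj (u y) * p y x)"
        unfolding fip_def q_def delta_kernel_def cnj_sum
        by (simp only: sum_subtractf[symmetric]) (intro sum.cong refl, auto simp: algebra_simps)
      also have "\<dots> = 0"
        unfolding \<delta> kernel_reproduces_row[OF p u] using submoduleD(2)[OF U(1) u] by auto
      finally show ?thesis .
    qed
    ultimately show "(\<lambda>y. q y x) \<in> W" unfolding W_def by simp
  next
    fix v y assume v: "v \<in> W"
    have "(\<Sum>x\<in>X. p y x * v x) = cnj (\<Sum>x\<in>X. p x y * cnj (v x))"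
      unfolding cnj_sum by (intro sum.cong refl) (simp flip: kernel_hermitian[OF p])
    also have "(\<Sum>x\<in>X. p x y * cnj (v x)) = fip X (\<lambda>x. p x y) v" unfolding fip_def ..
    also have "\<dots> = cnj (fip X v (\<lambda>x. p x y))" by (rule fip_cnj)
    also have "fip X v (\<lambda>x. p x y) = 0" using v kernel_column[OF p] unfolding W_def by blast
    finally have "(\<Sum>x\<in>X. p y x * v x) = 0" by simp
    then show "(\<Sum>x\<in>X. q y x * v x) = v y"
      unfolding q_def using v \<delta>[of y v] unfolding W_def full_space_def
      by (auto simp: left_diff_distrib sum_subtractf)
  next
    fix x y show "q x y = cnj (q y x)"
      unfolding q_def delta_kernel_def using kernel_hermitian[OF p, of x y] by auto
  qed
  have "(\<Sum>g\<in>carrier G. rep_char X r q g * cnj (rep_char X r p g)) = 0"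
  proof (rule char_orthogonal[OF U(1) p W q])
    fix F
    assume F: "equivariant G r r F" and qF': "\<forall>y x. (\<Sum>z\<in>X. q y z * F z x) = F y x"
      and Fp': "\<forall>y x. (\<Sum>z\<in>X. F y z * p z x) = F y x"
    note qF = qF'[rule_format] and Fp = Fp'[rule_format]
    have supp: "F y x = 0" if "y \<notin> X" for y x
      unfolding qF[of y x, symmetric] q_def delta_kernel_def using that psupp by (intro sum.neutral) auto
    then obtain c where c: "\<And>u. u \<in> U \<Longrightarrow> kapply X F u = cscale c u"
      using U(3) F unfolding schur_scalar_def by blast
    \<comment> \<open>F equals F p and acts on U as c, so F = c p. Its range lies in U, which q
      annihilates.\<close>
    have Fc: "F y x = c * p y x" for y x
      using fun_cong[OF c[OF kernel_column[OF p, of x]], of y] Fp[of y x]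
      unfolding kapply_def cscale_def by simp
    have "F y x = 0" for y x
    proof -
    have "(\<Sum>z\<in>X. q y z * F z x) = F y x - (\<Sum>z\<in>X. p y z * F z x)"
      unfolding q_def using \<delta>[of y "\<lambda>z. F z x"] supp[of y x] by (simp add: left_diff_distrib sum_subtractf)
    also have "(\<Sum>z\<in>X. p y z * F z x) = c * (\<Sum>z\<in>X. p y z * p z x)"
      unfolding Fc by (simp add: sum_distrib_left mult_ac)
    also have "\<dots> = F y x" unfolding kernel_idem[OF p] Fc ..
    finally show ?thesis unfolding qF by simp
    qed
    then show "\<forall>y x. F y x = 0" by blast
  qed
  moreover have "rep_char X r q g = rep_char X r (delta_kernel X) g - rep_char X r p g" for g
    unfolding rep_char_def q_def by (simp add: sum_subtractf)
  ultimately show ?thesis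
    using schur_scalar_norm[OF U p] by (simp add: left_diff_distrib sum_subtractf)
qed

end

section \<open>Alternating sums of permutation characters\<close>

definition perm_char :: "nat \<Rightarrow> nat \<Rightarrow> (nat \<Rightarrow> int) \<Rightarrow> (nat \<Rightarrow> nat) \<Rightarrow> nat" where
  "perm_char n l a g = card {w\<in>tabloids n l a. w \<circ> g = w}"

definition shifted :: "(nat \<Rightarrow> nat) \<Rightarrow> (nat \<Rightarrow> nat) \<Rightarrow> nat \<Rightarrow> int" where
  "shifted \<mu> \<sigma> i = int (\<mu> i) + int (\<sigma> i) - int i"

text \<open>The Jacobi-Trudi determinant with the complete symmetric function of degree m read as
  the trivial module of the symmetric group on m letters and products read as induction; each term
  of the expansion is a permutation character.\<close>

definition jt_char :: "nat \<Rightarrow> nat \<Rightarrow> (nat \<Rightarrow> nat) \<Rightarrow> (nat \<Rightarrow> nat) \<Rightarrow> int" where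
  "jt_char n l \<mu> g = (\<Sum>\<sigma> | \<sigma> permutes {..<l}. sign \<sigma> * int (perm_char n l (shifted \<mu> \<sigma>) g))"

text \<open>The sum of all (i - \<sigma> i)^2 is positive, which amounts to the rearrangement
  inequality. The weight, where row i counts i times its length, plays the part of the dominance
  order.\<close>

lemma weight_shifted:
  assumes \<sigma>: "\<sigma> permutes {..<l}" "\<sigma> \<noteq> id"
  shows "(\<Sum>i<l. int i * shifted \<mu> \<sigma> i) < (\<Sum>i<l. int i * int (\<mu> i))"
proof -
  have sq: "(\<Sum>i<l. int (\<sigma> i) * int (\<sigma> i)) = (\<Sum>i<l. int i * int i)"
    using sum.permute[OF \<sigma>(1), of "\<lambda>i. int i * int i"] by (simp add: comp_def)
  from \<sigma> obtain j where j: "\<sigma> j \<noteq> j" by (auto simp: fun_eq_iff)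
  then have "j \<in> {..<l}" using permutes_not_in[OF \<sigma>(1)] by blast
  then have "0 < (\<Sum>i<l. (int i - int (\<sigma> i))\<^sup>2)"
    using j by (intro sum_pos2[of _ j]) auto
  also have "\<dots> = 2 * ((\<Sum>i<l. int i * int i) - (\<Sum>i<l. int i * int (\<sigma> i)))"
    by (simp add: power2_eq_square algebra_simps sum.distrib sum_subtractf sq sum_distrib_left)
  finally have "(\<Sum>i<l. int i * int (\<sigma> i)) < (\<Sum>i<l. int i * int i)" by simp
  then show ?thesis unfolding shifted_def by (simp add: algebra_simps sum.distrib sum_subtractf)
qed

lemma card_carrier_sym_group: "card (carrier (sym_group n)) = fact n"
  by (simp add: carrier_sym_group card_permutations)

context partition_shape
begin

text \<open>For lower weight the column antisymmetriser kills all functions on tabloids of shape a,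
  so there is no nonzero intertwiner from the Specht module to that permutation module.\<close>

lemma perm_char_specht_orthogonal:
  assumes p: "is_kernel M (specht \<mu>) p" and a: "(\<Sum>i<l. int i * a i) < (\<Sum>i<l. int i * int (\<mu> i))"
  shows "(\<Sum>g\<in>carrier (sym_group n). of_nat (perm_char n l a g) * cnj (rep_char M relabel p g)) = 0"
proof -
  interpret Y: perm_rep "sym_group n" "tabloids n l a" relabel by (rule perm_rep_tabloids)
  interpret perm_rep_pair "sym_group n" M relabel "tabloids n l a" relabel ..
  let ?Y = "tabloids n l a"
  have "(\<Sum>g\<in>carrier (sym_group n). rep_char ?Y relabel (delta_kernel ?Y) g
      * cnj (rep_char M relabel p g)) = 0"
  proof (rule char_orthogonal[OF specht_submodule p Y.full_space_submodule delta_kernel[OF finite_tabloids]])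
    fix F
    assume F: "equivariant (sym_group n) relabel relabel F"
      and qF: "\<forall>y x. (\<Sum>z\<in>?Y. delta_kernel ?Y y z * F z x) = F y x"
      and Fp: "\<forall>y x. (\<Sum>z\<in>M. F y z * p z x) = F y x"
    show "\<forall>y x. F y x = 0"
    proof (intro allI)
      fix y x
      show "F y x = 0"
      proof (cases "y \<in> ?Y")
        case True
        from kapply_specht_small[OF F True a kernel_column[OF p, of x]] show ?thesis
          unfolding kapply_def using Fp by simp
      next
        case False
        have "F y x = (\<Sum>z\<in>?Y. delta_kernel ?Y y z * F z x)" using qF by simp
        also have "\<dots> = 0"
          unfolding delta_kernel_def by (rule sum.neutral) (use False in auto)
        finally show ?thesis .
      qed
    qed
  qed
  then show ?thesis unfolding Y.rep_char_delta perm_char_def .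
qed

text \<open>Both characters have norm \<open>1\<close> and so has their inner product, hence their difference has norm \<open>0\<close>.
  Only the identity contributes to the inner product, since every other shift lowers the weight.\<close>

lemma specht_char:
  assumes norm: "(\<Sum>g\<in>carrier (sym_group n). (jt_char n l \<mu> g)\<^sup>2) = fact n"
    and p: "is_kernel M (specht \<mu>) p" and g: "g \<in> carrier (sym_group n)"
  shows "rep_char M relabel p g = of_int (jt_char n l \<mu> g)"
proof -
  let ?G = "carrier (sym_group n)"
  define \<chi> where "\<chi> = rep_char M relabel p"
  define \<psi> where "\<psi> = jt_char n l \<mu>"
  have \<chi>\<chi>: "(\<Sum>g\<in>?G. \<chi> g * cnj (\<chi> g)) = fact n"
    using M.schur_scalar_norm[OF specht_submodule specht_nonzero specht_schur_scalar p]
    unfolding \<chi>_def card_carrier_sym_group by simp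
  have "(\<Sum>g\<in>?G. of_int (\<psi> g) * cnj (\<chi> g))
      = (\<Sum>\<sigma> | \<sigma> permutes {..<l}. of_int (sign \<sigma>) *
          (\<Sum>g\<in>?G. of_nat (perm_char n l (shifted \<mu> \<sigma>) g) * cnj (\<chi> g)))"
    unfolding \<psi>_def jt_char_def
    by (simp add: sum_distrib_left sum_distrib_right mult_ac, rule sum.swap)
  also have "\<dots> = (\<Sum>\<sigma> | \<sigma> permutes {..<l}. if \<sigma> = id then fact n else 0)"
  proof (intro sum.cong refl)
    fix \<sigma> assume "\<sigma> \<in> {\<sigma>. \<sigma> permutes {..<l}}"
    then have \<sigma>: "\<sigma> permutes {..<l}" by simp
    show "of_int (sign \<sigma>) * (\<Sum>g\<in>?G. of_nat (perm_char n l (shifted \<mu> \<sigma>) g) * cnj (\<chi> g))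
        = (if \<sigma> = id then fact n else 0)"
    proof (cases "\<sigma> = id")
      case True
      have "shifted \<mu> id = (\<lambda>i. int (\<mu> i))" by (simp add: shifted_def fun_eq_iff)
      then have "(\<Sum>g\<in>?G. of_nat (perm_char n l (shifted \<mu> id) g) * cnj (\<chi> g)) = fact n"
        using M.schur_scalar_full_char[OF specht_submodule specht_nonzero specht_schur_scalar p]
        unfolding \<chi>_def card_carrier_sym_group M.rep_char_delta perm_char_def by simp
      then show ?thesis using True by (simp add: sign_id)
    next
      case False
      then show ?thesis
        using perm_char_specht_orthogonal[OF p weight_shifted[OF \<sigma> False]] unfolding \<chi>_def by simp
    qed
  qed
  also have "\<dots> = fact n"
    by (subst sum.delta) (auto simp: finite_permutations permutes_id)
  finally have \<psi>\<chi>: "(\<Sum>g\<in>?G. of_int (\<psi> g) * cnj (\<chi> g)) = fact n" .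
  from arg_cong[OF this, of cnj] have \<chi>\<psi>: "(\<Sum>g\<in>?G. of_int (\<psi> g) * \<chi> g) = fact n" by simp
  have \<psi>\<psi>: "(\<Sum>g\<in>?G. of_int (\<psi> g) * of_int (\<psi> g)) = (fact n :: complex)"
    using arg_cong[OF norm, of "of_int :: int \<Rightarrow> complex"] unfolding \<psi>_def by (simp add: power2_eq_square)
  have "(of_real (\<Sum>g\<in>?G. (cmod (of_int (\<psi> g) - \<chi> g))\<^sup>2) :: complex)
      = (\<Sum>g\<in>?G. (of_int (\<psi> g) - \<chi> g) * cnj (of_int (\<psi> g) - \<chi> g))"
    by (simp add: complex_norm_square del: of_real_power complex_cnj_diff)
  also have "\<dots> = (\<Sum>g\<in>?G. of_int (\<psi> g) * of_int (\<psi> g)) - (\<Sum>g\<in>?G. of_int (\<psi> g) * cnj (\<chi> g))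
      - (\<Sum>g\<in>?G. of_int (\<psi> g) * \<chi> g) + (\<Sum>g\<in>?G. \<chi> g * cnj (\<chi> g))"
    by (simp add: algebra_simps sum.distrib sum_subtractf)
  also have "\<dots> = 0" unfolding \<psi>\<psi> \<psi>\<chi> \<chi>\<psi> \<chi>\<chi> by simp
  finally have "(\<Sum>g\<in>?G. (cmod (of_int (\<psi> g) - \<chi> g))\<^sup>2) = 0" by (simp only: of_real_eq_0_iff)
  then have "(cmod (of_int (\<psi> g) - \<chi> g))\<^sup>2 = 0"
    using g finite_carrier_sym_group by (simp add: sum_nonneg_eq_0_iff)
  then show ?thesis unfolding \<chi>_def \<psi>_def by simp
qed

end

section \<open>Counting orbits by content\<close>

definition content_mset :: "nat \<Rightarrow> (nat \<Rightarrow> 'k) \<Rightarrow> 'k multiset" where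
  "content_mset n f = image_mset f (mset_set {1..n})"

text \<open>The selection Q sees only the content and is thus constant on orbits of the symmetric
  group; products of such counts are again of this form.\<close>

definition fixed_count :: "nat \<Rightarrow> 'k set \<Rightarrow> ('k multiset \<Rightarrow> bool) \<Rightarrow> (nat \<Rightarrow> nat) \<Rightarrow> nat" where
  "fixed_count n K Q g = card {f \<in> {1..n} \<rightarrow>\<^sub>E K. Q (content_mset n f) \<and> f \<circ> g = f}"

definition msets_over :: "'k set \<Rightarrow> nat \<Rightarrow> 'k multiset set" where
  "msets_over K n = {M. set_mset M \<subseteq> K \<and> size M = n}"

lemma finite_msets_over: "finite K \<Longrightarrow> finite (msets_over K n)"
proof -
  assume K: "finite K"
  have "msets_over K n \<subseteq> mset ` {xs. set xs \<subseteq> K \<and> length xs = n}"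
  proof
    fix M assume M: "M \<in> msets_over K n"
    obtain xs where xs: "mset xs = M" using ex_mset by blast
    then have "set xs \<subseteq> K \<and> length xs = n" using M unfolding msets_over_def by auto
    then show "M \<in> mset ` {xs. set xs \<subseteq> K \<and> length xs = n}" using xs by blast
  qed
  then show ?thesis by (rule finite_subset) (intro finite_imageI finite_lists_length_eq[OF K])
qed

lemma content_comp_permutes: "g permutes {1..n} \<Longrightarrow> content_mset n (f \<circ> g) = content_mset n f"
  unfolding content_mset_def by (simp add: permutes_image_mset flip: multiset.map_comp)

lemma comp_permutes_PiE:
  assumes g: "g permutes {1..n}" and f: "f \<in> {1..n} \<rightarrow>\<^sub>E K"
  shows "f \<circ> g \<in> {1..n} \<rightarrow>\<^sub>E K"
proof (rule PiE_I)
  fix x assume "x \<in> {1..n}"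
  then show "(f \<circ> g) x \<in> K" using f permutes_in_image[OF g, of x] by auto
next
  fix x assume "x \<notin> {1..n}"
  then show "(f \<circ> g) x = undefined" using f permutes_not_in[OF g, of x] by auto
qed

lemma content_eq_imp_comp:
  assumes f: "f \<in> {1..n} \<rightarrow>\<^sub>E K" and f': "f' \<in> {1..n} \<rightarrow>\<^sub>E K" and eq: "content_mset n f = content_mset n f'"
  shows "\<exists>g. g permutes {1..n} \<and> f = f' \<circ> g"
proof -
  obtain g where g: "g permutes {1..n}" "\<forall>x\<in>{1..n}. f x = f' (g x)"
    using image_mset_eq_implies_permutes[of "{1..n}" f f'] eq unfolding content_mset_def by auto
  have "f = f' \<circ> g"
  proof
    fix x show "f x = (f' \<circ> g) x"
    proof (cases "x \<in> {1..n}")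
      case True
      then show ?thesis using g(2) by simp
    next
      case False
      then show ?thesis using PiE_arb[OF f False] PiE_arb[OF f' False] permutes_not_in[OF g(1) False] by simp
    qed
  qed
  with g(1) show ?thesis by blast
qed

lemma content_surj:
  assumes "M \<in> msets_over K n"
  shows "\<exists>f\<in>{1..n} \<rightarrow>\<^sub>E K. content_mset n f = M"
proof -
  obtain xs where xs: "mset xs = M" using ex_mset by blast
  have len: "length xs = n" and set: "set xs \<subseteq> K" using assms xs unfolding msets_over_def by auto
  define f where "f = (\<lambda>i\<in>{1..n}. xs ! (i - 1))"
  have "f \<in> {1..n} \<rightarrow>\<^sub>E K"
    unfolding f_def using len set by (auto simp: restrict_PiE_iff intro!: subsetD[OF set] nth_mem)
  moreover have "content_mset n f = M"
  proof -
    have "content_mset n f = mset (map f [1..<Suc n])"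
      unfolding content_mset_def by (simp add: atLeastLessThanSuc_atLeastAtMost del: upt_Suc)
    also have "map f [1..<Suc n] = xs"
      by (rule nth_equalityI) (auto simp: len f_def simp del: upt_Suc)
    finally show ?thesis using xs by simp
  qed
  ultimately show ?thesis by blast
qed

lemma content_in: "f \<in> {1..n} \<rightarrow>\<^sub>E K \<Longrightarrow> content_mset n f \<in> msets_over K n"
  unfolding content_mset_def msets_over_def by auto

text \<open>Burnside's lemma: contents separate the orbits of \<open>S\<^sub>n\<close> on functions.\<close>

lemma sum_fixed_count:
  assumes K: "finite K"
  shows "(\<Sum>g | g permutes {1..n}. fixed_count n K Q g) = fact n * card {M\<in>msets_over K n. Q M}"
proof -
  let ?P = "{g. g permutes {1..n}}"
  define S where "S = {f \<in> {1..n} \<rightarrow>\<^sub>E K. Q (content_mset n f)}"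
  have finP: "finite ?P" by (simp add: finite_permutations)
  have finS: "finite S" unfolding S_def using K by (simp add: finite_PiE)
  have "fixed_count n K Q g = (\<Sum>f\<in>S. if f \<circ> g = f then 1 else 0)" for g
  proof -
    have "fixed_count n K Q g = card {f\<in>S. f \<circ> g = f}"
      unfolding fixed_count_def S_def by (rule arg_cong[of _ _ card]) auto
    also have "\<dots> = (\<Sum>f\<in>S. if f \<circ> g = f then 1 else 0)"
      using finS by (simp add: sum.If_cases Int_def)
    finally show ?thesis .
  qed
  then have "(\<Sum>g\<in>?P. fixed_count n K Q g) = (\<Sum>f\<in>S. \<Sum>g\<in>?P. if f \<circ> g = f then 1 else 0)"
    by (simp only: sum.swap[of _ S])
  also have "\<dots> = (\<Sum>f\<in>S. card {g\<in>?P. f \<circ> g = f})"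
    using finP by (simp add: sum.If_cases Int_def)
  also have "\<dots> = (\<Sum>M\<in>content_mset n ` S. \<Sum>f\<in>{f\<in>S. content_mset n f = M}. card {g\<in>?P. f \<circ> g = f})"
    using finS by (intro sum.group[symmetric]) auto
  also have "\<dots> = (\<Sum>M\<in>content_mset n ` S. fact n)"
  proof (intro sum.cong refl)
    fix M assume "M \<in> content_mset n ` S"
    then obtain f0 where f0: "f0 \<in> S" "content_mset n f0 = M" by blast
    let ?O = "{f\<in>S. content_mset n f = M}"
    have f0P: "f0 \<in> {1..n} \<rightarrow>\<^sub>E K" using f0 unfolding S_def by simp
    \<comment> \<open>Composition with \<open>h\<close> moves the stabiliser of
      \<open>f = f0 \<circ> h\<close> onto the set of all \<open>g\<close> that carry
      \<open>f0\<close> to \<open>f\<close>. As \<open>f\<close> ranges over the orbit these sets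
      partition the symmetric group, so each orbit contributes n!.\<close>
    have stab: "card {g\<in>?P. f \<circ> g = f} = card {g\<in>?P. f0 \<circ> g = f}" if f: "f \<in> ?O" for f
    proof -
      have fP: "f \<in> {1..n} \<rightarrow>\<^sub>E K" using f unfolding S_def by simp
      obtain h where h: "h permutes {1..n}" "f = f0 \<circ> h"
        using content_eq_imp_comp[OF fP f0P] f f0(2) by auto
      have hi: "inv' h permutes {1..n}" using permutes_inv[OF h(1)] .
      have "bij_betw (\<lambda>g. h \<circ> g) {g\<in>?P. f \<circ> g = f} {g\<in>?P. f0 \<circ> g = f}"
      proof (rule bij_betwI[where g = "\<lambda>g. inv' h \<circ> g"])
        show "(\<lambda>g. h \<circ> g) \<in> {g\<in>?P. f \<circ> g = f} \<rightarrow> {g\<in>?P. f0 \<circ> g = f}"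
          using permutes_compose[OF _ h(1)] h(2) by (auto simp: comp_assoc)
        have "f \<circ> (inv' h \<circ> g) = f0 \<circ> g" for g
          unfolding h(2) using permutes_inverses[OF h(1)] by (simp add: fun_eq_iff)
        then show "(\<lambda>g. inv' h \<circ> g) \<in> {g\<in>?P. f0 \<circ> g = f} \<rightarrow> {g\<in>?P. f \<circ> g = f}"
          using permutes_compose[OF _ hi] by auto
        show "inv' h \<circ> (h \<circ> g) = g" "h \<circ> (inv' h \<circ> g) = g" for g
          using permutes_inverses[OF h(1)] by (simp_all add: fun_eq_iff)
      qed
      then show ?thesis by (rule bij_betw_same_card)
    qed
    have "(\<Sum>f\<in>?O. card {g\<in>?P. f \<circ> g = f}) = (\<Sum>f\<in>?O. \<Sum>g\<in>{g\<in>?P. f0 \<circ> g = f}. 1)"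
      using stab by simp
    also have "\<dots> = (\<Sum>g\<in>?P. 1)"
    proof (rule sum.group)
      show "(\<lambda>g. f0 \<circ> g) ` ?P \<subseteq> ?O"
        using f0 comp_permutes_PiE[OF _ f0P] content_comp_permutes[of _ n f0] unfolding S_def by auto
    qed (use finP finS in auto)
    also have "\<dots> = fact n" by (simp add: card_permutations)
    finally show "(\<Sum>f\<in>?O. card {g\<in>?P. f \<circ> g = f}) = fact n" .
  qed
  also have "\<dots> = fact n * card (content_mset n ` S)" by simp
  also have "content_mset n ` S = {M\<in>msets_over K n. Q M}"
  proof
    show "content_mset n ` S \<subseteq> {M\<in>msets_over K n. Q M}" unfolding S_def using content_in by auto
    show "{M\<in>msets_over K n. Q M} \<subseteq> content_mset n ` S"
    proof
      fix M assume M: "M \<in> {M\<in>msets_over K n. Q M}"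
      then obtain f where "f \<in> {1..n} \<rightarrow>\<^sub>E K" "content_mset n f = M" using content_surj[of M K n] by auto
      then show "M \<in> content_mset n ` S" using M unfolding S_def by auto
    qed
  qed
  finally show ?thesis .
qed

text \<open>A pair of functions is a function into pairs, fixed by g exactly when both are, and the
  two contents are the marginals of its content. In this way products of permutation characters
  count tables.\<close>

lemma fixed_count_mult:
  assumes g: "g permutes {1..n}"
  shows "fixed_count n K Q g * fixed_count n K' Q' g
    = fixed_count n (K \<times> K') (\<lambda>M. Q (image_mset fst M) \<and> Q' (image_mset snd M)) g"
proof -
  let ?A = "{f \<in> {1..n} \<rightarrow>\<^sub>E K. Q (content_mset n f) \<and> f \<circ> g = f}"
  let ?B = "{f \<in> {1..n} \<rightarrow>\<^sub>E K'. Q' (content_mset n f) \<and> f \<circ> g = f}"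
  let ?C = "{f \<in> {1..n} \<rightarrow>\<^sub>E K \<times> K'. (Q (image_mset fst (content_mset n f)) \<and> Q' (image_mset snd (content_mset n f))) \<and> f \<circ> g = f}"
  let ?\<phi> = "\<lambda>(u, v). \<lambda>x\<in>{1..n}. (u x, v x)"
  let ?\<psi> = "\<lambda>f. (\<lambda>x\<in>{1..n}. fst (f x), \<lambda>x\<in>{1..n}. snd (f x))"
  have ginv: "f \<circ> g = f" if "\<And>x. x \<in> {1..n} \<Longrightarrow> f (g x) = f x" for f :: "nat \<Rightarrow> 'c"
  proof
    fix x show "(f \<circ> g) x = f x" using that permutes_not_in[OF g, of x] by (cases "x \<in> {1..n}") auto
  qed
  have gin: "g x \<in> {1..n}" if "x \<in> {1..n}" for x using permutes_in_image[OF g] that by blast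
  have "bij_betw ?\<phi> (?A \<times> ?B) ?C"
  proof (rule bij_betwI[where g = ?\<psi>])
    show "?\<phi> \<in> ?A \<times> ?B \<rightarrow> ?C"
    proof clarify
      fix u v
      assume u: "u \<in> {1..n} \<rightarrow>\<^sub>E K" "Q (content_mset n u)" "u \<circ> g = u"
        and v: "v \<in> {1..n} \<rightarrow>\<^sub>E K'" "Q' (content_mset n v)" "v \<circ> g = v"
      let ?f = "\<lambda>x\<in>{1..n}. (u x, v x)"
      have "?f \<in> {1..n} \<rightarrow>\<^sub>E K \<times> K'" using u(1) v(1) by auto
      moreover have "image_mset fst (content_mset n ?f) = content_mset n u" "image_mset snd (content_mset n ?f) = content_mset n v"
        unfolding content_mset_def by (auto simp: multiset.map_comp intro!: image_mset_cong)
      moreover have "?f \<circ> g = ?f"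
        by (rule ginv) (use gin fun_cong[OF u(3)] fun_cong[OF v(3)] in auto)
      ultimately show "?f \<in> {1..n} \<rightarrow>\<^sub>E K \<times> K' \<and>
          (Q (image_mset fst (content_mset n ?f)) \<and> Q' (image_mset snd (content_mset n ?f))) \<and> ?f \<circ> g = ?f"
        using u(2) v(2) by simp
    qed
    show "?\<psi> \<in> ?C \<rightarrow> ?A \<times> ?B"
    proof
      fix f assume f: "f \<in> ?C"
      have fg: "f (g x) = f x" for x using f by (auto simp: fun_eq_iff)
      have "content_mset n (\<lambda>x\<in>{1..n}. fst (f x)) = image_mset fst (content_mset n f)"
        "content_mset n (\<lambda>x\<in>{1..n}. snd (f x)) = image_mset snd (content_mset n f)"
        unfolding content_mset_def by (auto simp: multiset.map_comp intro!: image_mset_cong)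
      moreover have "(\<lambda>x\<in>{1..n}. fst (f x)) \<circ> g = (\<lambda>x\<in>{1..n}. fst (f x))"
        "(\<lambda>x\<in>{1..n}. snd (f x)) \<circ> g = (\<lambda>x\<in>{1..n}. snd (f x))"
        by (rule ginv; use gin fg in \<open>simp del: atLeastAtMost_iff\<close>)+
      moreover have "(\<lambda>x\<in>{1..n}. fst (f x)) \<in> {1..n} \<rightarrow>\<^sub>E K" "(\<lambda>x\<in>{1..n}. snd (f x)) \<in> {1..n} \<rightarrow>\<^sub>E K'"
        using f by (auto simp: restrict_PiE_iff PiE_iff mem_Times_iff)
      ultimately show "?\<psi> f \<in> ?A \<times> ?B" using f by simp
    qed
    show "?\<psi> (?\<phi> uv) = uv" if "uv \<in> ?A \<times> ?B" for uv
      using that by (auto simp: fun_eq_iff PiE_def extensional_def)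
    show "?\<phi> (?\<psi> f) = f" if "f \<in> ?C" for f
      using that by (auto simp: fun_eq_iff PiE_def extensional_def)
  qed
  from bij_betw_same_card[OF this] show ?thesis unfolding fixed_count_def by (simp add: card_cartesian_product)
qed

definition has_margin :: "nat \<Rightarrow> (nat \<Rightarrow> int) \<Rightarrow> nat multiset \<Rightarrow> bool" where
  "has_margin l a M \<longleftrightarrow> (\<forall>i<l. int (count M i) = a i)"

lemma perm_char_fixed_count: "perm_char n l a g = fixed_count n {..<l} (has_margin l a) g"
proof -
  have "count (content_mset n w) i = card {x\<in>{1..n}. w x = i}" for w :: "nat \<Rightarrow> nat" and i
    unfolding content_mset_def by (simp add: count_image_mset Int_def vimage_def conj_commute)
  then show ?thesis unfolding perm_char_def fixed_count_def has_margin_def tabloids_def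
    by (intro arg_cong[of _ _ card]) auto
qed

section \<open>The bialternant identity\<close>

text \<open>Polynomials in the variables \<open>y\<^sub>0, y\<^sub>1, \<dots>\<close> with monomials encoded as multisets of indices.\<close>

definition mono_of :: "nat multiset \<Rightarrow> nat multiset \<Rightarrow>\<^sub>0 int" where
  "mono_of M = Poly_Mapping.single M 1"

lemma mono_of_empty [simp]: "mono_of {#} = 1"
  by (simp add: mono_of_def)

lemma lookup_mono_of: "Poly_Mapping.lookup (mono_of M) N = (if M = N then 1 else 0)"
  by (simp add: mono_of_def lookup_single when_def)

definition complete_sym :: "nat \<Rightarrow> int \<Rightarrow> nat multiset \<Rightarrow>\<^sub>0 int" where
  "complete_sym l m = (if m < 0 then 0 else \<Sum>M\<in>msets_over {..<l} (nat m). mono_of M)"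

text \<open>The series 1 / (1 - y_i t), whose inverse is \<open>linear_factor i\<close>.\<close>

definition geom :: "nat \<Rightarrow> (nat multiset \<Rightarrow>\<^sub>0 int) fps" where
  "geom i = Abs_fps (\<lambda>k. mono_of (replicate_mset k i))"

definition linear_factor :: "nat \<Rightarrow> (nat multiset \<Rightarrow>\<^sub>0 int) fps" where
  "linear_factor i = 1 - fps_const (mono_of {#i#}) * fps_X"

lemma mono_of_mult: "mono_of M * mono_of N = mono_of (M + N)"
  by (simp add: mono_of_def mult_single)

lemma mono_of_prod: "(\<Prod>i\<in>I. mono_of (f i)) = mono_of (\<Sum>i\<in>I. f i)"
  by (induction I rule: infinite_finite_induct) (simp_all add: mono_of_mult)

lemma prod_geom_nth:
  assumes "finite I"
  shows "fps_nth (\<Prod>i\<in>I. geom i) m = (\<Sum>M\<in>msets_over I m. mono_of M)"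
  using assms
proof (induction I arbitrary: m rule: finite_induct)
  case empty
  have "msets_over ({} :: nat set) m = (if m = 0 then {{#}} else {})"
    unfolding msets_over_def by auto
  then show ?case by (cases "m = 0") simp_all
next
  case (insert a I)
  have "fps_nth (\<Prod>i\<in>insert a I. geom i) m
      = (\<Sum>k=0..m. mono_of (replicate_mset k a) * (\<Sum>M\<in>msets_over I (m - k). mono_of M))"
    using insert by (simp add: fps_mult_nth geom_def)
  also have "\<dots> = (\<Sum>k=0..m. \<Sum>M\<in>msets_over I (m - k). mono_of (replicate_mset k a + M))"
    by (simp add: sum_distrib_left mono_of_mult)
  also have "\<dots> = (\<Sum>(k, M)\<in>Sigma {0..m} (\<lambda>k. msets_over I (m - k)). mono_of (replicate_mset k a + M))"
    by (rule sum.Sigma) (simp_all add: finite_msets_over insert.hyps)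
  also have "\<dots> = (\<Sum>N\<in>msets_over (insert a I) m. mono_of N)"
  proof (rule sum.reindex_bij_witness[where j = "\<lambda>(k, M). replicate_mset k a + M"
        and i = "\<lambda>N. (count N a, filter_mset (\<lambda>x. x \<noteq> a) N)"], goal_cases)
    case (1 kM)
    then obtain k M where kM: "kM = (k, M)" "set_mset M \<subseteq> I" unfolding msets_over_def by auto
    have "a \<notin># M" using kM(2) insert.hyps(2) by blast
    then have "filter_mset (\<lambda>x. x \<noteq> a) M = M" "count M a = 0"
      by (auto simp: filter_mset_eq_conv count_eq_zero_iff)
    moreover have "filter_mset (\<lambda>x. x \<noteq> a) (replicate_mset k a) = {#}"
      by (induction k) auto
    ultimately show ?case using kM(1) by simp
  next
    case (3 N)
    then show ?case using multiset_partition[of N "\<lambda>x. x = a"] by (simp add: filter_eq_replicate_mset)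
  next
    case (4 N)
    have "size N = count N a + size (filter_mset (\<lambda>x. x \<noteq> a) N)"
      using arg_cong[OF multiset_partition[of N "\<lambda>x. x = a"], of size]
      by (simp add: filter_eq_replicate_mset)
    then show ?case using 4 unfolding msets_over_def by auto
  next
    case (2 kM)
    then show ?case unfolding msets_over_def by (fastforce split: if_splits)
  qed (auto simp: msets_over_def)
  finally show ?case .
qed

lemma linear_factor_geom: "linear_factor i * geom i = 1"
proof (rule fps_ext)
  fix k
  show "fps_nth (linear_factor i * geom i) k = fps_nth 1 k"
    unfolding linear_factor_def geom_def left_diff_distrib mult.assoc
    by (cases k) (simp_all add: mono_of_mult fps_X_mult_nth)
qed

lemma prod_linear_factor_nth:
  assumes "finite I" "card I < d"
  shows "fps_nth (\<Prod>i\<in>I. linear_factor i) d = 0"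
  using assms
proof (induction I arbitrary: d rule: finite_induct)
  case (insert a I)
  then show ?case
    unfolding prod.insert[OF insert.hyps] linear_factor_def[of a] left_diff_distrib mult.assoc
    by (simp add: fps_X_mult_nth)
qed simp

text \<open>Write H for the product of all geometric series and E_k for the product of the linear
  factors other than the k-th. Then E_k H = 1 / (1 - y_k t), and coefficients of t^m are compared.
  E_k has degree at most l - 1, so its coefficients can be indexed by l - Suc j; the reversed order
  produces the Jacobi-Trudi indices.\<close>

lemma complete_sym_expansion:
  assumes k: "k < l"
  shows "mono_of (replicate_mset m k)
    = (\<Sum>j<l. complete_sym l (int m - int (l - Suc j)) * fps_nth (\<Prod>i\<in>{..<l} - {k}. linear_factor i) (l - Suc j))"
proof -
  let ?E = "\<Prod>i\<in>{..<l} - {k}. linear_factor i" and ?H = "\<Prod>i\<in>{..<l}. geom i"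
  have kl: "k \<in> {..<l}" using k by simp
  have "?E * ?H = ?E * (\<Prod>i\<in>{..<l} - {k}. geom i) * geom k"
    unfolding prod.remove[OF finite_lessThan kl, of geom] by (simp add: mult_ac)
  also have "\<dots> = (\<Prod>i\<in>{..<l} - {k}. linear_factor i * geom i) * geom k"
    by (simp only: prod.distrib)
  also have "\<dots> = geom k" by (simp add: linear_factor_geom)
  finally have EH: "?E * ?H = geom k" .
  have H: "fps_nth ?H d = complete_sym l (int d)" for d
    unfolding complete_sym_def using prod_geom_nth[of "{..<l}" d] by simp
  have E0: "fps_nth ?E d = 0" if "l \<le> d" for d
  proof (rule prod_linear_factor_nth)
    have "card ({..<l} - {k}) = l - 1" using k by simp
    then show "card ({..<l} - {k}) < d" using k that by linarith
  qed simp
  have "mono_of (replicate_mset m k) = fps_nth (?E * ?H) m" unfolding EH by (simp add: geom_def)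
  also have "\<dots> = (\<Sum>d\<in>{0..m}. fps_nth ?E d * complete_sym l (int m - int d))"
    unfolding fps_mult_nth by (intro sum.cong refl) (simp add: H of_nat_diff)
  also have "\<dots> = (\<Sum>d\<in>{0..m} \<inter> {..<l}. fps_nth ?E d * complete_sym l (int m - int d))"
    by (rule sum.mono_neutral_right) (auto simp: E0 not_less)
  also have "\<dots> = (\<Sum>d<l. fps_nth ?E d * complete_sym l (int m - int d))"
    by (rule sum.mono_neutral_left) (auto simp: complete_sym_def)
  also have "\<dots> = (\<Sum>j<l. fps_nth ?E (l - Suc j) * complete_sym l (int m - int (l - Suc j)))"
    by (rule sum.nat_diff_reindex[symmetric])
  finally show ?thesis by (simp add: mult.commute)
qed

definition alternant :: "nat \<Rightarrow> (nat \<Rightarrow> nat) \<Rightarrow> (nat multiset \<Rightarrow>\<^sub>0 int) mat" where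
  "alternant l L = mat l l (\<lambda>(i, k). mono_of (replicate_mset (L i) k))"

text \<open>For \<open>L i = \<mu> i + (l - Suc i)\<close> the entry in place (i, j) has degree
  \<mu> i - i + j, as in the Jacobi-Trudi determinant.\<close>

definition jt_matrix :: "nat \<Rightarrow> (nat \<Rightarrow> nat) \<Rightarrow> (nat multiset \<Rightarrow>\<^sub>0 int) mat" where
  "jt_matrix l L = mat l l (\<lambda>(i, j). complete_sym l (int (L i) - int (l - Suc j)))"

text \<open>Every alternant is the Jacobi--Trudi matrix times one fixed matrix, and for the staircase the
  former is unitriangular.\<close>

lemma bialternant:
  "det (alternant l L) = det (jt_matrix l L) * det (alternant l (\<lambda>i. l - Suc i))"
proof -
  define E where "E = mat l l (\<lambda>(j, k). fps_nth (\<Prod>i\<in>{..<l} - {k}. linear_factor i) (l - Suc j))"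
  have mult: "alternant l L = jt_matrix l L * E" for L
  proof (rule eq_matI)
    fix i k assume "i < dim_row (jt_matrix l L * E)" "k < dim_col (jt_matrix l L * E)"
    then have ik: "i < l" "k < l" by (auto simp: jt_matrix_def E_def)
    show "alternant l L $$ (i, k) = (jt_matrix l L * E) $$ (i, k)"
      using ik complete_sym_expansion[OF ik(2), of "L i"]
      by (simp add: alternant_def jt_matrix_def E_def scalar_prod_def lessThan_atLeast0)
  qed (auto simp: alternant_def jt_matrix_def E_def)
  have carr: "jt_matrix l L \<in> carrier_mat l l" "E \<in> carrier_mat l l" for L
    unfolding jt_matrix_def E_def by auto
  have dets: "det (alternant l L) = det (jt_matrix l L) * det E" for L
    unfolding mult by (rule det_mult[OF carr])
  have "complete_sym l 0 = 1"
  proof -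
    have "msets_over {..<l} 0 = {{#} :: nat multiset}" unfolding msets_over_def by auto
    then show ?thesis unfolding complete_sym_def by simp
  qed
  then have "prod_list (diag_mat (jt_matrix l (\<lambda>i. l - Suc i))) = 1"
    unfolding prod_list_diag_prod by (simp add: jt_matrix_def)
  moreover have "upper_triangular (jt_matrix l (\<lambda>i. l - Suc i))"
    unfolding jt_matrix_def by (auto simp: complete_sym_def)
  ultimately have "det (jt_matrix l (\<lambda>i. l - Suc i)) = 1"
    using det_upper_triangular[OF _ carr(1)] by metis
  then show ?thesis using dets[of L] dets[of "\<lambda>i. l - Suc i"] by simp
qed

lemma image_mset_sum: "image_mset f (\<Sum>j\<in>I. g j) = (\<Sum>j\<in>I. image_mset f (g j))"
  by (induction I rule: infinite_finite_induct) auto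

lemma filter_mset_sum: "filter_mset P (\<Sum>j\<in>I. g j) = (\<Sum>j\<in>I. filter_mset P (g j))"
  by (induction I rule: infinite_finite_induct) auto

lemma count_sum_replicate:
  fixes l i :: nat
  assumes "inj_on p {..<l}" "i < l"
  shows "count (\<Sum>j<l. replicate_mset (c j) (p j)) (p i) = c i"
proof -
  have "count (\<Sum>j<l. replicate_mset (c j) (p j)) (p i) = (\<Sum>j<l. if j = i then c j else 0)"
    unfolding count_sum using assms by (intro sum.cong) (auto dest: inj_onD)
  also have "\<dots> = c i" using assms(2) by simp
  finally show ?thesis .
qed

text \<open>The product expands over families of multisets \<open>g i\<close> of size
  \<open>a i\<close>. Placing \<open>g i\<close> in row i makes the family a table with row margin
  a, and the monomial records its column margin. If some \<open>a i\<close> is negative, both sides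
  vanish.\<close>

lemma prod_complete_sym:
  assumes sum: "(\<Sum>i<l. a i) = int n"
  shows "(\<Prod>i<l. complete_sym l (a i))
    = (\<Sum>M\<in>{M\<in>msets_over ({..<l} \<times> {..<l}) n. has_margin l a (image_mset fst M)}. mono_of (image_mset snd M))"
    (is "_ = sum _ ?S")
proof (cases "\<forall>i<l. 0 \<le> a i")
  case False
  then obtain i where i: "i < l" "a i < 0" by auto
  then have "complete_sym l (a i) = 0" by (simp add: complete_sym_def)
  then have "(\<Prod>i<l. complete_sym l (a i)) = 0" using i by (intro prod_zero) auto
  moreover have "\<not> has_margin l a M" for M
  proof
    assume "has_margin l a M"
    then have "int (count M i) = a i" using i(1) unfolding has_margin_def by blast
    then show False using i(2) by simp
  qed
  ultimately show ?thesis by simp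
next
  case True
  let ?B = "\<lambda>i. msets_over {..<l} (nat (a i))"
  have "(\<Prod>i<l. complete_sym l (a i)) = (\<Prod>i<l. \<Sum>M\<in>?B i. mono_of M)"
    by (intro prod.cong refl) (use True in \<open>force simp: complete_sym_def\<close>)
  also have "\<dots> = (\<Sum>g\<in>Pi\<^sub>E {..<l} ?B. \<Prod>i<l. mono_of (g i))"
    by (rule prod_sum_PiE) (simp_all add: finite_msets_over)
  also have "\<dots> = (\<Sum>g\<in>Pi\<^sub>E {..<l} ?B. mono_of (\<Sum>i<l. g i))" by (simp add: mono_of_prod)
  also have "\<dots> = (\<Sum>M\<in>?S. mono_of (image_mset snd M))"
  proof (rule sum.reindex_bij_witness[where j = "\<lambda>g. \<Sum>i<l. image_mset (Pair i) (g i)"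
        and i = "\<lambda>M. \<lambda>i\<in>{..<l}. image_mset snd (filter_mset (\<lambda>x. fst x = i) M)"], goal_cases)
    case (1 g)
    have "image_mset snd (filter_mset (\<lambda>x. fst x = i) (\<Sum>j<l. image_mset (Pair j) (g j))) = g i"
      if "i < l" for i
    proof -
      have "filter_mset (\<lambda>x. fst x = i) (\<Sum>j<l. image_mset (Pair j) (g j))
          = (\<Sum>j<l. if j = i then image_mset (Pair i) (g i) else {#})"
        unfolding filter_mset_sum filter_mset_image_mset by (intro sum.cong) auto
      also have "\<dots> = image_mset (Pair i) (g i)" using that by simp
      finally show ?thesis by (simp add: multiset.map_comp comp_def)
    qed
    then show ?case using 1 by (auto simp: fun_eq_iff PiE_def extensional_def)
  next
    case (2 g)
    have g: "set_mset (g i) \<subseteq> {..<l}" "size (g i) = nat (a i)" if "i < l" for i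
      using 2 that unfolding msets_over_def by (auto simp: PiE_iff)
    let ?M = "\<Sum>i<l. image_mset (Pair i) (g i)"
    have "set_mset ?M \<subseteq> {..<l} \<times> {..<l}"
      using g(1) by (fastforce simp: set_mset_sum)
    moreover have "size ?M = n"
    proof -
      have "int (size ?M) = (\<Sum>i<l. a i)"
        unfolding size_multiset_sum using g(2) True by simp
      then show ?thesis unfolding sum by (simp only: of_nat_eq_iff)
    qed
    moreover have "has_margin l a (image_mset fst ?M)"
      unfolding has_margin_def
    proof (intro allI impI)
      fix i assume i: "i < l"
      have "image_mset fst ?M = (\<Sum>j<l. replicate_mset (size (g j)) j)"
        unfolding image_mset_sum by (simp add: multiset.map_comp comp_def image_mset_const_eq)
      then have "count (image_mset fst ?M) i = size (g i)"
        using count_sum_replicate[of "\<lambda>j. j" l i "\<lambda>j. size (g j)"] i by simp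
      then show "int (count (image_mset fst ?M) i) = a i" using g(2)[OF i] True i by simp
    qed
    ultimately show ?case unfolding msets_over_def by simp
  next
    case (3 M)
    then have M: "set_mset M \<subseteq> {..<l} \<times> {..<l}" unfolding msets_over_def by simp
    have "(\<Sum>i<l. image_mset (Pair i) ((\<lambda>i\<in>{..<l}. image_mset snd (filter_mset (\<lambda>x. fst x = i) M)) i))
        = (\<Sum>i<l. filter_mset (\<lambda>x. fst x = i) M)"
    proof (intro sum.cong refl)
      fix i assume "i \<in> {..<l}"
      then show "image_mset (Pair i) ((\<lambda>i\<in>{..<l}. image_mset snd (filter_mset (\<lambda>x. fst x = i) M)) i)
          = filter_mset (\<lambda>x. fst x = i) M"
        by (auto simp: multiset.map_comp comp_def intro!: image_mset_cong[of _ _ "\<lambda>x. x", simplified])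
    qed
    also have "\<dots> = M"
    proof (rule multiset_eqI)
      fix x
      have "count (\<Sum>i<l. filter_mset (\<lambda>x. fst x = i) M) x = (\<Sum>i<l. if i = fst x then count M x else 0)"
        unfolding count_sum by (intro sum.cong) auto
      also have "\<dots> = count M x"
      proof (cases "fst x < l")
        case False
        then have "x \<notin># M" using M by auto
        then show ?thesis by (simp add: not_in_iff)
      qed simp
      finally show "count (\<Sum>i<l. filter_mset (\<lambda>x. fst x = i) M) x = count M x" .
    qed
    finally show ?case .
  next
    case (4 M)
    have "size (image_mset snd (filter_mset (\<lambda>x. fst x = i) M)) = nat (a i)" if "i < l" for i
    proof -
      have "int (count (image_mset fst M) i) = a i" using 4 that unfolding has_margin_def by simp
      moreover have "count (image_mset fst M) i = size (filter_mset (\<lambda>x. fst x = i) M)"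
        by (simp add: count_conv_size_mset filter_mset_image_mset)
      ultimately show ?thesis by simp
    qed
    moreover have "set_mset (image_mset snd (filter_mset P M)) \<subseteq> {..<l}" for P
      using 4 unfolding msets_over_def by auto
    ultimately show ?case unfolding restrict_PiE_iff msets_over_def by blast
  next
    case (5 g)
    show ?case unfolding image_mset_sum by (simp add: multiset.map_comp comp_def)
  qed
  finally show ?thesis .
qed

lemma lookup_sign_mult:
  fixes x :: "nat multiset \<Rightarrow>\<^sub>0 int"
  shows "Poly_Mapping.lookup (of_int (sign p) * x) k = sign p * Poly_Mapping.lookup x k"
  by (simp add: sign_def)

section \<open>Coefficient extraction and the norm of the alternating character\<close>

context partition_shape
begin

definition beta :: "nat \<Rightarrow> nat" where
  "beta i = \<mu> i + (l - Suc i)"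

lemma beta_inj: "inj_on beta {..<l}"
proof (rule linorder_inj_onI)
  fix i j assume "i < j" "i \<in> {..<l}" "j \<in> {..<l}"
  then show "beta i \<noteq> beta j"
    using antimonoD[OF anti, of i j] unfolding beta_def by simp
qed auto

lemma sum_shifted: "\<sigma> permutes {..<l} \<Longrightarrow> (\<Sum>i<l. shifted \<mu> \<sigma> i) = int n"
  using sum.permute[of \<sigma> "{..<l}" int] unfolding shifted_def size
  by (simp add: sum.distrib sum_subtractf comp_def)

definition table_count :: "(nat \<Rightarrow> nat) \<Rightarrow> (nat \<Rightarrow> nat) \<Rightarrow> nat" where
  "table_count \<sigma> \<tau> = card {M\<in>msets_over ({..<l} \<times> {..<l}) n.
     has_margin l (shifted \<mu> \<sigma>) (image_mset fst M) \<and> has_margin l (shifted \<mu> \<tau>) (image_mset snd M)}"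

text \<open>The coefficient of y^(\<mu> + \<delta>), with \<delta> the staircase, is compared in the
  bialternant identity. In the alternant of \<open>beta\<close> it is 1, since the exponents are
  distinct. On the other side the products of complete functions expand over tables with prescribed
  row margin, and the monomial of \<tau> from the staircase alternant then fixes the column
  margin.\<close>

lemma alternating_table_count:
  "(\<Sum>\<sigma> | \<sigma> permutes {..<l}. \<Sum>\<tau> | \<tau> permutes {..<l}. sign \<sigma> * sign \<tau> * int (table_count \<sigma> \<tau>)) = 1"
proof -
  let ?P = "{p. p permutes {..<l}}"
  let ?D = "\<lambda>\<tau>. \<Sum>i<l. replicate_mset (l - Suc (\<tau> i)) i"
  let ?L = "\<Sum>i<l. replicate_mset (beta i) i"
  have finP: "finite ?P" by (simp add: finite_permutations)
  have less: "p i < l" if "p \<in> ?P" "i < l" for p i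
    using permutes_in_image[of p "{..<l}" i] that by simp
  have det_jt: "det (jt_matrix l beta) = (\<Sum>\<sigma>\<in>?P. of_int (sign \<sigma>) * (\<Prod>i<l. complete_sym l (shifted \<mu> \<sigma> i)))"
  proof -
    have "(\<Prod>i = 0..<l. jt_matrix l beta $$ (i, \<sigma> i)) = (\<Prod>i<l. complete_sym l (shifted \<mu> \<sigma> i))"
      if \<sigma>: "\<sigma> \<in> ?P" for \<sigma>
      unfolding atLeast0LessThan
    proof (intro prod.cong refl)
      fix i assume "i \<in> {..<l}"
      then have i: "i < l" by simp
      have "int (beta i) - int (l - Suc (\<sigma> i)) = shifted \<mu> \<sigma> i"
        using i less[OF \<sigma> i] unfolding beta_def shifted_def by (simp add: of_nat_diff)
      then show "jt_matrix l beta $$ (i, \<sigma> i) = complete_sym l (shifted \<mu> \<sigma> i)"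
        using i less[OF \<sigma> i] unfolding jt_matrix_def by simp
    qed
    then show ?thesis
      using det_def'[of "jt_matrix l beta" l] by (simp add: jt_matrix_def atLeast0LessThan)
  qed
  \<comment> \<open>The transpose is expanded so that \<open>\<tau>\<close> acts on the exponents:
    variable \<open>i\<close> gets exponent \<open>l - Suc (\<tau> i)\<close>, and subtracting this
    from \<open>beta i\<close> leaves \<open>shifted \<mu> \<tau> i\<close>.\<close>
  have det_delta: "det (alternant l (\<lambda>i. l - Suc i)) = (\<Sum>\<tau>\<in>?P. of_int (sign \<tau>) * mono_of (?D \<tau>))"
  proof -
    let ?A = "alternant l (\<lambda>i. l - Suc i)"
    have A: "?A \<in> carrier_mat l l" unfolding alternant_def by simp
    have "(\<Prod>i = 0..<l. transpose_mat ?A $$ (i, \<tau> i)) = mono_of (?D \<tau>)" if \<tau>: "\<tau> \<in> ?P" for \<tau>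
      unfolding atLeast0LessThan mono_of_prod[symmetric]
      using less[OF \<tau>] by (intro prod.cong refl) (simp add: alternant_def)
    then show ?thesis
      using det_def'[of "transpose_mat ?A" l] A det_transpose[OF A] by (simp add: atLeast0LessThan)
  qed
  have det_beta: "det (alternant l beta) = (\<Sum>p\<in>?P. of_int (sign p) * mono_of (\<Sum>i<l. replicate_mset (beta i) (p i)))"
  proof -
    have "(\<Prod>i = 0..<l. alternant l beta $$ (i, p i)) = mono_of (\<Sum>i<l. replicate_mset (beta i) (p i))"
      if p: "p \<in> ?P" for p
      unfolding atLeast0LessThan mono_of_prod[symmetric]
      using less[OF p] by (intro prod.cong refl) (simp add: alternant_def)
    then show ?thesis
      using det_def'[of "alternant l beta" l] by (simp add: alternant_def atLeast0LessThan)
  qed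
  have right: "Poly_Mapping.lookup (det (alternant l beta)) ?L = 1"
  proof -
    have "Poly_Mapping.lookup (mono_of (\<Sum>i<l. replicate_mset (beta i) (p i))) ?L = (if p = id then 1 else 0)"
      if p: "p \<in> ?P" for p
    proof -
      have "p = id" if eq: "(\<Sum>i<l. replicate_mset (beta i) (p i)) = ?L"
      proof
        fix i show "p i = id i"
        proof (cases "i < l")
          case True
          have "beta i = count ?L (p i)"
            using count_sum_replicate[of p l i beta] permutes_inj_on[of p "{..<l}"] p True
            unfolding eq by simp
          also have "\<dots> = beta (p i)"
            using count_sum_replicate[of "\<lambda>j. j" l "p i" beta] less[OF p True] by simp
          finally show ?thesis
            using inj_onD[OF beta_inj, of i "p i"] True less[OF p True] by simp
        next
          case False
          then show ?thesis using p permutes_not_in[of p "{..<l}" i] by simp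
        qed
      qed
      then show ?thesis by (auto simp: lookup_mono_of)
    qed
    then have "Poly_Mapping.lookup (det (alternant l beta)) ?L = (\<Sum>p\<in>?P. if p = id then 1 else 0)"
      unfolding det_beta by (simp add: lookup_sum lookup_sign_mult)
        (intro sum.cong, auto simp: sign_id)
    also have "\<dots> = 1" using finP by (simp add: permutes_id)
    finally show ?thesis .
  qed
  have coeff: "Poly_Mapping.lookup ((\<Prod>i<l. complete_sym l (shifted \<mu> \<sigma> i)) * mono_of (?D \<tau>)) ?L = int (table_count \<sigma> \<tau>)"
    if \<sigma>: "\<sigma> \<in> ?P" and \<tau>: "\<tau> \<in> ?P" for \<sigma> \<tau>
  proof -
    let ?S = "{M\<in>msets_over ({..<l} \<times> {..<l}) n. has_margin l (shifted \<mu> \<sigma>) (image_mset fst M)}"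
    have finS: "finite ?S" using finite_msets_over[of "{..<l} \<times> {..<l}" n] by simp
    have iff: "image_mset snd M + ?D \<tau> = ?L \<longleftrightarrow> has_margin l (shifted \<mu> \<tau>) (image_mset snd M)"
      if M: "M \<in> ?S" for M
    proof -
      have cD: "count (?D \<tau>) i = (if i < l then l - Suc (\<tau> i) else 0)" for i
        using count_sum_replicate[of "\<lambda>j. j" l i "\<lambda>i. l - Suc (\<tau> i)"]
        by (auto simp: count_sum intro!: sum.neutral)
      have cL: "count ?L i = (if i < l then beta i else 0)" for i
        using count_sum_replicate[of "\<lambda>j. j" l i beta]
        by (auto simp: count_sum intro!: sum.neutral)
      have out: "count (image_mset snd M) i = 0" if "\<not> i < l" for i
        using M that unfolding msets_over_def by (auto simp: count_eq_zero_iff)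
      have "image_mset snd M + ?D \<tau> = ?L \<longleftrightarrow> (\<forall>i. count (image_mset snd M + ?D \<tau>) i = count ?L i)"
        by (rule multiset_eq_iff)
      also have "\<dots> \<longleftrightarrow> (\<forall>i<l. count (image_mset snd M) i + (l - Suc (\<tau> i)) = beta i)"
        unfolding count_union cD cL using out by auto
      also have "\<dots> \<longleftrightarrow> (\<forall>i<l. int (count (image_mset snd M) i) = shifted \<mu> \<tau> i)"
      proof (intro all_cong)
        fix i assume "i < l"
        then show "(count (image_mset snd M) i + (l - Suc (\<tau> i)) = beta i)
            = (int (count (image_mset snd M) i) = shifted \<mu> \<tau> i)"
          using less[OF \<tau>, of i] unfolding beta_def shifted_def by auto
      qed
      finally show ?thesis unfolding has_margin_def .
    qed
    have "Poly_Mapping.lookup ((\<Prod>i<l. complete_sym l (shifted \<mu> \<sigma> i)) * mono_of (?D \<tau>)) ?L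
        = (\<Sum>M\<in>?S. if image_mset snd M + ?D \<tau> = ?L then 1 else 0)"
      unfolding prod_complete_sym[OF sum_shifted[OF \<sigma>[simplified]]] sum_distrib_right mono_of_mult lookup_sum
      by (simp add: lookup_mono_of)
    also have "\<dots> = (\<Sum>M\<in>?S. if has_margin l (shifted \<mu> \<tau>) (image_mset snd M) then 1 else 0)"
      using iff by (intro sum.cong) auto
    also have "\<dots> = int (card {M\<in>?S. has_margin l (shifted \<mu> \<tau>) (image_mset snd M)})"
      using finS by (simp add: sum.If_cases Int_def)
    also have "{M\<in>?S. has_margin l (shifted \<mu> \<tau>) (image_mset snd M)} = {M\<in>msets_over ({..<l} \<times> {..<l}) n.
     has_margin l (shifted \<mu> \<sigma>) (image_mset fst M) \<and> has_margin l (shifted \<mu> \<tau>) (image_mset snd M)}"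
      by auto
    finally show ?thesis unfolding table_count_def .
  qed
  have "det (jt_matrix l beta) * det (alternant l (\<lambda>i. l - Suc i))
      = (\<Sum>\<sigma>\<in>?P. \<Sum>\<tau>\<in>?P. of_int (sign \<sigma>) *
          (of_int (sign \<tau>) * ((\<Prod>i<l. complete_sym l (shifted \<mu> \<sigma> i)) * mono_of (?D \<tau>))))"
    unfolding det_jt det_delta sum_product by (simp add: mult_ac)
  then have "1 = Poly_Mapping.lookup (\<Sum>\<sigma>\<in>?P. \<Sum>\<tau>\<in>?P. of_int (sign \<sigma>) *
          (of_int (sign \<tau>) * ((\<Prod>i<l. complete_sym l (shifted \<mu> \<sigma> i)) * mono_of (?D \<tau>)))) ?L"
    using right bialternant[of l beta] by simp
  also have "\<dots> = (\<Sum>\<sigma>\<in>?P. \<Sum>\<tau>\<in>?P. sign \<sigma> * (sign \<tau> * int (table_count \<sigma> \<tau>)))"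
    unfolding lookup_sum lookup_sign_mult using coeff by (intro sum.cong refl) simp
  finally show ?thesis by (simp add: mult.assoc)
qed

text \<open>Burnside's lemma turns each product of two permutation characters into n! times a number
  of two-dimensional tables, and the signed sum of these numbers is known from
  \<open>alternating_table_count\<close>.\<close>

lemma jt_char_norm: "(\<Sum>g\<in>carrier (sym_group n). (jt_char n l \<mu> g)\<^sup>2) = fact n"
proof -
  let ?P = "{p. p permutes {..<l}}" and ?G = "{g. g permutes {1..n}}"
  have "(\<Sum>g\<in>?G. (jt_char n l \<mu> g)\<^sup>2)
      = (\<Sum>g\<in>?G. \<Sum>\<sigma>\<in>?P. \<Sum>\<tau>\<in>?P. sign \<sigma> * sign \<tau> *
          int (perm_char n l (shifted \<mu> \<sigma>) g * perm_char n l (shifted \<mu> \<tau>) g))"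
    unfolding jt_char_def power2_eq_square sum_product by (simp add: mult_ac)
  also have "\<dots> = (\<Sum>\<sigma>\<in>?P. \<Sum>\<tau>\<in>?P. \<Sum>g\<in>?G. sign \<sigma> * sign \<tau> *
          int (perm_char n l (shifted \<mu> \<sigma>) g * perm_char n l (shifted \<mu> \<tau>) g))"
    by (subst sum.swap, rule sum.cong[OF refl], rule sum.swap)
  also have "\<dots> = (\<Sum>\<sigma>\<in>?P. \<Sum>\<tau>\<in>?P. fact n * (sign \<sigma> * sign \<tau> * int (table_count \<sigma> \<tau>)))"
  proof (intro sum.cong refl)
    fix \<sigma> \<tau>
    have "(\<Sum>g\<in>?G. perm_char n l (shifted \<mu> \<sigma>) g * perm_char n l (shifted \<mu> \<tau>) g) = fact n * table_count \<sigma> \<tau>"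
      unfolding perm_char_fixed_count table_count_def
      by (subst sum_fixed_count[symmetric]) (auto simp: fixed_count_mult intro!: sum.cong)
    then have "(\<Sum>g\<in>?G. int (perm_char n l (shifted \<mu> \<sigma>) g * perm_char n l (shifted \<mu> \<tau>) g)) = fact n * int (table_count \<sigma> \<tau>)"
      by (metis (mono_tags, lifting) of_nat_fact of_nat_mult of_nat_sum sum.cong)
    then show "(\<Sum>g\<in>?G. sign \<sigma> * sign \<tau> *
          int (perm_char n l (shifted \<mu> \<sigma>) g * perm_char n l (shifted \<mu> \<tau>) g))
        = fact n * (sign \<sigma> * sign \<tau> * int (table_count \<sigma> \<tau>))"
      by (simp only: sum_distrib_left[symmetric] mult_ac)
  qed
  also have "\<dots> = fact n" using alternating_table_count by (simp flip: sum_distrib_left)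
  finally show ?thesis unfolding carrier_sym_group .
qed

end

section \<open>Kronecker coefficients as signed counts of three-dimensional tables\<close>

definition relabel2 :: "(nat \<Rightarrow> nat) \<Rightarrow> (nat \<Rightarrow> nat) \<times> (nat \<Rightarrow> nat) \<Rightarrow> (nat \<Rightarrow> nat) \<times> (nat \<Rightarrow> nat)" where
  "relabel2 p = (\<lambda>(v, w). (v \<circ> p, w \<circ> p))"

lemma tensor_action_eq_pull: "tensor_action = pull relabel2"
  by (simp add: fun_eq_iff tensor_action_def pull_def relabel2_def)

lemma perm_rep_tabloid_pairs: "perm_rep (sym_group n) (tabloids n l a \<times> tabloids n l b) relabel2"
  by (rule perm_rep.intro)
    (auto simp: sym_group_is_group finite_carrier_sym_group finite_tabloids sym_group_carrier
      sym_group_mult sym_group_one tabloids_relabel comp_assoc relabel2_def)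

definition tensor_kernel ::
  "('x \<Rightarrow> 'x \<Rightarrow> complex) \<Rightarrow> ('y \<Rightarrow> 'y \<Rightarrow> complex) \<Rightarrow> 'x \<times> 'y \<Rightarrow> 'x \<times> 'y \<Rightarrow> complex" where
  "tensor_kernel p q y x = p (fst y) (fst x) * q (snd y) (snd x)"

lemma tensor_space_supported:
  assumes "supported_subspace X U" "supported_subspace Y V"
  shows "supported_subspace (X \<times> Y) (tensor_space U V)"
  unfolding supported_subspace_def
proof (intro conjI ballI allI impI)
  show "cfun.subspace (tensor_space U V)" unfolding tensor_space_def by (rule cfun.subspace_span)
next
  fix v z assume "v \<in> tensor_space U V" and z: "z \<notin> X \<times> Y"
  then show "v z = 0" unfolding tensor_space_def
  proof (induction v rule: cfun.span_induct)
    case base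
    show ?case unfolding cfun.subspace_def by (auto simp: cscale_def)
  next
    case (step v)
    then obtain f g where "v = pure_tensor f g" "f \<in> U" "g \<in> V" by blast
    then show ?case
      using z assms unfolding pure_tensor_def supported_subspace_def by (cases z) auto
  qed
qed

lemma tensor_kernel:
  assumes p: "is_kernel X U p" and q: "is_kernel Y V q"
  shows "is_kernel (X \<times> Y) (tensor_space U V) (tensor_kernel p q)"
  unfolding is_kernel_def
proof (intro conjI allI ballI)
  fix x
  have "(\<lambda>y. tensor_kernel p q y x) = pure_tensor (\<lambda>y. p y (fst x)) (\<lambda>y. q y (snd x))"
    by (auto simp: tensor_kernel_def pure_tensor_def)
  then show "(\<lambda>y. tensor_kernel p q y x) \<in> tensor_space U V"
    unfolding tensor_space_def using kernel_column[OF p] kernel_column[OF q]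
    by (auto intro!: cfun.span_base)
next
  fix v y assume "v \<in> tensor_space U V"
  then show "(\<Sum>x\<in>X \<times> Y. tensor_kernel p q y x * v x) = v y" unfolding tensor_space_def
  proof (induction v rule: cfun.span_induct)
    case base
    show ?case unfolding cfun.subspace_def
      by (auto simp: cscale_def distrib_left sum.distrib mult.left_commute simp flip: sum_distrib_left)
  next
    case (step v)
    then obtain f g where v: "v = pure_tensor f g" "f \<in> U" "g \<in> V" by blast
    have "(\<Sum>x\<in>X \<times> Y. tensor_kernel p q y x * v x)
        = (\<Sum>x\<in>X. p (fst y) x * f x) * (\<Sum>x\<in>Y. q (snd y) x * g x)"
      unfolding v(1) tensor_kernel_def pure_tensor_def sum_product sum.cartesian_product
      by (intro sum.cong) (auto simp: mult_ac)
    also have "\<dots> = v y"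
      using kernel_reproduces[OF p v(2)] kernel_reproduces[OF q v(3)]
      by (simp add: v(1) pure_tensor_def case_prod_beta)
    finally show ?case .
  qed
next
  fix x y show "tensor_kernel p q x y = cnj (tensor_kernel p q y x)"
    unfolding tensor_kernel_def
    using kernel_hermitian[OF p, of "fst x" "fst y"] kernel_hermitian[OF q, of "snd x" "snd y"] by simp
qed

lemma tensor_rep_char:
  "rep_char (X \<times> Y) relabel2 (tensor_kernel p q) g = rep_char X relabel p g * rep_char Y relabel q g"
  unfolding rep_char_def sum_product sum.cartesian_product
  by (intro sum.cong) (auto simp: tensor_kernel_def relabel2_def)

section \<open>Three-dimensional tables from products of three characters\<close>

definition cube :: "nat \<Rightarrow> (nat \<times> nat \<times> nat) set" where
  "cube l = {..<l} \<times> {..<l} \<times> {..<l}"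

definition cube_count :: "nat \<Rightarrow> nat \<Rightarrow> (nat \<Rightarrow> int) \<Rightarrow> (nat \<Rightarrow> int) \<Rightarrow> (nat \<Rightarrow> int) \<Rightarrow> nat" where
  "cube_count l n a b c = card {M\<in>msets_over (cube l) n. has_margin l a (image_mset fst M) \<and>
     has_margin l b (image_mset fst (image_mset snd M)) \<and> has_margin l c (image_mset snd (image_mset snd M))}"

lemma sum_perm_char_product:
  "(\<Sum>g | g permutes {1..n}. perm_char n l a g * perm_char n l b g * perm_char n l c g)
    = fact n * cube_count l n a b c"
proof -
  let ?Q = "\<lambda>M. has_margin l b (image_mset fst M) \<and> has_margin l c (image_mset snd M)"
  have "perm_char n l a g * perm_char n l b g * perm_char n l c g
      = fixed_count n (cube l) (\<lambda>M. has_margin l a (image_mset fst M) \<and> ?Q (image_mset snd M)) g"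
    if g: "g permutes {1..n}" for g
    unfolding perm_char_fixed_count mult.assoc cube_def
    by (simp only: fixed_count_mult[OF g])
  then have "(\<Sum>g | g permutes {1..n}. perm_char n l a g * perm_char n l b g * perm_char n l c g)
      = (\<Sum>g | g permutes {1..n}. fixed_count n (cube l) (\<lambda>M. has_margin l a (image_mset fst M) \<and> ?Q (image_mset snd M)) g)"
    by (intro sum.cong) auto
  also have "\<dots> = fact n * card {M\<in>msets_over (cube l) n. has_margin l a (image_mset fst M) \<and> ?Q (image_mset snd M)}"
    by (rule sum_fixed_count) (simp add: cube_def)
  finally show ?thesis unfolding cube_count_def .
qed

lemma sum_product3:
  fixes f g h :: "_ \<Rightarrow> int"
  shows "sum f A * (sum g B * sum h C) = (\<Sum>a\<in>A. \<Sum>b\<in>B. \<Sum>c\<in>C. f a * (g b * h c))"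
  unfolding sum_product by (intro sum.cong refl sum_distrib_left)

text \<open>The multiplicity is the mean over the group of a product of three Specht characters;
  these are integer-valued, so the conjugation disappears. Expanding each as a signed sum and
  applying Burnside's lemma to every term cancels n!.\<close>

lemma kronecker_eq:
  assumes "partition_shape \<mu>\<^sub>1 l n" "partition_shape \<mu>\<^sub>2 l n" "partition_shape \<mu>\<^sub>3 l n"
  shows "int (kronecker \<mu>\<^sub>1 \<mu>\<^sub>2 \<mu>\<^sub>3)
    = (\<Sum>\<sigma> | \<sigma> permutes {..<l}. \<Sum>\<tau> | \<tau> permutes {..<l}. \<Sum>\<pi> | \<pi> permutes {..<l}.
         sign \<sigma> * sign \<tau> * sign \<pi> *
         int (cube_count l n (shifted \<mu>\<^sub>1 \<sigma>) (shifted \<mu>\<^sub>2 \<tau>) (shifted \<mu>\<^sub>3 \<pi>)))" (is "_ = ?R")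
proof -
  interpret A: partition_shape \<mu>\<^sub>1 l n by (rule assms(1))
  interpret B: partition_shape \<mu>\<^sub>2 l n by (rule assms(2))
  interpret C: partition_shape \<mu>\<^sub>3 l n by (rule assms(3))
  let ?G = "{g. g permutes {1..n}}" and ?P = "{p. p permutes {..<l}}"
  let ?X = "\<lambda>\<sigma> \<tau> \<pi> g. int (perm_char n l (shifted \<mu>\<^sub>1 \<sigma>) g * perm_char n l (shifted \<mu>\<^sub>2 \<tau>) g * perm_char n l (shifted \<mu>\<^sub>3 \<pi>) g)"
  let ?Y = "\<lambda>\<sigma> \<tau> \<pi>. cube_count l n (shifted \<mu>\<^sub>1 \<sigma>) (shifted \<mu>\<^sub>2 \<tau>) (shifted \<mu>\<^sub>3 \<pi>)"
  define p q r where "p = kernel_of A.M (specht \<mu>\<^sub>1)" and "q = kernel_of B.M (specht \<mu>\<^sub>2)"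
    and "r = kernel_of C.M (specht \<mu>\<^sub>3)"
  have p: "is_kernel A.M (specht \<mu>\<^sub>1) p" and q: "is_kernel B.M (specht \<mu>\<^sub>2) q"
    and r: "is_kernel C.M (specht \<mu>\<^sub>3) r"
    unfolding p_def q_def r_def
    using kernel_of[OF finite_tabloids conjunct1[OF A.specht_submodule]]
      kernel_of[OF finite_tabloids conjunct1[OF B.specht_submodule]]
      kernel_of[OF finite_tabloids conjunct1[OF C.specht_submodule]] by auto
  let ?V = "tensor_space (specht \<mu>\<^sub>2) (specht \<mu>\<^sub>3)"
  interpret T: perm_rep "sym_group n" "B.M \<times> C.M" relabel2 by (rule perm_rep_tabloid_pairs)
  interpret perm_rep_pair "sym_group n" A.M relabel "B.M \<times> C.M" relabel2 ..
  have V: "T.submodule ?V"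
  proof
    show "supported_subspace (B.M \<times> C.M) ?V"
      by (rule tensor_space_supported[OF conjunct1[OF B.specht_submodule] conjunct1[OF C.specht_submodule]])
    show "invariant_subspace (sym_group n) (pull relabel2) ?V"
      unfolding invariant_subspace_def
    proof (intro conjI ballI)
      show "cfun.subspace ?V" unfolding tensor_space_def by (rule cfun.subspace_span)
      fix g v assume g: "g \<in> carrier (sym_group n)" and v: "v \<in> ?V"
      from v show "pull relabel2 g v \<in> ?V" unfolding tensor_space_def
      proof (induction v rule: cfun.span_induct)
        case base
        show ?case unfolding cfun.subspace_def
          by (auto simp: pull_linear cfun.span_zero cfun.span_add cfun.span_scale)
      next
        case (step v)
        then obtain f h where fh: "v = pure_tensor f h" "f \<in> specht \<mu>\<^sub>2" "h \<in> specht \<mu>\<^sub>3" by blast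
        have "pull relabel2 g v = pure_tensor (pull relabel g f) (pull relabel g h)"
          unfolding fh(1) by (auto simp: pull_def pure_tensor_def relabel2_def)
        then show ?case
          using B.M.submoduleD(3)[OF B.specht_submodule g fh(2)] C.M.submoduleD(3)[OF C.specht_submodule g fh(3)]
          by (intro cfun.span_base) blast
      qed
    qed
  qed
  have "of_nat (kronecker \<mu>\<^sub>1 \<mu>\<^sub>2 \<mu>\<^sub>3) * fact n
      = (\<Sum>g\<in>carrier (sym_group n). rep_char (B.M \<times> C.M) relabel2 (tensor_kernel q r) g * cnj (rep_char A.M relabel p g))"
    using multiplicity_in_char[OF A.specht_submodule A.specht_nonzero A.specht_schur_scalar p V tensor_kernel[OF q r]]
    unfolding kronecker_def A.psize perm_action_eq_pull tensor_action_eq_pull card_carrier_sym_group by simp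
  also have "\<dots> = (\<Sum>g\<in>carrier (sym_group n). of_int (jt_char n l \<mu>\<^sub>1 g * (jt_char n l \<mu>\<^sub>2 g * jt_char n l \<mu>\<^sub>3 g)))"
    unfolding tensor_rep_char
    using A.specht_char[OF A.jt_char_norm p] B.specht_char[OF B.jt_char_norm q] C.specht_char[OF C.jt_char_norm r]
    by (intro sum.cong refl) simp
  finally have "(of_int (int (kronecker \<mu>\<^sub>1 \<mu>\<^sub>2 \<mu>\<^sub>3) * fact n) :: complex)
      = of_int (\<Sum>g\<in>?G. jt_char n l \<mu>\<^sub>1 g * (jt_char n l \<mu>\<^sub>2 g * jt_char n l \<mu>\<^sub>3 g))"
    by (simp add: carrier_sym_group)
  then have "int (kronecker \<mu>\<^sub>1 \<mu>\<^sub>2 \<mu>\<^sub>3) * fact n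
      = (\<Sum>g\<in>?G. jt_char n l \<mu>\<^sub>1 g * (jt_char n l \<mu>\<^sub>2 g * jt_char n l \<mu>\<^sub>3 g))"
    by (simp only: of_int_eq_iff)
  also have "\<dots> = (\<Sum>g\<in>?G. \<Sum>\<sigma>\<in>?P. \<Sum>\<tau>\<in>?P. \<Sum>\<pi>\<in>?P. sign \<sigma> * sign \<tau> * sign \<pi> *
      ?X \<sigma> \<tau> \<pi> g)"
    unfolding jt_char_def sum_product3 by (intro sum.cong refl) (simp add: mult_ac)
  also have "\<dots> = (\<Sum>\<sigma>\<in>?P. \<Sum>\<tau>\<in>?P. \<Sum>\<pi>\<in>?P. \<Sum>g\<in>?G. sign \<sigma> * sign \<tau> * sign \<pi> *
      ?X \<sigma> \<tau> \<pi> g)"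
    by (subst sum.swap, rule sum.cong[OF refl], subst sum.swap, rule sum.cong[OF refl], rule sum.swap)
  also have "\<dots> = (\<Sum>\<sigma>\<in>?P. \<Sum>\<tau>\<in>?P. \<Sum>\<pi>\<in>?P. fact n * (sign \<sigma> * sign \<tau> * sign \<pi> *
      int (?Y \<sigma> \<tau> \<pi>)))"
  proof (intro sum.cong refl)
    fix \<sigma> \<tau> \<pi>
    have "(\<Sum>g\<in>?G. ?X \<sigma> \<tau> \<pi> g)
        = int (fact n * ?Y \<sigma> \<tau> \<pi>)"
      unfolding sum_perm_char_product[symmetric] by (simp only: of_nat_sum)
    then show "(\<Sum>g\<in>?G. sign \<sigma> * sign \<tau> * sign \<pi> *
        ?X \<sigma> \<tau> \<pi> g)
      = fact n * (sign \<sigma> * sign \<tau> * sign \<pi> *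
        int (?Y \<sigma> \<tau> \<pi>))"
      by (simp only: sum_distrib_left[symmetric]) simp
  qed
  also have "\<dots> = fact n * ?R" by (simp only: sum_distrib_left)
  finally show ?thesis by simp
qed

section \<open>Stable counts of three-dimensional tables\<close>

definition proj1 :: "(nat \<times> nat \<times> nat) multiset \<Rightarrow> nat multiset" where
  "proj1 M = image_mset fst M"
definition proj2 :: "(nat \<times> nat \<times> nat) multiset \<Rightarrow> nat multiset" where
  "proj2 M = image_mset fst (image_mset snd M)"
definition proj3 :: "(nat \<times> nat \<times> nat) multiset \<Rightarrow> nat multiset" where
  "proj3 M = image_mset snd (image_mset snd M)"

lemma proj_simps [simp]:
  "proj1 {#} = {#}" "proj2 {#} = {#}" "proj3 {#} = {#}"
  "proj1 (add_mset (x, y, z) M) = add_mset x (proj1 M)"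
  "proj2 (add_mset (x, y, z) M) = add_mset y (proj2 M)"
  "proj3 (add_mset (x, y, z) M) = add_mset z (proj3 M)"
  "proj1 (M + N) = proj1 M + proj1 N" "proj2 (M + N) = proj2 M + proj2 N" "proj3 (M + N) = proj3 M + proj3 N"
  "size (proj1 M) = size M" "size (proj2 M) = size M" "size (proj3 M) = size M"
  unfolding proj1_def proj2_def proj3_def by simp_all

lemma proj_replicate [simp]:
  "proj1 (replicate_mset k (x, y, z)) = replicate_mset k x"
  "proj2 (replicate_mset k (x, y, z)) = replicate_mset k y"
  "proj3 (replicate_mset k (x, y, z)) = replicate_mset k z"
  by (induction k) simp_all

definition margins :: "nat \<Rightarrow> nat \<Rightarrow> (nat \<Rightarrow> int) \<Rightarrow> (nat \<Rightarrow> int) \<Rightarrow> (nat \<Rightarrow> int) \<Rightarrow>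
    (nat \<times> nat \<times> nat) multiset \<Rightarrow> bool" where
  "margins lo l a b c M \<longleftrightarrow> (\<forall>i. lo \<le> i \<and> i < l \<longrightarrow>
     int (count (proj1 M) i) = a i \<and> int (count (proj2 M) i) = b i \<and> int (count (proj3 M) i) = c i)"

text \<open>A cell with all coordinates below \<open>lo\<close> is invisible to the margins from
  \<open>lo\<close> on and is left out to keep the sets of tables finite. For \<open>lo = 1\<close>
  only the corner is missing, and \<open>cells 1 2\<close> consists of the seven cells next to
  it.\<close>

definition cells :: "nat \<Rightarrow> nat \<Rightarrow> (nat \<times> nat \<times> nat) set" where
  "cells lo l = {(x, y, z). x < l \<and> y < l \<and> z < l \<and> (lo \<le> x \<or> lo \<le> y \<or> lo \<le> z)}"

definition tables :: "nat \<Rightarrow> nat \<Rightarrow> (nat \<Rightarrow> int) \<Rightarrow> (nat \<Rightarrow> int) \<Rightarrow> (nat \<Rightarrow> int) \<Rightarrow> (nat \<times> nat \<times> nat) multiset set" where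
  "tables lo l a b c = {M. set_mset M \<subseteq> cells lo l \<and> margins lo l a b c M}"

lemma cells_subset_cube: "cells lo l \<subseteq> cube l"
  unfolding cells_def cube_def by auto

lemma finite_cells: "finite (cells lo l)"
  using finite_subset[OF cells_subset_cube] unfolding cube_def by simp

lemma proj_set:
  assumes "set_mset M \<subseteq> cube l"
  shows "set_mset (proj1 M) \<subseteq> {..<l}" "set_mset (proj2 M) \<subseteq> {..<l}" "set_mset (proj3 M) \<subseteq> {..<l}"
  using assms unfolding proj1_def proj2_def proj3_def cube_def by auto

lemma sum_count_lessThan:
  fixes l :: nat
  assumes "set_mset N \<subseteq> {..<l}"
  shows "(\<Sum>i<l. count N i) = size N"
  unfolding size_multiset_overloaded_eq using assms
  by (intro sum.mono_neutral_right) (auto simp: not_in_iff)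

text \<open>Every cell has a coordinate of at least \<open>lo\<close>, so each unit of the table is
  counted in one of these margins. The bound yields both finiteness and room for the corner
  entry.\<close>

lemma size_le_margins:
  assumes "set_mset M \<subseteq> cells lo l"
  shows "size M \<le> (\<Sum>i=lo..<l. count (proj1 M) i + count (proj2 M) i + count (proj3 M) i)"
  using assms
proof (induction M)
  case (add x M)
  obtain u v w where x: "x = (u, v, w)" by (cases x) auto
  have cnt: "count (add_mset j N) i = count N i + (if i = j then 1 else 0)" for j i :: nat and N
    by simp
  have "(\<Sum>i=lo..<l. (if i = u then 1 else 0) + (if i = v then 1 else 0) + (if i = w then 1 else (0::nat))) \<ge> 1"
    using add.prems unfolding x cells_def by (auto simp: sum.distrib)
  then show ?case using add unfolding x by (simp add: cnt sum.distrib del: count_add_mset)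
qed simp

lemma tables_size_le:
  assumes "M \<in> tables lo l a b c"
  shows "int (size M) \<le> (\<Sum>i=lo..<l. a i + b i + c i)"
proof -
  have "int (size M) \<le> int (\<Sum>i=lo..<l. count (proj1 M) i + count (proj2 M) i + count (proj3 M) i)"
    using size_le_margins[of M lo l] assms unfolding tables_def by (simp only: of_nat_le_iff) simp
  also have "\<dots> = (\<Sum>i=lo..<l. a i + b i + c i)"
    unfolding of_nat_sum using assms unfolding tables_def margins_def by (intro sum.cong) auto
  finally show ?thesis .
qed

lemma finite_tables: "finite (tables lo l a b c)"
proof (rule finite_subset)
  show "tables lo l a b c \<subseteq> (\<Union>k\<le>nat (\<Sum>i=lo..<l. a i + b i + c i). msets_over (cells lo l) k)"
  proof
    fix M assume M: "M \<in> tables lo l a b c"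
    have "size M \<le> nat (\<Sum>i=lo..<l. a i + b i + c i)" using tables_size_le[OF M] by simp
    then show "M \<in> (\<Union>k\<le>nat (\<Sum>i=lo..<l. a i + b i + c i). msets_over (cells lo l) k)"
      using M unfolding tables_def msets_over_def by auto
  qed
qed (simp add: finite_msets_over finite_cells)

lemma cube_count_eq: "cube_count l n a b c = card {M\<in>msets_over (cube l) n. margins 0 l a b c M}"
  unfolding cube_count_def margins_def has_margin_def proj1_def proj2_def proj3_def
  by (rule arg_cong[of _ _ card]) auto

text \<open>For large \<open>n\<close> the entry in the corner \<open>(0, 0, 0)\<close> absorbs the dependence on \<open>n\<close>.\<close>

lemma cube_count_stable:
  assumes sums: "(\<Sum>i<l. a i) = int n" "(\<Sum>i<l. b i) = int n" "(\<Sum>i<l. c i) = int n"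
    and large: "(\<Sum>i=1..<l. a i + b i + c i) \<le> int n" and l: "0 < l"
  shows "cube_count l n a b c = card (tables 1 l a b c)"
proof -
  let ?z = "(0, 0, 0) :: nat \<times> nat \<times> nat"
  let ?f = "filter_mset (\<lambda>x. x \<noteq> ?z)"
  let ?S = "{M\<in>msets_over (cube l) n. margins 0 l a b c M}"
  have split: "replicate_mset (count M ?z) ?z + ?f M = M" for M
    using multiset_partition[of M "\<lambda>x. x = ?z"] by (simp add: filter_eq_replicate_mset)
  have cnt: "count (proj1 (?f M)) i = count (proj1 M) i"
    "count (proj2 (?f M)) i = count (proj2 M) i"
    "count (proj3 (?f M)) i = count (proj3 M) i" if "1 \<le> i" for i M
    using arg_cong[OF split[of M], of "\<lambda>M. count (proj1 M) i"] arg_cong[OF split[of M], of "\<lambda>M. count (proj2 M) i"]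
      arg_cong[OF split[of M], of "\<lambda>M. count (proj3 M) i"] that by simp_all
  \<comment> \<open>The margin at row 0 is determined by the total and the other margins, so it
    imposes no further condition.\<close>
  have zero: "int k = a0" if "(\<Sum>i<l. int (h i)) = (\<Sum>i<l. A i)" "\<And>i. 1 \<le> i \<Longrightarrow> i < l \<Longrightarrow> int (h i) = A i"
    "k = h 0" "a0 = A 0" for h :: "nat \<Rightarrow> nat" and A :: "nat \<Rightarrow> int" and k a0
  proof -
    have decomp: "(\<Sum>i<l. f i) = f 0 + (\<Sum>i=1..<l. f i)" for f :: "nat \<Rightarrow> int"
      using l by (simp add: lessThan_atLeast0 sum.atLeast_Suc_lessThan)
    have "(\<Sum>i=1..<l. int (h i)) = (\<Sum>i=1..<l. A i)" using that(2) by (intro sum.cong) auto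
    then show ?thesis using that(1,3,4) decomp[of "\<lambda>i. int (h i)"] decomp[of A] by simp
  qed
  have "bij_betw (?f) ?S (tables 1 l a b c)"
  \<comment> \<open>The inverse puts all missing units into the corner. The subtraction is exact
    because \<open>tables_size_le\<close> and \<open>large\<close> bound the size of
    \<open>M\<close> by \<open>n\<close>.\<close>
  proof (rule bij_betwI[where g = "\<lambda>M. replicate_mset (n - size M) ?z + M"])
    show "?f \<in> ?S \<rightarrow> tables 1 l a b c"
    proof
      fix M assume M: "M \<in> ?S"
      have "set_mset (?f M) \<subseteq> cells 1 l"
        using M unfolding msets_over_def cube_def cells_def by auto
      moreover have "margins 1 l a b c (?f M)"
        using M cnt unfolding margins_def by simp
      ultimately show "?f M \<in> tables 1 l a b c" unfolding tables_def by simp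
    qed
    show "(\<lambda>M. replicate_mset (n - size M) ?z + M) \<in> tables 1 l a b c \<rightarrow> ?S"
    proof
      fix M assume M: "M \<in> tables 1 l a b c"
      let ?N = "replicate_mset (n - size M) ?z + M"
      have "int (size M) \<le> int n" using tables_size_le[OF M] large by linarith
      then have size: "size ?N = n" by simp
      have sub: "set_mset ?N \<subseteq> cube l"
        using M l cells_subset_cube[of 1 l] unfolding tables_def by (auto simp: cube_def)
      have marg: "int (count (proj1 ?N) i) = a i" "int (count (proj2 ?N) i) = b i" "int (count (proj3 ?N) i) = c i"
        if "1 \<le> i" "i < l" for i
        using M that unfolding tables_def margins_def by simp_all
      have sum: "(\<Sum>i<l. int (count (proj1 ?N) i)) = int n" "(\<Sum>i<l. int (count (proj2 ?N) i)) = int n"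
        "(\<Sum>i<l. int (count (proj3 ?N) i)) = int n"
        unfolding of_nat_sum[symmetric] proj_set[OF sub, THEN sum_count_lessThan]
        by (simp_all only: proj_simps(10-12) size)
      have "int (count (proj1 ?N) 0) = a 0"
        by (rule zero[of "\<lambda>i. count (proj1 ?N) i" a]) (use sum(1) sums(1) marg in simp_all)
      moreover have "int (count (proj2 ?N) 0) = b 0"
        by (rule zero[of "\<lambda>i. count (proj2 ?N) i" b]) (use sum(2) sums(2) marg in simp_all)
      moreover have "int (count (proj3 ?N) 0) = c 0"
        by (rule zero[of "\<lambda>i. count (proj3 ?N) i" c]) (use sum(3) sums(3) marg in simp_all)
      ultimately have "margins 0 l a b c ?N"
        unfolding margins_def using marg by (metis less_one not_le)
      then show "?N \<in> ?S" using sub size unfolding msets_over_def by blast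
    qed
    show "replicate_mset (n - size (?f M)) ?z + ?f M = M"
      if "M \<in> ?S" for M
    proof -
      have "n = count M ?z + size (?f M)"
        using arg_cong[OF split[of M], of size] that unfolding msets_over_def by simp
      then show ?thesis using split[of M] by simp
    qed
    show "?f (replicate_mset (n - size M) ?z + M) = M" if "M \<in> tables 1 l a b c" for M
    proof -
      have "?f (replicate_mset k ?z) = {#}" for k by simp
      moreover have "?f M = M"
        using that unfolding tables_def cells_def by (auto simp: filter_mset_eq_conv)
      ultimately show ?thesis by (simp only: filter_union_mset empty_neutral)
    qed
  qed
  from bij_betw_same_card[OF this] show ?thesis unfolding cube_count_eq .
qed

section \<open>Tables on the seven cells next to the corner\<close>

definition corner_tables :: "(nat \<times> nat \<times> nat) set \<Rightarrow> int \<Rightarrow> int \<Rightarrow> int \<Rightarrow> (nat \<times> nat \<times> nat) multiset set" where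
  "corner_tables K a b c = {M. set_mset M \<subseteq> K \<and> int (count (proj1 M) 1) = a \<and>
     int (count (proj2 M) 1) = b \<and> int (count (proj3 M) 1) = c}"

definition corner_count :: "(nat \<times> nat \<times> nat) set \<Rightarrow> int \<Rightarrow> int \<Rightarrow> int \<Rightarrow> int" where
  "corner_count K a b c = int (card (corner_tables K a b c))"

lemma finite_corner_tables:
  assumes "K \<subseteq> cells 1 2"
  shows "finite (corner_tables K a b c)"
proof (rule finite_subset)
  show "corner_tables K a b c \<subseteq> tables 1 2 (\<lambda>_. a) (\<lambda>_. b) (\<lambda>_. c)"
  proof
    fix M assume M: "M \<in> corner_tables K a b c"
    have "1 \<le> i \<and> i < 2 \<longleftrightarrow> i = 1" for i :: nat by auto
    then show "M \<in> tables 1 2 (\<lambda>_. a) (\<lambda>_. b) (\<lambda>_. c)"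
      using M assms unfolding corner_tables_def tables_def margins_def by simp blast
  qed
qed (rule finite_tables)

text \<open>Margins from row 2 on see only cells with a coordinate of at least 2, so the part R on
  these cells ranges over a finite set that does not involve the margins at 1. The seven cells have
  to supply what R leaves of the margins at 1; a negative rest gives the count 0.\<close>

lemma card_tables_split:
  assumes l: "2 \<le> l"
  shows "int (card (tables 1 l a b c)) = (\<Sum>R\<in>tables 2 l a b c.
    corner_count (cells 1 2) (a 1 - int (count (proj1 R) 1)) (b 1 - int (count (proj2 R) 1)) (c 1 - int (count (proj3 R) 1)))"
proof -
  let ?B = "\<lambda>R. corner_tables (cells 1 2) (a 1 - int (count (proj1 R) 1)) (b 1 - int (count (proj2 R) 1)) (c 1 - int (count (proj3 R) 1))"
  let ?in = "filter_mset (\<lambda>x. x \<in> cells 2 l)" and ?out = "filter_mset (\<lambda>x. x \<notin> cells 2 l)"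
  let ?S = "SIGMA R:tables 2 l a b c. ?B R"
  have small: "count (proj1 M) i = 0" "count (proj2 M) i = 0" "count (proj3 M) i = 0"
    if "set_mset M \<subseteq> cells 1 2" "2 \<le> i" for M i
  proof -
    have "set_mset M \<subseteq> cube 2" using that(1) cells_subset_cube by blast
    from proj_set[OF this] that(2)
    show "count (proj1 M) i = 0" "count (proj2 M) i = 0" "count (proj3 M) i = 0"
      by (auto simp: count_eq_zero_iff)
  qed
  have split: "?in M + ?out M = M" for M
    by (rule multiset_partition[symmetric])
  have cnt: "count (proj1 M) i = count (proj1 (?in M)) i + count (proj1 (?out M)) i"
    "count (proj2 M) i = count (proj2 (?in M)) i + count (proj2 (?out M)) i"
    "count (proj3 M) i = count (proj3 (?in M)) i + count (proj3 (?out M)) i"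
    for M i
    by (metis split proj_simps(7) count_union, metis split proj_simps(8) count_union, metis split proj_simps(9) count_union)
  have disj: "x \<notin> cells 2 l" if "x \<in> cells 1 2" for x using that unfolding cells_def by auto
  have "bij_betw (\<lambda>M. (?in M, ?out M)) (tables 1 l a b c) ?S"
  proof (rule bij_betwI[where g = "\<lambda>(R, B). R + B"])
    show "(\<lambda>M. (?in M, ?out M)) \<in> tables 1 l a b c \<rightarrow> ?S"
    proof
      fix M assume M: "M \<in> tables 1 l a b c"
      let ?R = "?in M" and ?C = "?out M"
      have C: "set_mset ?C \<subseteq> cells 1 2" using M unfolding tables_def cells_def by auto
      have marg: "int (count (proj1 M) i) = a i" "int (count (proj2 M) i) = b i" "int (count (proj3 M) i) = c i"
        if "1 \<le> i" "i < l" for i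
        using M that unfolding tables_def margins_def by simp_all
      have "margins 2 l a b c ?R"
        unfolding margins_def
      proof (intro allI impI)
        fix i assume "2 \<le> i \<and> i < l"
        then show "int (count (proj1 ?R) i) = a i \<and> int (count (proj2 ?R) i) = b i \<and> int (count (proj3 ?R) i) = c i"
          using marg[of i] cnt[of M i] small[OF C, of i] by simp
      qed
      then have "?R \<in> tables 2 l a b c" unfolding tables_def by auto
      moreover have "?C \<in> ?B ?R"
        unfolding corner_tables_def using C marg[of 1] cnt[of M 1] l by simp
      ultimately show "(?R, ?C) \<in> ?S" by blast
    qed
    show "(\<lambda>(R, B). R + B) \<in> ?S \<rightarrow> tables 1 l a b c"
    proof clarify
      fix R B assume R: "R \<in> tables 2 l a b c" and B: "B \<in> ?B R"
      have "set_mset B \<subseteq> cells 1 2" using B unfolding corner_tables_def by simp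
      note sm = small[OF this]
      have sub: "set_mset (R + B) \<subseteq> cells 1 l"
        using R B l unfolding tables_def corner_tables_def cells_def by fastforce
      have "int (count (proj1 (R + B)) i) = a i \<and> int (count (proj2 (R + B)) i) = b i \<and> int (count (proj3 (R + B)) i) = c i"
        if i: "1 \<le> i" "i < l" for i
      proof (cases "i = 1")
        case True
        then show ?thesis using B unfolding corner_tables_def by simp
      next
        case False
        then have "2 \<le> i" using i by simp
        then show ?thesis using R i sm[of i] unfolding tables_def margins_def by simp
      qed
      then show "R + B \<in> tables 1 l a b c" using sub unfolding tables_def margins_def by blast
    qed
    show "(\<lambda>(R, B). R + B) (?in M, ?out M) = M" for M
      using split by simp
    show "(?in ((\<lambda>(R, B). R + B) RB), ?out ((\<lambda>(R, B). R + B) RB)) = RB"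
      if "RB \<in> ?S" for RB
    proof -
      obtain R B where RB: "RB = (R, B)" by (cases RB)
      have R: "set_mset R \<subseteq> cells 2 l" and B: "set_mset B \<subseteq> cells 1 2"
        using that unfolding RB tables_def corner_tables_def by auto
      have "?in R = R" "?out R = {#}"
        "?in B = {#}" "?out B = B"
        using R B disj by (auto simp: filter_mset_eq_conv filter_mset_eq_mempty_iff)
      then show ?thesis unfolding RB by simp
    qed
  qed
  then have "card (tables 1 l a b c) = card ?S" by (rule bij_betw_same_card)
  also have "\<dots> = (\<Sum>R\<in>tables 2 l a b c. card (?B R))"
    by (rule card_SigmaI) (auto simp: finite_tables finite_corner_tables)
  finally show ?thesis unfolding corner_count_def by simp
qed

text \<open>A table either avoids the cell or arises by adding one unit to it, and the smaller table
  then has margins lowered by (x, y, z). In generating functions this cancels the factor 1 / (1 -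
  X^x Y^y Z^z).\<close>

lemma corner_count_remove:
  assumes K: "insert (x, y, z) K \<subseteq> cells 1 2" and k: "(x, y, z) \<notin> K"
  shows "corner_count (insert (x, y, z) K) a b c
      - corner_count (insert (x, y, z) K) (a - int x) (b - int y) (c - int z) = corner_count K a b c"
proof -
  let ?k = "(x, y, z)"
  let ?A = "corner_tables (insert ?k K) a b c"
  let ?B = "corner_tables (insert ?k K) (a - int x) (b - int y) (c - int z)"
  let ?C = "corner_tables K a b c"
  have xyz: "x < 2" "y < 2" "z < 2" using K unfolding cells_def by auto
  have add_iff: "add_mset ?k M \<in> ?A \<longleftrightarrow> M \<in> ?B" for M
  proof -
    \<comment> \<open>As coordinates are 0 or 1, a unit in the cell adds exactly its coordinates to
      the margins at 1.\<close>
    have "x = 0 \<or> x = 1" "y = 0 \<or> y = 1" "z = 0 \<or> z = 1" using xyz by auto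
    then show ?thesis by (elim disjE) (auto simp: corner_tables_def)
  qed
  have "?A = ?C \<union> add_mset ?k ` ?B"
  proof
    show "?A \<subseteq> ?C \<union> add_mset ?k ` ?B"
    proof
      fix M assume M: "M \<in> ?A"
      show "M \<in> ?C \<union> add_mset ?k ` ?B"
      proof (cases "?k \<in># M")
        case True
        then obtain N where "M = add_mset ?k N" by (metis multi_member_split)
        then show ?thesis using M add_iff by blast
      next
        case False
        then show ?thesis using M unfolding corner_tables_def by auto
      qed
    qed
    show "?C \<union> add_mset ?k ` ?B \<subseteq> ?A"
    proof -
      have "?C \<subseteq> ?A" unfolding corner_tables_def by auto
      then show ?thesis using add_iff by blast
    qed
  qed
  moreover have "?C \<inter> add_mset ?k ` ?B = {}" using k unfolding corner_tables_def by auto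
  moreover have "finite ?C" "finite ?B" using finite_corner_tables K by auto
  ultimately have "card ?A = card ?C + card (add_mset ?k ` ?B)"
    by (simp add: card_Un_disjoint)
  also have "card (add_mset ?k ` ?B) = card ?B" by (rule card_image) (simp add: inj_on_def)
  finally show ?thesis unfolding corner_count_def by simp
qed

definition core_cells :: "(nat \<times> nat \<times> nat) set" where
  "core_cells = {(1, 1, 0), (1, 0, 1), (0, 1, 1), (1, 1, 1)}"

text \<open>Counts solutions of \<open>a = p + q + s\<close>, \<open>b = p + r + s\<close>, \<open>c = q + r + s\<close>;
  the free parameter is \<open>r\<close>, since \<open>b + c - a = 2 r + s\<close>.\<close>

lemma core_count:
  assumes "b \<le> a" "c \<le> a" "0 \<le> b + c - a"
  shows "corner_count core_cells a b c = (b + c - a) div 2 + 1"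
proof -
  define u where "u = (\<lambda>p q r s. replicate_mset p (1::nat, 1::nat, 0::nat) + replicate_mset q (1, 0, 1)
    + replicate_mset r (0, 1, 1) + replicate_mset s (1, 1, 1))"
  \<comment> \<open>Solving the three equations for given \<open>r\<close> yields p = a - c + r, q =
    a - b + r and s = b + c - a - 2 r. The first two are nonnegative because a is at least b and c;
    the last one bounds \<open>r\<close>.\<close>
  define t where "t = (\<lambda>r. u (nat (a - c) + r) (nat (a - b) + r) r (nat (b + c - a) - 2 * r))"
  have proj_u: "count (proj1 (u p q r s)) 1 = p + q + s" "count (proj2 (u p q r s)) 1 = p + r + s"
    "count (proj3 (u p q r s)) 1 = q + r + s" for p q r s
    unfolding u_def by simp_all
  have core: "\<exists>p q s. M = u p q (count M (0, 1, 1)) s" if M: "set_mset M \<subseteq> core_cells" for M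
  proof (intro exI multiset_eqI)
    fix x
    show "count M x = count (u (count M (1, 1, 0)) (count M (1, 0, 1)) (count M (0, 1, 1)) (count M (1, 1, 1))) x"
    proof (cases "x \<in> core_cells")
      case True
      then show ?thesis unfolding core_cells_def u_def by auto
    next
      case False
      then have "count M x = 0" using M by (auto simp: count_eq_zero_iff)
      then show ?thesis using False unfolding core_cells_def u_def by auto
    qed
  qed
  have bij: "bij_betw t {0..nat ((b + c - a) div 2)} (corner_tables core_cells a b c)"
  proof (rule bij_betwI[where g = "\<lambda>M. count M (0, 1, 1)"])
    show "t \<in> {0..nat ((b + c - a) div 2)} \<rightarrow> corner_tables core_cells a b c"
    proof
      fix r assume "r \<in> {0..nat ((b + c - a) div 2)}"
      then have r: "2 * int r \<le> b + c - a" using assms(3) by auto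
      have "set_mset (t r) \<subseteq> core_cells" unfolding t_def u_def core_cells_def by auto
      moreover have "int (count (proj1 (t r)) 1) = a" "int (count (proj2 (t r)) 1) = b" "int (count (proj3 (t r)) 1) = c"
        unfolding t_def proj_u using assms r by auto
      ultimately show "t r \<in> corner_tables core_cells a b c" unfolding corner_tables_def by simp
    qed
    have sol: "2 * int (count M (0, 1, 1)) \<le> b + c - a \<and> t (count M (0, 1, 1)) = M"
      if M: "M \<in> corner_tables core_cells a b c" for M
    proof -
      define r where "r = count M (0, 1, 1)"
      obtain p q s where u: "M = u p q r s"
        using core[of M] M unfolding corner_tables_def r_def by auto
      have "a = int (p + q + s)" "b = int (p + r + s)" "c = int (q + r + s)"
        using M proj_u[of p q r s] unfolding corner_tables_def u by simp_all
      then have le: "2 * int r \<le> b + c - a" and "p = nat (a - c) + r" "q = nat (a - b) + r" "s = nat (b + c - a) - 2 * r"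
        using assms by auto
      then have "t r = M" unfolding t_def u by simp
      then show ?thesis using le unfolding r_def by simp
    qed
    show "(\<lambda>M. count M (0, 1, 1)) \<in> corner_tables core_cells a b c \<rightarrow> {0..nat ((b + c - a) div 2)}"
    proof
      fix M assume "M \<in> corner_tables core_cells a b c"
      then have "2 * int (count M (0, 1, 1)) \<le> b + c - a" using sol by blast
      then show "count M (0, 1, 1) \<in> {0..nat ((b + c - a) div 2)}" using assms(3) by auto
    qed
    show "count (t r) (0, 1, 1) = r" for r unfolding t_def u_def by simp
    show "t (count M (0, 1, 1)) = M" if "M \<in> corner_tables core_cells a b c" for M
      using sol[OF that] by simp
  qed
  have "card (corner_tables core_cells a b c) = nat ((b + c - a) div 2) + 1"
    using bij_betw_same_card[OF bij] by simp
  then show ?thesis unfolding corner_count_def using assms(3) by simp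
qed

text \<open>In terms of generating functions: multiplication by \<open>(1 - x) (1 - y) (1 - z)\<close> cancels the factors
  of the cells \<open>(1, 0, 0)\<close>, \<open>(0, 1, 0)\<close> and \<open>(0, 0, 1)\<close>.\<close>

lemma corner_count_difference:
  defines "K \<equiv> cells 1 2"
  shows "corner_count K a b c - corner_count K (a - 1) b c
      - (corner_count K a (b - 1) c - corner_count K (a - 1) (b - 1) c)
      - (corner_count K a b (c - 1) - corner_count K (a - 1) b (c - 1)
      - (corner_count K a (b - 1) (c - 1) - corner_count K (a - 1) (b - 1) (c - 1)))
    = corner_count core_cells a b c"
proof -
  let ?K1 = "insert (0, 1, 0) (insert (0, 0, 1) core_cells)" and ?K2 = "insert (0, 0, 1) core_cells"
  have K: "K = insert (1, 0, 0) ?K1"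
    unfolding K_def cells_def core_cells_def by (auto simp: less_2_cases_iff)
  have 1: "corner_count K a b c - corner_count K (a - 1) b c = corner_count ?K1 a b c" for a b c
    using corner_count_remove[of 1 0 0 ?K1 a b c] unfolding K
    by (simp add: core_cells_def cells_def)
  have 2: "corner_count ?K1 a b c - corner_count ?K1 a (b - 1) c = corner_count ?K2 a b c" for a b c
    using corner_count_remove[of 0 1 0 ?K2 a b c]
    by (simp add: core_cells_def cells_def)
  have 3: "corner_count ?K2 a b c - corner_count ?K2 a b (c - 1) = corner_count core_cells a b c" for a b c
    using corner_count_remove[of 0 0 1 core_cells a b c]
    by (simp add: core_cells_def cells_def)
  show ?thesis unfolding 1 2 3 ..
qed

section \<open>Quasi-linear functions\<close>

text \<open>The parity condition on \<open>A - C\<close> keeps \<open>B\<close> integral under shifts of odd total weight.\<close>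

definition quasi_linear :: "(int \<Rightarrow> int \<Rightarrow> int \<Rightarrow> int) \<Rightarrow> bool" where
  "quasi_linear h \<longleftrightarrow> (\<exists>k1 k2 k3 A B C. even (A - C) \<and> (\<forall>a b c. a - b \<ge> k1 \<longrightarrow> a - c \<ge> k2 \<longrightarrow> b + c - a \<ge> k3 \<longrightarrow>
     2 * h a b c = A * (b + c - a) + 2 * B - (if even (b + c - a) then 0 else C)))"

lemma quasi_linear_zero: "quasi_linear (\<lambda>a b c. 0)"
  unfolding quasi_linear_def by (intro exI[of _ 0]) simp

lemma quasi_linear_add:
  assumes "quasi_linear h" "quasi_linear h'"
  shows "quasi_linear (\<lambda>a b c. h a b c + h' a b c)"
proof -
  from assms(1) obtain k1 k2 k3 A B C where 1: "even (A - C)"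
    "\<And>a b c. a - b \<ge> k1 \<Longrightarrow> a - c \<ge> k2 \<Longrightarrow> b + c - a \<ge> k3 \<Longrightarrow>
     2 * h a b c = A * (b + c - a) + 2 * B - (if even (b + c - a) then 0 else C)"
    unfolding quasi_linear_def by metis
  from assms(2) obtain l1 l2 l3 A' B' C' where 2: "even (A' - C')"
    "\<And>a b c. a - b \<ge> l1 \<Longrightarrow> a - c \<ge> l2 \<Longrightarrow> b + c - a \<ge> l3 \<Longrightarrow>
     2 * h' a b c = A' * (b + c - a) + 2 * B' - (if even (b + c - a) then 0 else C')"
    unfolding quasi_linear_def by metis
  show ?thesis unfolding quasi_linear_def
  proof (intro exI conjI allI impI)
    show "even ((A + A') - (C + C'))" using 1(1) 2(1) by presburger
    fix a b c assume "max k1 l1 \<le> a - b" "max k2 l2 \<le> a - c" "max k3 l3 \<le> b + c - a"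
    then show "2 * (h a b c + h' a b c) = (A + A') * (b + c - a) + 2 * (B + B') - (if even (b + c - a) then 0 else C + C')"
      using 1(2)[of a b c] 2(2)[of a b c] by (simp add: distrib_right distrib_left)
  qed
qed

lemma quasi_linear_cmult:
  assumes "quasi_linear h"
  shows "quasi_linear (\<lambda>a b c. m * h a b c)"
proof -
  from assms obtain k1 k2 k3 A B C where 1: "even (A - C)"
    "\<And>a b c. a - b \<ge> k1 \<Longrightarrow> a - c \<ge> k2 \<Longrightarrow> b + c - a \<ge> k3 \<Longrightarrow>
     2 * h a b c = A * (b + c - a) + 2 * B - (if even (b + c - a) then 0 else C)"
    unfolding quasi_linear_def by metis
  show ?thesis unfolding quasi_linear_def
  proof (intro exI conjI allI impI)
    show "even (m * A - m * C)" using 1(1) by (simp flip: right_diff_distrib)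
    fix a b c assume "k1 \<le> a - b" "k2 \<le> a - c" "k3 \<le> b + c - a"
    from arg_cong[OF 1(2)[OF this], of "\<lambda>t. m * t"]
    show "2 * (m * h a b c) = (m * A) * (b + c - a) + 2 * (m * B) - (if even (b + c - a) then 0 else m * C)"
      by (cases "even (b + c - a)") (simp_all only: if_True if_False, simp_all add: algebra_simps)
  qed
qed

lemma quasi_linear_sum:
  "(\<And>i. i \<in> I \<Longrightarrow> quasi_linear (h i)) \<Longrightarrow> quasi_linear (\<lambda>a b c. \<Sum>i\<in>I. h i a b c)"
  by (induction I rule: infinite_finite_induct) (simp_all add: quasi_linear_zero quasi_linear_add)

text \<open>A shift adds d = v + w - u to b + c - a. For even d only B changes. For odd d the parity
  classes trade places: C becomes -C and (A d - C) / 2 is added to B, an integer since A and C have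
  the same parity.\<close>

lemma quasi_linear_shift:
  assumes "quasi_linear h"
  shows "quasi_linear (\<lambda>a b c. h (a + u) (b + v) (c + w))"
proof -
  from assms obtain k1 k2 k3 A B C where 1: "even (A - C)"
    "\<And>a b c. a - b \<ge> k1 \<Longrightarrow> a - c \<ge> k2 \<Longrightarrow> b + c - a \<ge> k3 \<Longrightarrow>
     2 * h a b c = A * (b + c - a) + 2 * B - (if even (b + c - a) then 0 else C)"
    unfolding quasi_linear_def by metis
  define d where "d = v + w - u"
  have val: "2 * h (a + u) (b + v) (c + w) = A * (b + c - a) + A * d + 2 * B - (if even (b + c - a + d) then 0 else C)"
    if "k1 - u + v \<le> a - b" "k2 - u + w \<le> a - c" "k3 - d \<le> b + c - a" for a b c
  proof -
    have "b + v + (c + w) - (a + u) = b + c - a + d" unfolding d_def by simp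
    then show ?thesis using 1(2)[of "a + u" "b + v" "c + w"] that unfolding d_def
      by (simp add: algebra_simps)
  qed
  show ?thesis
  proof (cases "even d")
    case True
    then have "2 * (d div 2) = d" by simp
    then have d: "2 * (A * (d div 2)) = A * d" by (metis mult.left_commute)
    show ?thesis unfolding quasi_linear_def
    proof (intro exI conjI allI impI)
      show "even (A - C)" by (rule 1(1))
      fix a b c assume "k1 - u + v \<le> a - b" "k2 - u + w \<le> a - c" "k3 - d \<le> b + c - a"
      from val[OF this] show "2 * h (a + u) (b + v) (c + w)
          = A * (b + c - a) + 2 * (B + A * (d div 2)) - (if even (b + c - a) then 0 else C)"
        using True d by simp
    qed
  next
    case False
    have "even (A * d - C)" using 1(1) False by simp
    then have d: "2 * ((A * d - C) div 2) = A * d - C" by simp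
    show ?thesis unfolding quasi_linear_def
    proof (intro exI conjI allI impI)
      show "even (A - (- C))" using 1(1) by simp
      fix a b c assume "k1 - u + v \<le> a - b" "k2 - u + w \<le> a - c" "k3 - d \<le> b + c - a"
      from val[OF this] show "2 * h (a + u) (b + v) (c + w)
          = A * (b + c - a) + 2 * (B + (A * d - C) div 2) - (if even (b + c - a) then 0 else - C)"
        using False d by simp
    qed
  qed
qed

text \<open>Twice the floor of N / 2 is N minus its parity, so A = B = C = 1.\<close>

lemma quasi_linear_core: "quasi_linear (corner_count core_cells)"
  unfolding quasi_linear_def
proof (intro exI conjI allI impI)
  show "even (1 - 1 :: int)" by simp
  fix a b c :: int assume "0 \<le> a - b" "0 \<le> a - c" "0 \<le> b + c - a"
  then have "corner_count core_cells a b c = (b + c - a) div 2 + 1" by (intro core_count) simp_all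
  then show "2 * corner_count core_cells a b c = 1 * (b + c - a) + 2 * 1 - (if even (b + c - a) then 0 else 1)"
    by presburger
qed

section \<open>Antisymmetrisation in the two largest rows\<close>

lemma int_telescope:
  fixes h :: "int \<Rightarrow> int"
  assumes "u \<le> v"
  shows "(\<Sum>x=u+1..v. h x - h (x - 1)) = h v - h u"
  using assms
proof (induction v rule: int_ge_induct)
  case (step v)
  have "{u+1..v+1} = insert (v + 1) {u+1..v}" using step.hyps by auto
  then show ?case using step.IH by simp
qed simp

text \<open>Pairs \<open>\<sigma>\<close> with \<open>\<sigma> \<circ> (0 1)\<close>.\<close>

lemma sum_sign_pair:
  assumes l: "2 \<le> l"
    and inv: "\<And>\<sigma>. \<sigma> permutes {..<l} \<Longrightarrow> H (\<sigma> \<circ> Transposition.transpose 0 1) = H \<sigma>"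
  shows "(\<Sum>\<sigma> | \<sigma> permutes {..<l}. sign \<sigma> * H \<sigma> (int (\<sigma> 1)))
    = (\<Sum>\<sigma> | \<sigma> permutes {..<l} \<and> \<sigma> 0 < \<sigma> 1. sign \<sigma> * (\<Sum>x=int (\<sigma> 0)+1..int (\<sigma> 1). H \<sigma> x - H \<sigma> (x - 1)))"
proof -
  let ?s = "Transposition.transpose 0 1 :: nat \<Rightarrow> nat"
  let ?P = "{\<sigma>. \<sigma> permutes {..<l} \<and> \<sigma> 0 < \<sigma> 1}" and ?N = "{\<sigma>. \<sigma> permutes {..<l} \<and> \<sigma> 1 < \<sigma> 0}"
  have s: "?s permutes {..<l}" using l by (intro permutes_swap_id) auto
  have ss: "\<sigma> \<circ> ?s \<circ> ?s = \<sigma>" for \<sigma> :: "nat \<Rightarrow> nat" by (simp add: comp_assoc)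
  have fin: "finite ?P" "finite ?N" using finite_permutations[of "{..<l}"] by auto
  have un: "{\<sigma>. \<sigma> permutes {..<l}} = ?P \<union> ?N"
  proof -
    have "\<sigma> 0 \<noteq> \<sigma> 1" if "\<sigma> permutes {..<l}" for \<sigma> :: "nat \<Rightarrow> nat"
      using permutes_inj[OF that] by (auto dest: injD)
    then show ?thesis by (auto simp: neq_iff)
  qed
  have disj: "?P \<inter> ?N = {}" by auto
  have "(\<Sum>\<sigma> | \<sigma> permutes {..<l}. sign \<sigma> * H \<sigma> (int (\<sigma> 1)))
      = (\<Sum>\<sigma>\<in>?P. sign \<sigma> * H \<sigma> (int (\<sigma> 1))) + (\<Sum>\<sigma>\<in>?N. sign \<sigma> * H \<sigma> (int (\<sigma> 1)))"
    unfolding un by (rule sum.union_disjoint[OF fin disj])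
  also have "(\<Sum>\<sigma>\<in>?N. sign \<sigma> * H \<sigma> (int (\<sigma> 1))) = (\<Sum>\<sigma>\<in>?P. sign (\<sigma> \<circ> ?s) * H (\<sigma> \<circ> ?s) (int ((\<sigma> \<circ> ?s) 1)))"
    by (rule sum.reindex_bij_witness[where i = "\<lambda>\<sigma>. \<sigma> \<circ> ?s" and j = "\<lambda>\<sigma>. \<sigma> \<circ> ?s"])
      (auto simp: ss[unfolded One_nat_def] permutes_compose[OF s[unfolded One_nat_def]])
  also have "\<dots> = (\<Sum>\<sigma>\<in>?P. - (sign \<sigma> * H \<sigma> (int (\<sigma> 0))))"
  proof (intro sum.cong refl)
    fix \<sigma> assume "\<sigma> \<in> ?P"
    then have \<sigma>: "\<sigma> permutes {..<l}" by simp
    have "permutation \<sigma>" "permutation ?s" using permutes_imp_permutation[OF _ \<sigma>] permutes_imp_permutation[OF _ s] by auto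
    then have "sign (\<sigma> \<circ> ?s) = - sign \<sigma>" by (simp add: sign_compose sign_swap_id)
    then show "sign (\<sigma> \<circ> ?s) * H (\<sigma> \<circ> ?s) (int ((\<sigma> \<circ> ?s) 1)) = - (sign \<sigma> * H \<sigma> (int (\<sigma> 0)))"
      using inv[OF \<sigma>] by simp
  qed
  finally have "(\<Sum>\<sigma> | \<sigma> permutes {..<l}. sign \<sigma> * H \<sigma> (int (\<sigma> 1)))
      = (\<Sum>\<sigma>\<in>?P. sign \<sigma> * (H \<sigma> (int (\<sigma> 1)) - H \<sigma> (int (\<sigma> 0))))"
    by (simp add: sum_negf sum_subtractf right_diff_distrib)
  \<comment> \<open>The difference is written in unit steps because each backward difference of step
    1 removes one cell from the corner count.\<close>
  also have "\<dots> = (\<Sum>\<sigma>\<in>?P. sign \<sigma> * (\<Sum>x=int (\<sigma> 0)+1..int (\<sigma> 1). H \<sigma> x - H \<sigma> (x - 1)))"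
    by (intro sum.cong refl) (simp add: int_telescope)
  finally show ?thesis .
qed

text \<open>Rows from 2 on of a padded (a, \<alpha>) are the parts of \<alpha> moved by two places,
  so these margins depend on neither a nor n. The formula is meant for i >= 2, where the subtraction
  is exact.\<close>

definition tail_margin :: "(nat \<Rightarrow> nat) \<Rightarrow> (nat \<Rightarrow> nat) \<Rightarrow> nat \<Rightarrow> int" where
  "tail_margin \<alpha> \<sigma> i = int (\<alpha> (i - 2)) + int (\<sigma> i) - int i"

lemma tail_margin_swap: "2 \<le> i \<Longrightarrow> tail_margin \<alpha> (\<sigma> \<circ> Transposition.transpose 0 1) i = tail_margin \<alpha> \<sigma> i"
  by (simp add: tail_margin_def Transposition.transpose_def)

lemma tables_cong:
  assumes "\<And>i. lo \<le> i \<Longrightarrow> i < l \<Longrightarrow> a i = a' i \<and> b i = b' i \<and> c i = c' i"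
  shows "tables lo l a b c = tables lo l a' b' c'"
  unfolding tables_def margins_def using assms by auto

text \<open>The eventual value of the Kronecker coefficient of \<open>(a, \<alpha>)[n]\<close>, \<open>(b, \<beta>)[n]\<close>, \<open>(c, \<gamma>)[n]\<close>.\<close>

definition stable_value ::
  "nat \<Rightarrow> (nat \<Rightarrow> nat) \<Rightarrow> (nat \<Rightarrow> nat) \<Rightarrow> (nat \<Rightarrow> nat) \<Rightarrow> int \<Rightarrow> int \<Rightarrow> int \<Rightarrow> int" where
  "stable_value l \<alpha> \<beta> \<gamma> a b c =
    (\<Sum>\<sigma> | \<sigma> permutes {..<l}. sign \<sigma> * (\<Sum>\<tau> | \<tau> permutes {..<l}. sign \<tau> * (\<Sum>\<pi> | \<pi> permutes {..<l}. sign \<pi> *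
      (\<Sum>R\<in>tables 2 l (tail_margin \<alpha> \<sigma>) (tail_margin \<beta> \<tau>) (tail_margin \<gamma> \<pi>).
         corner_count (cells 1 2) (a + int (\<sigma> 1) - 1 - int (count (proj1 R) 1))
           (b + int (\<tau> 1) - 1 - int (count (proj2 R) 1)) (c + int (\<pi> 1) - 1 - int (count (proj3 R) 1))))))"

text \<open>Composing with the swap of 0 and 1 leaves the tail margins and hence the range of R
  unchanged, so \<open>sum_sign_pair\<close> applies to each of the three sums. The unit steps form
  one backward difference in each of a, b and c, which reduces the seven cells to the core; a finite
  integer combination of shifts of one quasi-linear function remains.\<close>

lemma quasi_linear_stable_value:
  assumes l: "2 \<le> l"
  shows "quasi_linear (stable_value l \<alpha> \<beta> \<gamma>)"
proof -
  let ?P = "{p. p permutes {..<l}}" and ?Q = "{p. p permutes {..<l} \<and> p 0 < p 1}"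
  define T where "T = (\<lambda>\<sigma> \<tau> \<pi>. tables 2 l (tail_margin \<alpha> \<sigma>) (tail_margin \<beta> \<tau>) (tail_margin \<gamma> \<pi>))"
  let ?s = "Transposition.transpose 0 1 :: nat \<Rightarrow> nat"
  have T: "T (\<sigma> \<circ> ?s) \<tau> \<pi> = T \<sigma> \<tau> \<pi>" "T \<sigma> (\<tau> \<circ> ?s) \<pi> = T \<sigma> \<tau> \<pi>" "T \<sigma> \<tau> (\<pi> \<circ> ?s) = T \<sigma> \<tau> \<pi>" for \<sigma> \<tau> \<pi>
    unfolding T_def by (auto intro!: tables_cong simp: tail_margin_swap[unfolded One_nat_def])
  note T = T[unfolded One_nat_def]
  define t where "t = corner_count (cells 1 2)"
  define e where "e = (\<lambda>R a b c x y z. t (a + x - 1 - int (count (proj1 R) 1))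
           (b + y - 1 - int (count (proj2 R) 1)) (c + z - 1 - int (count (proj3 R) 1)))"
  \<comment> \<open>The variables \<open>x\<close>, \<open>y\<close>, \<open>z\<close> enter
    \<open>e\<close> only through a + x, b + y and c + z, so differences in them are differences in
    the margins.\<close>
  define e1 where "e1 = (\<lambda>R a b c x y z. e R a b c x y z - e R a b c (x - 1) y z)"
  define e2 where "e2 = (\<lambda>R a b c x y z. e1 R a b c x y z - e1 R a b c x (y - 1) z)"
  define e3 where "e3 = (\<lambda>R a b c x y z. e2 R a b c x y z - e2 R a b c x y (z - 1))"
  have e3: "e3 R a b c x y z = corner_count core_cells (a + (x - 1 - int (count (proj1 R) 1)))
      (b + (y - 1 - int (count (proj2 R) 1))) (c + (z - 1 - int (count (proj3 R) 1)))" for R a b c x y z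
    unfolding corner_count_difference[symmetric] e3_def e2_def e1_def e_def t_def
    by (simp add: algebra_simps)
  have "stable_value l \<alpha> \<beta> \<gamma> a b c = (\<Sum>\<sigma>\<in>?Q. sign \<sigma> * (\<Sum>x=int (\<sigma> 0)+1..int (\<sigma> 1).
      \<Sum>\<tau>\<in>?Q. sign \<tau> * (\<Sum>y=int (\<tau> 0)+1..int (\<tau> 1).
      \<Sum>\<pi>\<in>?Q. sign \<pi> * (\<Sum>z=int (\<pi> 0)+1..int (\<pi> 1). \<Sum>R\<in>T \<sigma> \<tau> \<pi>. e3 R a b c x y z))))" for a b c
  proof -
    have third: "(\<Sum>\<pi>\<in>?P. sign \<pi> * (\<Sum>R\<in>T \<sigma> \<tau> \<pi>. e2 R a b c x y (int (\<pi> 1))))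
        = (\<Sum>\<pi>\<in>?Q. sign \<pi> * (\<Sum>z=int (\<pi> 0)+1..int (\<pi> 1). \<Sum>R\<in>T \<sigma> \<tau> \<pi>. e3 R a b c x y z))" for \<sigma> \<tau> x y
      using sum_sign_pair[OF l, of "\<lambda>\<pi> z. \<Sum>R\<in>T \<sigma> \<tau> \<pi>. e2 R a b c x y z"]
      by (simp add: T e3_def flip: sum_subtractf)
    have second: "(\<Sum>\<tau>\<in>?P. sign \<tau> * (\<Sum>\<pi>\<in>?P. sign \<pi> * (\<Sum>R\<in>T \<sigma> \<tau> \<pi>. e1 R a b c x (int (\<tau> 1)) (int (\<pi> 1)))))
        = (\<Sum>\<tau>\<in>?Q. sign \<tau> * (\<Sum>y=int (\<tau> 0)+1..int (\<tau> 1).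
            \<Sum>\<pi>\<in>?P. sign \<pi> * (\<Sum>R\<in>T \<sigma> \<tau> \<pi>. e2 R a b c x y (int (\<pi> 1)))))" for \<sigma> x
      using sum_sign_pair[OF l, of "\<lambda>\<tau> y. \<Sum>\<pi>\<in>?P. sign \<pi> * (\<Sum>R\<in>T \<sigma> \<tau> \<pi>. e1 R a b c x y (int (\<pi> 1)))"]
      by (simp add: T e2_def flip: sum_subtractf right_diff_distrib)
    have first: "(\<Sum>\<sigma>\<in>?P. sign \<sigma> * (\<Sum>\<tau>\<in>?P. sign \<tau> * (\<Sum>\<pi>\<in>?P. sign \<pi> *
          (\<Sum>R\<in>T \<sigma> \<tau> \<pi>. e R a b c (int (\<sigma> 1)) (int (\<tau> 1)) (int (\<pi> 1))))))
        = (\<Sum>\<sigma>\<in>?Q. sign \<sigma> * (\<Sum>x=int (\<sigma> 0)+1..int (\<sigma> 1). \<Sum>\<tau>\<in>?P. sign \<tau> *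
            (\<Sum>\<pi>\<in>?P. sign \<pi> * (\<Sum>R\<in>T \<sigma> \<tau> \<pi>. e1 R a b c x (int (\<tau> 1)) (int (\<pi> 1))))))"
      using sum_sign_pair[OF l, of "\<lambda>\<sigma> x. \<Sum>\<tau>\<in>?P. sign \<tau> * (\<Sum>\<pi>\<in>?P. sign \<pi> *
          (\<Sum>R\<in>T \<sigma> \<tau> \<pi>. e R a b c x (int (\<tau> 1)) (int (\<pi> 1))))"]
      by (simp add: T e1_def flip: sum_subtractf right_diff_distrib)
    show ?thesis
      using first unfolding second third unfolding stable_value_def e_def t_def T_def .
  qed
  then have eq: "stable_value l \<alpha> \<beta> \<gamma> = (\<lambda>a b c. \<Sum>\<sigma>\<in>?Q. sign \<sigma> * (\<Sum>x=int (\<sigma> 0)+1..int (\<sigma> 1).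
      \<Sum>\<tau>\<in>?Q. sign \<tau> * (\<Sum>y=int (\<tau> 0)+1..int (\<tau> 1).
      \<Sum>\<pi>\<in>?Q. sign \<pi> * (\<Sum>z=int (\<pi> 0)+1..int (\<pi> 1). \<Sum>R\<in>T \<sigma> \<tau> \<pi>. e3 R a b c x y z))))"
    by (intro ext)
  show ?thesis
    unfolding eq e3
    by (intro quasi_linear_sum quasi_linear_cmult quasi_linear_shift quasi_linear_core)
qed

section \<open>Reduced Kronecker coefficients\<close>

lemma psize_eq_sum:
  assumes "\<And>i. m \<le> i \<Longrightarrow> \<alpha> i = 0"
  shows "psize \<alpha> = (\<Sum>i<m. \<alpha> i)"
  unfolding psize_def
proof (rule sum.mono_neutral_left)
  show "{i. \<alpha> i \<noteq> 0} \<subseteq> {..<m}" using assms by (metis (mono_tags) lessThan_iff mem_Collect_eq not_le subsetI)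
qed auto

lemma pcons_simps [simp]: "pcons a \<alpha> 0 = a" "pcons a \<alpha> (Suc i) = \<alpha> i"
  by (simp_all add: pcons_def)

lemma psize_pcons:
  assumes "\<And>i. m \<le> i \<Longrightarrow> \<alpha> i = 0"
  shows "psize (pcons a \<alpha>) = a + psize \<alpha>"
proof -
  have "psize (pcons a \<alpha>) = (\<Sum>i<Suc m. pcons a \<alpha> i)"
  proof (rule psize_eq_sum)
    fix i assume "Suc m \<le> i"
    then show "pcons a \<alpha> i = 0" using assms by (cases i) auto
  qed
  then show ?thesis using psize_eq_sum[of m \<alpha>] assms
    by (simp add: sum.lessThan_Suc_shift del: sum.lessThan_Suc)
qed

lemma antimono_pcons:
  assumes "antimono \<alpha>" "\<alpha> 0 \<le> a"
  shows "antimono (pcons a \<alpha>)"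
proof (rule decseq_SucI)
  fix i show "pcons a \<alpha> (Suc i) \<le> pcons a \<alpha> i"
    using assms antimonoD[of \<alpha> "i - 1" i] by (cases i) auto
qed

text \<open>Two rows precede \<alpha>, the padding row and the row a, hence m + 2. The bound on n
  says that the padding row n - (a + |\<alpha>|) is at least a, so the padded sequence is weakly
  decreasing.\<close>

lemma padded_shape:
  assumes \<alpha>: "antimono \<alpha>" "\<And>i. m \<le> i \<Longrightarrow> \<alpha> i = 0" and a: "\<alpha> 0 \<le> a" and n: "2 * a + psize \<alpha> \<le> n"
  shows "partition_shape (pad (pcons a \<alpha>) n) (m + 2) n"
proof
  have ps: "psize (pcons a \<alpha>) = a + psize \<alpha>" by (rule psize_pcons[OF \<alpha>(2)])
  show "antimono (pad (pcons a \<alpha>) n)"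
    unfolding pad_def ps by (intro antimono_pcons \<alpha>(1) a) (use n in simp)
  show "pad (pcons a \<alpha>) n i = 0" if i: "m + 2 \<le> i" for i
  proof -
    obtain j where "i = m + 2 + j" using le_Suc_ex[OF i] by blast
    then have "i = Suc (Suc (m + j))" by simp
    then show ?thesis unfolding pad_def using \<alpha>(2) by simp
  qed
  show "n = (\<Sum>i<m + 2. pad (pcons a \<alpha>) n i)"
    unfolding pad_def ps using n psize_eq_sum[of m \<alpha>] \<alpha>(2) by (simp add: sum.lessThan_Suc_shift del: sum.lessThan_Suc)
qed

lemma shifted_pad:
  "shifted (pad (pcons a \<alpha>) n) \<sigma> 1 = int a + int (\<sigma> 1) - 1"
  "2 \<le> i \<Longrightarrow> shifted (pad (pcons a \<alpha>) n) \<sigma> i = tail_margin \<alpha> \<sigma> i"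
proof -
  show "shifted (pad (pcons a \<alpha>) n) \<sigma> 1 = int a + int (\<sigma> 1) - 1"
    unfolding shifted_def pad_def by simp
  assume "2 \<le> i"
  then obtain j where "i = Suc (Suc j)" by (metis add_2_eq_Suc le_Suc_ex)
  then show "shifted (pad (pcons a \<alpha>) n) \<sigma> i = tail_margin \<alpha> \<sigma> i"
    unfolding shifted_def pad_def tail_margin_def by simp
qed

text \<open>\<open>\<sigma> 0\<close> is not negative, so the margin at row 0 is at least n - |(a,
  \<alpha>)|, while all margins add up to n.\<close>

lemma sum_shifted_pad_le:
  assumes sh: "partition_shape (pad (pcons a \<alpha>) n) l n" and \<sigma>: "\<sigma> permutes {..<l}" and l: "0 < l"
    and n: "psize (pcons a \<alpha>) \<le> n"
  shows "(\<Sum>i=1..<l. shifted (pad (pcons a \<alpha>) n) \<sigma> i) \<le> int (psize (pcons a \<alpha>))"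
proof -
  let ?s = "shifted (pad (pcons a \<alpha>) n) \<sigma>"
  have "(\<Sum>i<l. ?s i) = ?s 0 + (\<Sum>i=1..<l. ?s i)"
    using l by (simp add: lessThan_atLeast0 sum.atLeast_Suc_lessThan)
  moreover have "?s 0 \<ge> int n - int (psize (pcons a \<alpha>))"
    unfolding shifted_def pad_def using n by simp
  ultimately show ?thesis using partition_shape.sum_shifted[OF sh \<sigma>] by linarith
qed

text \<open>The bound on n serves twice: it makes the three padded sequences partitions of n, and it
  makes n at least the sum of the three sizes, so that the corner entry is never negative. The
  surviving margins no longer involve n.\<close>

lemma kronecker_stable:
  assumes \<alpha>: "antimono \<alpha>" "\<And>i. m \<le> i \<Longrightarrow> \<alpha> i = 0" "\<alpha> 0 \<le> a"
    and \<beta>: "antimono \<beta>" "\<And>i. m \<le> i \<Longrightarrow> \<beta> i = 0" "\<beta> 0 \<le> b"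
    and \<gamma>: "antimono \<gamma>" "\<And>i. m \<le> i \<Longrightarrow> \<gamma> i = 0" "\<gamma> 0 \<le> c"
    and n: "2 * (a + b + c) + psize \<alpha> + psize \<beta> + psize \<gamma> \<le> n"
  shows "int (kronecker (pad (pcons a \<alpha>) n) (pad (pcons b \<beta>) n) (pad (pcons c \<gamma>) n))
    = stable_value (m + 2) \<alpha> \<beta> \<gamma> (int a) (int b) (int c)"
proof -
  let ?l = "m + 2"
  let ?P = "{p. p permutes {..<?l}}"
  let ?a = "shifted (pad (pcons a \<alpha>) n)" and ?b = "shifted (pad (pcons b \<beta>) n)" and ?c = "shifted (pad (pcons c \<gamma>) n)"
  have sh: "partition_shape (pad (pcons a \<alpha>) n) ?l n" "partition_shape (pad (pcons b \<beta>) n) ?l n"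
    "partition_shape (pad (pcons c \<gamma>) n) ?l n"
    by (rule padded_shape[OF \<alpha>] padded_shape[OF \<beta>] padded_shape[OF \<gamma>]; use n in simp)+
  have ps: "psize (pcons a \<alpha>) = a + psize \<alpha>" "psize (pcons b \<beta>) = b + psize \<beta>" "psize (pcons c \<gamma>) = c + psize \<gamma>"
    using psize_pcons[OF \<alpha>(2)] psize_pcons[OF \<beta>(2)] psize_pcons[OF \<gamma>(2)] by auto
  have count: "int (cube_count ?l n (?a \<sigma>) (?b \<tau>) (?c \<pi>))
      = (\<Sum>R\<in>tables 2 ?l (tail_margin \<alpha> \<sigma>) (tail_margin \<beta> \<tau>) (tail_margin \<gamma> \<pi>).
         corner_count (cells 1 2) (int a + int (\<sigma> 1) - 1 - int (count (proj1 R) 1))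
           (int b + int (\<tau> 1) - 1 - int (count (proj2 R) 1)) (int c + int (\<pi> 1) - 1 - int (count (proj3 R) 1)))"
    if p: "\<sigma> \<in> ?P" "\<tau> \<in> ?P" "\<pi> \<in> ?P" for \<sigma> \<tau> \<pi>
  proof -
    have "cube_count ?l n (?a \<sigma>) (?b \<tau>) (?c \<pi>) = card (tables 1 ?l (?a \<sigma>) (?b \<tau>) (?c \<pi>))"
    proof (rule cube_count_stable)
      show "(\<Sum>i<?l. ?a \<sigma> i) = int n" "(\<Sum>i<?l. ?b \<tau> i) = int n" "(\<Sum>i<?l. ?c \<pi> i) = int n"
        using partition_shape.sum_shifted[OF sh(1)] partition_shape.sum_shifted[OF sh(2)]
          partition_shape.sum_shifted[OF sh(3)] p by auto
      have "(\<Sum>i=1..<?l. ?a \<sigma> i) \<le> int (psize (pcons a \<alpha>))" "(\<Sum>i=1..<?l. ?b \<tau> i) \<le> int (psize (pcons b \<beta>))"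
        "(\<Sum>i=1..<?l. ?c \<pi> i) \<le> int (psize (pcons c \<gamma>))"
        by (rule sum_shifted_pad_le[OF sh(1)] sum_shifted_pad_le[OF sh(2)] sum_shifted_pad_le[OF sh(3)];
            use p n ps in simp)+
      moreover have "int (a + psize \<alpha>) + int (b + psize \<beta>) + int (c + psize \<gamma>) \<le> int n"
        unfolding of_nat_add[symmetric] of_nat_le_iff using n by simp
      ultimately show "(\<Sum>i=1..<?l. ?a \<sigma> i + ?b \<tau> i + ?c \<pi> i) \<le> int n"
        unfolding sum.distrib ps by (elim order_trans[OF add_mono[OF add_mono]])
    qed simp
    moreover have "tables 2 ?l (?a \<sigma>) (?b \<tau>) (?c \<pi>)
        = tables 2 ?l (tail_margin \<alpha> \<sigma>) (tail_margin \<beta> \<tau>) (tail_margin \<gamma> \<pi>)"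
      by (rule tables_cong) (simp add: shifted_pad(2))
    ultimately show ?thesis using card_tables_split[of ?l "?a \<sigma>" "?b \<tau>" "?c \<pi>"] by (simp only: shifted_pad(1))
  qed
  have "int (kronecker (pad (pcons a \<alpha>) n) (pad (pcons b \<beta>) n) (pad (pcons c \<gamma>) n))
      = (\<Sum>\<sigma>\<in>?P. sign \<sigma> * (\<Sum>\<tau>\<in>?P. sign \<tau> * (\<Sum>\<pi>\<in>?P. sign \<pi> * int (cube_count ?l n (?a \<sigma>) (?b \<tau>) (?c \<pi>)))))"
    unfolding kronecker_eq[OF sh] by (simp only: sum_distrib_left mult.assoc)
  also have "\<dots> = stable_value ?l \<alpha> \<beta> \<gamma> (int a) (int b) (int c)"
    unfolding stable_value_def by (intro sum.cong refl arg_cong2[where f = "(*)"] count)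
  finally show ?thesis .
qed

lemma reduced_kronecker_eq_stable_value:
  assumes \<alpha>: "antimono \<alpha>" "\<And>i. m \<le> i \<Longrightarrow> \<alpha> i = 0" "\<alpha> 0 \<le> a"
    and \<beta>: "antimono \<beta>" "\<And>i. m \<le> i \<Longrightarrow> \<beta> i = 0" "\<beta> 0 \<le> b"
    and \<gamma>: "antimono \<gamma>" "\<And>i. m \<le> i \<Longrightarrow> \<gamma> i = 0" "\<gamma> 0 \<le> c"
  shows "int (reduced_kronecker (pcons a \<alpha>) (pcons b \<beta>) (pcons c \<gamma>))
    = stable_value (m + 2) \<alpha> \<beta> \<gamma> (int a) (int b) (int c)"
proof -
  let ?k = "\<lambda>n. kronecker (pad (pcons a \<alpha>) n) (pad (pcons b \<beta>) n) (pad (pcons c \<gamma>) n)"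
  let ?v = "stable_value (m + 2) \<alpha> \<beta> \<gamma> (int a) (int b) (int c)"
  let ?N = "2 * (a + b + c) + psize \<alpha> + psize \<beta> + psize \<gamma>"
  have k: "int (?k n) = ?v" if "?N \<le> n" for n
    using kronecker_stable[OF \<alpha> \<beta> \<gamma> that] .
  have "?k n = nat ?v" if "?N \<le> n" for n
    unfolding k[OF that, symmetric] by (rule nat_int[symmetric])
  then have "eventually (\<lambda>n. ?k n = nat ?v) sequentially"
    unfolding eventually_sequentially by (intro exI[of _ ?N] allI impI)
  then have "?k \<longlonglongrightarrow> nat ?v" by (rule tendsto_eventually)
  then have "reduced_kronecker (pcons a \<alpha>) (pcons b \<beta>) (pcons c \<gamma>) = nat ?v"
    unfolding reduced_kronecker_def by (rule limI)
  \<comment> \<open>The value is itself a Kronecker coefficient, hence nonnegative, and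
    \<open>nat\<close> loses nothing.\<close>
  moreover have "0 \<le> ?v" unfolding k[OF order_refl, symmetric] by (rule of_nat_0_le_iff)
  ultimately show ?thesis by simp
qed

theorem theorem6p1:
  fixes \<alpha> \<beta> \<gamma> :: "nat \<Rightarrow> nat"
  assumes "is_partition \<alpha>" and "is_partition \<beta>" and "is_partition \<gamma>"
  shows "\<exists>(k1::int) (k2::int) (k3::int) (A::int) (B::int) (C::int).
    \<forall>a b c :: nat.
      a \<ge> \<alpha> 0 \<longrightarrow> b \<ge> \<beta> 0 \<longrightarrow> c \<ge> \<gamma> 0 \<longrightarrow>
      int a - int b \<ge> k1 \<longrightarrow> int a - int c \<ge> k2 \<longrightarrow> int b + int c - int a \<ge> k3 \<longrightarrow>
      real (reduced_kronecker (pcons a \<alpha>) (pcons b \<beta>) (pcons c \<gamma>)) =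
        1 / 2 * real_of_int A * real_of_int (int b + int c - int a) + real_of_int B
        - (if even (int b + int c - int a) then 0 else 1 / 2 * real_of_int C)"
proof -
  have "finite ({i. \<alpha> i \<noteq> 0} \<union> {i. \<beta> i \<noteq> 0} \<union> {i. \<gamma> i \<noteq> 0})"
    using assms unfolding is_partition_def by simp
  \<comment> \<open>A common bound lets the three partitions share the number m + 2 of rows.\<close>
  then obtain m where m: "\<forall>i\<in>{i. \<alpha> i \<noteq> 0} \<union> {i. \<beta> i \<noteq> 0} \<union> {i. \<gamma> i \<noteq> 0}. i < m"
    using finite_nat_set_iff_bounded by blast
  have zero: "\<alpha> i = 0" "\<beta> i = 0" "\<gamma> i = 0" if "m \<le> i" for i
  proof -
    have "i \<notin> {i. \<alpha> i \<noteq> 0} \<union> {i. \<beta> i \<noteq> 0} \<union> {i. \<gamma> i \<noteq> 0}"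
      using m that by (meson not_le)
    then show "\<alpha> i = 0" "\<beta> i = 0" "\<gamma> i = 0" by auto
  qed
  have anti: "antimono \<alpha>" "antimono \<beta>" "antimono \<gamma>" using assms unfolding is_partition_def by auto
  obtain k1 k2 k3 A B C where q: "\<forall>a b c. a - b \<ge> k1 \<longrightarrow> a - c \<ge> k2 \<longrightarrow> b + c - a \<ge> k3 \<longrightarrow>
      2 * stable_value (m + 2) \<alpha> \<beta> \<gamma> a b c
        = A * (b + c - a) + 2 * B - (if even (b + c - a) then 0 else C)"
    using quasi_linear_stable_value[of "m + 2" \<alpha> \<beta> \<gamma>, OF le_add2]
    unfolding quasi_linear_def by (elim exE conjE) (rule that)
  show ?thesis
  proof (intro exI allI impI)
    fix a b c :: nat
    assume abc: "\<alpha> 0 \<le> a" "\<beta> 0 \<le> b" "\<gamma> 0 \<le> c"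
      and k: "k1 \<le> int a - int b" "k2 \<le> int a - int c" "k3 \<le> int b + int c - int a"
    let ?r = "reduced_kronecker (pcons a \<alpha>) (pcons b \<beta>) (pcons c \<gamma>)" and ?N = "int b + int c - int a"
    have "int ?r = stable_value (m + 2) \<alpha> \<beta> \<gamma> (int a) (int b) (int c)"
      by (rule reduced_kronecker_eq_stable_value) (use anti zero abc in auto)
    then have "2 * int ?r = A * ?N + 2 * B - (if even ?N then 0 else C)" using q[rule_format, OF k] by simp
    then have "real_of_int (2 * int ?r) = real_of_int (A * ?N + 2 * B - (if even ?N then 0 else C))"
      by (simp only:)
    then show "real ?r = 1 / 2 * real_of_int A * real_of_int ?N + real_of_int B
        - (if even ?N then 0 else 1 / 2 * real_of_int C)"
      by (auto simp: field_simps split: if_splits)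
  qed
qed

end
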